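(* A pointed category $\mathcal C$ has kernels if and only if there is an almost strict supercoherent structure $X_\bullet$ together with an isomorphism $N_\bullet(\mathcal C)\cong \mathrm{dec}(X)_\bullet$ of simplicial objects in $\mathsf{Cat}$.
   Context: All categories are small and the axiom of choice is assumed. A pointed category is a category with a chosen object $0$ that is both initial and terminal; $!_a\colon a\to0$, $!^a\colon0\to a$ are the unique morphisms; a zero morphism is one factoring through $0$. $\mathcal C$ has (algebraic) kernels if every $f\colon a\to b$ has a chosen $\kappa_f\colon\ker f\to a$ such that $f\kappa_f$ is zero; $\kappa_{\mathrm{id}_a}=\,!^a$ and $\kappa_{!_a}=\mathrm{id}_a$ for all $a$; and for every $g\colon c\to a$ with $fg$ zero there is a unique $h\colon c\to\ker f$ with $\kappa_fh=g$. Nerve: $N_n(\mathcal C)$, $n\ge0$, is the functor category $[\{0<1<\dots<n\},\mathcal C]$ of chains $a_0\xrightarrow{f_1}a_1\to\cdots\xrightarrow{f_n}a_n$ with commutative ladders as morphisms. With the standard simplicial operators $d_i$ (omit the $i$-th vertex) and $s_j$ (repeat the $j$-th vertex, inserting an identity) it is a simplicial object $N_\bullet(\mathcal C)$ in $\mathsf{Cat}$. An almost strict supercoherent structure $X_\bullet$ consists of categories $X_n$, $n\ge0$, with $X_0$ the terminal category, functors $d_i\colon X_n\to X_{n-1}$ ($n\ge1$, $0\le i\le n$) and $s_j\colon X_n\to X_{n+1}$ ($n\ge 0$, $0\le j\le n$) satisfying the standard simplicial identities $d_id_j=d_{j-1}d_i$ ($i<j$), $s_is_j=s_{j+1}s_i$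 ($i\le j$), $d_is_j=s_{j-1}d_i$ ($i<j$), $d_is_j=\mathrm{id}$ ($i=j,j+1$), $d_is_j=s_jd_{i-1}$ ($i>j+1$), except that the identity $d_{n-1}d_n=d_{n-1}d_{n-1}$ of functors $X_n\to X_{n-2}$, $n\geq 2$, is replaced by a natural transformation $\alpha_n\colon d_{n-1}d_n\Rightarrow d_{n-1}d_{n-1}$. These are required to satisfy the following coherence conditions (juxtaposition is whiskering, $\square$ is vertical composition, right factor first): (C1) $d_i\alpha_n=\alpha_{n-1}d_i$ for $n\ge3$, $0\le i\le n-3$; (C2) $(\alpha_{n-1}d_{n-1})\,\square\,(d_{n-2}\alpha_n)=(\alpha_{n-1}d_{n-2})\,\square\,(\alpha_{n-1}d_n)$ for $n\ge3$; (C3) $\alpha_{n+1}s_n=\mathrm{id}_{d_n}$ and $\alpha_{n+1}s_{n-1}=\mathrm{id}_{d_n}$ for $n\ge1$; (C4) $\alpha_{n+1}s_k=s_k\alpha_n$ for $n\ge2$, $0\le k\le n-2$. The upper décalage $\mathrm{dec}(X)_\bullet$ has $\mathrm{dec}(X)_n=X_{n+1}$, $n\ge0$, with operators $d_i\colon X_{n+1}\to X_n$ ($n\geq 1$, $0\le i\le n$) and $s_j\colon X_{n+1}\to X_{n+2}$ ($0\le j\le n$) of $X_\bullet$; the top operators $d_{n+1}\colon X_{n+1}\to X_n$ and $s_{n+1}\colon X_{n+1}\to X_{n+2}$ are forgotten. Since the exceptional relations involve the forgotten operators, this is an honest simplicial object in $\mathsf{Cat}$. *)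

theory Defs
  imports Main "HOL-Library.FuncSet"
begin

section \<open>Small categories, functors, natural transformations\<close>

record ('o, 'a) cat =
  Obj :: "'o set"
  Arr :: "'a set"
  Dom :: "'a \<Rightarrow> 'o"
  Cod :: "'a \<Rightarrow> 'o"
  Idt :: "'o \<Rightarrow> 'a"
  Cmp :: "'a \<Rightarrow> 'a \<Rightarrow> 'a"

text \<open>Composition is written with the right factor applied first.\<close>

notation Cmp (\<open>(_ \<cdot>\<index> _)\<close> [71, 70] 70)

definition hom :: "('o, 'a) cat \<Rightarrow> 'o \<Rightarrow> 'o \<Rightarrow> 'a set" where
  "hom C a b = {f \<in> Arr C. Dom C f = a \<and> Cod C f = b}"

locale category =
  fixes C :: "('o, 'a) cat" (structure)
  assumes Dom_Obj: "f \<in> Arr C \<Longrightarrow> Dom C f \<in> Obj C"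
    and Cod_Obj: "f \<in> Arr C \<Longrightarrow> Cod C f \<in> Obj C"
    and Idt_hom: "a \<in> Obj C \<Longrightarrow> Idt C a \<in> hom C a a"
    and Cmp_hom: "f \<in> hom C a b \<Longrightarrow> g \<in> hom C b c \<Longrightarrow> g \<cdot> f \<in> hom C a c"
    and Cmp_Idt: "f \<in> hom C a b \<Longrightarrow> f \<cdot> Idt C a = f"
    and Idt_Cmp: "f \<in> hom C a b \<Longrightarrow> Idt C b \<cdot> f = f"
    and Cmp_assoc: "f \<in> hom C a b \<Longrightarrow> g \<in> hom C b c \<Longrightarrow> h \<in> hom C c d \<Longrightarrow>
                      (h \<cdot> g) \<cdot> f = h \<cdot> (g \<cdot> f)"

text \<open>The two maps of a functor are required to be extensional, i.e. \<^const>\<open>undefined\<close>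
  outside the objects and arrows of the source, so that equality of functors is equality
  of records.  The same convention is used for natural transformations, which are given
  by their families of components.\<close>

record ('o, 'a, 'p, 'b) ftor =
  ObjMap :: "'o \<Rightarrow> 'p"
  ArrMap :: "'a \<Rightarrow> 'b"

locale is_functor = A: category A + B: category B
  for A :: "('o, 'a) cat" and B :: "('p, 'b) cat" +
  fixes F :: "('o, 'a, 'p, 'b) ftor"
  assumes ObjMap_ext: "ObjMap F \<in> Obj A \<rightarrow>\<^sub>E Obj B"
    and ArrMap_ext: "ArrMap F \<in> extensional (Arr A)"
    and ArrMap_hom: "f \<in> hom A a b \<Longrightarrow> ArrMap F f \<in> hom B (ObjMap F a) (ObjMap F b)"
    and ArrMap_Idt: "a \<in> Obj A \<Longrightarrow> ArrMap F (Idt A a) = Idt B (ObjMap F a)"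
    and ArrMap_Cmp: "f \<in> hom A a b \<Longrightarrow> g \<in> hom A b c \<Longrightarrow>
                       ArrMap F (g \<cdot>\<^bsub>A\<^esub> f) = ArrMap F g \<cdot>\<^bsub>B\<^esub> ArrMap F f"

definition id_ftor :: "('o, 'a) cat \<Rightarrow> ('o, 'a, 'o, 'a) ftor" where
  "id_ftor A = \<lparr>ObjMap = \<lambda>a\<in>Obj A. a, ArrMap = \<lambda>f\<in>Arr A. f\<rparr>"

text \<open>The category argument is the source of the composite.\<close>

definition comp_ftor ::
  "('p, 'b, 'q, 'c) ftor \<Rightarrow> ('o, 'a) cat \<Rightarrow> ('o, 'a, 'p, 'b) ftor \<Rightarrow> ('o, 'a, 'q, 'c) ftor"
  (\<open>(_ \<odot>\<^bsub>_\<^esub> _)\<close> [71, 0, 70] 70) where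
  "G \<odot>\<^bsub>A\<^esub> F = \<lparr>ObjMap = \<lambda>a\<in>Obj A. ObjMap G (ObjMap F a),
                  ArrMap = \<lambda>f\<in>Arr A. ArrMap G (ArrMap F f)\<rparr>"

definition iso_ftor :: "('o, 'a) cat \<Rightarrow> ('p, 'b) cat \<Rightarrow> ('o, 'a, 'p, 'b) ftor \<Rightarrow> bool" where
  "iso_ftor A B F \<longleftrightarrow> is_functor A B F \<and>
     (\<exists>G. is_functor B A G \<and> G \<odot>\<^bsub>A\<^esub> F = id_ftor A \<and> F \<odot>\<^bsub>B\<^esub> G = id_ftor B)"

locale is_nat_trans = F: is_functor A B F + G: is_functor A B G
  for A :: "('o, 'a) cat" and B :: "('p, 'b) cat" and F G +
  fixes \<tau> :: "'o \<Rightarrow> 'b"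
  assumes component_ext: "\<tau> \<in> extensional (Obj A)"
    and component_hom: "a \<in> Obj A \<Longrightarrow> \<tau> a \<in> hom B (ObjMap F a) (ObjMap G a)"
    and naturality: "f \<in> hom A a b \<Longrightarrow> \<tau> b \<cdot>\<^bsub>B\<^esub> ArrMap F f = ArrMap G f \<cdot>\<^bsub>B\<^esub> \<tau> a"

definition id_nat :: "('o, 'a) cat \<Rightarrow> ('p, 'b) cat \<Rightarrow> ('o, 'a, 'p, 'b) ftor \<Rightarrow> 'o \<Rightarrow> 'b" where
  "id_nat A B F = (\<lambda>a\<in>Obj A. Idt B (ObjMap F a))"

definition vcomp ::
  "('o, 'a) cat \<Rightarrow> ('p, 'b) cat \<Rightarrow> ('o \<Rightarrow> 'b) \<Rightarrow> ('o \<Rightarrow> 'b) \<Rightarrow> 'o \<Rightarrow> 'b" where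
  "vcomp A B \<sigma> \<tau> = (\<lambda>a\<in>Obj A. \<sigma> a \<cdot>\<^bsub>B\<^esub> \<tau> a)"

text \<open>The whiskerings \<open>H \<tau>\<close> and \<open>\<tau> K\<close>; the category argument is the source of the
  resulting functors.\<close>

definition whisker_left ::
  "('o, 'a) cat \<Rightarrow> ('p, 'b, 'q, 'c) ftor \<Rightarrow> ('o \<Rightarrow> 'b) \<Rightarrow> 'o \<Rightarrow> 'c" where
  "whisker_left A H \<tau> = (\<lambda>a\<in>Obj A. ArrMap H (\<tau> a))"

definition whisker_right ::
  "('o, 'a) cat \<Rightarrow> ('p \<Rightarrow> 'c) \<Rightarrow> ('o, 'a, 'p, 'b) ftor \<Rightarrow> 'o \<Rightarrow> 'c" where
  "whisker_right A \<tau> K = (\<lambda>a\<in>Obj A. \<tau> (ObjMap K a))"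

text \<open>Arrows of the functor category carry their source and target.\<close>

definition fun_cat :: "('o, 'a) cat \<Rightarrow> ('p, 'b) cat \<Rightarrow>
    (('o, 'a, 'p, 'b) ftor,
     ('o, 'a, 'p, 'b) ftor \<times> ('o, 'a, 'p, 'b) ftor \<times> ('o \<Rightarrow> 'b)) cat" where
  "fun_cat A B =
     \<lparr>Obj = {F. is_functor A B F},
      Arr = {(F, G, \<tau>). is_nat_trans A B F G \<tau>},
      Dom = \<lambda>(F, G, \<tau>). F,
      Cod = \<lambda>(F, G, \<tau>). G,
      Idt = \<lambda>F. (F, F, id_nat A B F),
      Cmp = \<lambda>(F', G', \<sigma>) (F, G, \<tau>). (F, G', vcomp A B \<sigma> \<tau>)\<rparr>"

definition precomp :: "('o, 'a) cat \<Rightarrow> ('p, 'b) cat \<Rightarrow> ('q, 'c) cat \<Rightarrow> ('o, 'a, 'p, 'b) ftor \<Rightarrow>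
    (('p, 'b, 'q, 'c) ftor,
     ('p, 'b, 'q, 'c) ftor \<times> ('p, 'b, 'q, 'c) ftor \<times> ('p \<Rightarrow> 'c),
     ('o, 'a, 'q, 'c) ftor,
     ('o, 'a, 'q, 'c) ftor \<times> ('o, 'a, 'q, 'c) ftor \<times> ('o \<Rightarrow> 'c)) ftor" where
  "precomp A B C K =
     \<lparr>ObjMap = \<lambda>F\<in>Obj (fun_cat B C). F \<odot>\<^bsub>A\<^esub> K,
      ArrMap = \<lambda>(F, G, \<tau>)\<in>Arr (fun_cat B C). (F \<odot>\<^bsub>A\<^esub> K, G \<odot>\<^bsub>A\<^esub> K, whisker_right A \<tau> K)\<rparr>"

definition terminal_cat :: "('o, 'a) cat \<Rightarrow> bool" where
  "terminal_cat A \<longleftrightarrow> category A \<and> (\<exists>a. Obj A = {a}) \<and> (\<exists>f. Arr A = {f})"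


section \<open>Pointed categories and kernels\<close>

locale pointed_category = category C for C :: "('o, 'a) cat" (structure) +
  fixes z :: 'o
  assumes z_Obj: "z \<in> Obj C"
    and z_initial: "a \<in> Obj C \<Longrightarrow> \<exists>!f. f \<in> hom C z a"
    and z_terminal: "a \<in> Obj C \<Longrightarrow> \<exists>!f. f \<in> hom C a z"

definition to_zero :: "('o, 'a) cat \<Rightarrow> 'o \<Rightarrow> 'o \<Rightarrow> 'a" where
  "to_zero C z a = (THE f. f \<in> hom C a z)"

definition from_zero :: "('o, 'a) cat \<Rightarrow> 'o \<Rightarrow> 'o \<Rightarrow> 'a" where
  "from_zero C z a = (THE f. f \<in> hom C z a)"

definition zero_arrow :: "('o, 'a) cat \<Rightarrow> 'o \<Rightarrow> 'a \<Rightarrow> bool" where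
  "zero_arrow C z f \<longleftrightarrow>
     (\<exists>g \<in> hom C (Dom C f) z. \<exists>h \<in> hom C z (Cod C f). f = h \<cdot>\<^bsub>C\<^esub> g)"

text \<open>A choice \<open>\<kappa>\<close> of kernels; the object \<open>ker f\<close> is the domain of \<open>\<kappa> f\<close>.\<close>

definition kernel_choice :: "('o, 'a) cat \<Rightarrow> 'o \<Rightarrow> ('a \<Rightarrow> 'a) \<Rightarrow> bool" where
  "kernel_choice C z \<kappa> \<longleftrightarrow>
     (\<forall>f \<in> Arr C. \<kappa> f \<in> Arr C \<and> Cod C (\<kappa> f) = Dom C f \<and> zero_arrow C z (f \<cdot>\<^bsub>C\<^esub> \<kappa> f)) \<and>
     (\<forall>a \<in> Obj C. \<kappa> (Idt C a) = from_zero C z a) \<and>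
     (\<forall>a \<in> Obj C. \<kappa> (to_zero C z a) = Idt C a) \<and>
     (\<forall>f \<in> Arr C. \<forall>g \<in> Arr C. Cod C g = Dom C f \<longrightarrow> zero_arrow C z (f \<cdot>\<^bsub>C\<^esub> g) \<longrightarrow>
        (\<exists>!h. h \<in> hom C (Dom C g) (Dom C (\<kappa> f)) \<and> \<kappa> f \<cdot>\<^bsub>C\<^esub> h = g))"

definition has_kernels :: "('o, 'a) cat \<Rightarrow> 'o \<Rightarrow> bool" where
  "has_kernels C z \<longleftrightarrow> (\<exists>\<kappa>. kernel_choice C z \<kappa>)"


section \<open>Simplicial objects in Cat\<close>

text \<open>\<open>face X n i\<close> is \<open>d\<^sub>i : X\<^sub>n \<rightarrow> X\<^sub>n\<^sub>-\<^sub>1\<close> (for \<open>n \<ge> 1\<close>, \<open>i \<le> n\<close>) and \<open>degen X n j\<close> is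
  \<open>s\<^sub>j : X\<^sub>n \<rightarrow> X\<^sub>n\<^sub>+\<^sub>1\<close> (for \<open>j \<le> n\<close>); values at other indices are irrelevant.\<close>

record ('o, 'a) simp_data =
  Lev :: "nat \<Rightarrow> ('o, 'a) cat"
  face :: "nat \<Rightarrow> nat \<Rightarrow> ('o, 'a, 'o, 'a) ftor"
  degen :: "nat \<Rightarrow> nat \<Rightarrow> ('o, 'a, 'o, 'a) ftor"

text \<open>All the simplicial identities other than those between two face operators.\<close>

locale simplicial_base =
  fixes X :: "('o, 'a, 'm) simp_data_scheme"
  assumes category_Lev: "category (Lev X n)"
    and face_functor:
      "n \<ge> 1 \<Longrightarrow> i \<le> n \<Longrightarrow> is_functor (Lev X n) (Lev X (n - 1)) (face X n i)"
    and degen_functor: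
      "j \<le> n \<Longrightarrow> is_functor (Lev X n) (Lev X (n + 1)) (degen X n j)"
    and degen_degen: "i \<le> j \<Longrightarrow> j \<le> n \<Longrightarrow>
      degen X (n + 1) i \<odot>\<^bsub>Lev X n\<^esub> degen X n j = degen X (n + 1) (j + 1) \<odot>\<^bsub>Lev X n\<^esub> degen X n i"
    and face_degen_less: "i < j \<Longrightarrow> j \<le> n \<Longrightarrow>
      face X (n + 1) i \<odot>\<^bsub>Lev X n\<^esub> degen X n j = degen X (n - 1) (j - 1) \<odot>\<^bsub>Lev X n\<^esub> face X n i"
    and face_degen_id: "j \<le> n \<Longrightarrow> i = j \<or> i = j + 1 \<Longrightarrow>
      face X (n + 1) i \<odot>\<^bsub>Lev X n\<^esub> degen X n j = id_ftor (Lev X n)"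
    and face_degen_greater: "j + 1 < i \<Longrightarrow> i \<le> n + 1 \<Longrightarrow>
      face X (n + 1) i \<odot>\<^bsub>Lev X n\<^esub> degen X n j = degen X (n - 1) j \<odot>\<^bsub>Lev X n\<^esub> face X n (i - 1)"

locale simplicial_object = simplicial_base X for X :: "('o, 'a) simp_data" +
  assumes face_face: "n \<ge> 2 \<Longrightarrow> i < j \<Longrightarrow> j \<le> n \<Longrightarrow>
    face X (n - 1) i \<odot>\<^bsub>Lev X n\<^esub> face X n j = face X (n - 1) (j - 1) \<odot>\<^bsub>Lev X n\<^esub> face X n i"

locale simplicial_iso = S: simplicial_object S + T: simplicial_object T
  for S :: "('o, 'a) simp_data" and T :: "('p, 'b) simp_data" +
  fixes \<Phi> :: "nat \<Rightarrow> ('o, 'a, 'p, 'b) ftor"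
  assumes iso_Lev: "iso_ftor (Lev S n) (Lev T n) (\<Phi> n)"
    and iso_face: "n \<ge> 1 \<Longrightarrow> i \<le> n \<Longrightarrow>
      \<Phi> (n - 1) \<odot>\<^bsub>Lev S n\<^esub> face S n i = face T n i \<odot>\<^bsub>Lev S n\<^esub> \<Phi> n"
    and iso_degen: "j \<le> n \<Longrightarrow>
      \<Phi> (n + 1) \<odot>\<^bsub>Lev S n\<^esub> degen S n j = degen T n j \<odot>\<^bsub>Lev S n\<^esub> \<Phi> n"


section \<open>The nerve\<close>

definition ord_cat :: "nat \<Rightarrow> (nat, nat \<times> nat) cat" where
  "ord_cat n =
     \<lparr>Obj = {..n},
      Arr = {(i, j). i \<le> j \<and> j \<le> n},
      Dom = fst,
      Cod = snd,
      Idt = \<lambda>i. (i, i),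
      Cmp = \<lambda>g f. (fst f, snd g)\<rparr>"

definition mono_ftor :: "nat \<Rightarrow> (nat \<Rightarrow> nat) \<Rightarrow> (nat, nat \<times> nat, nat, nat \<times> nat) ftor" where
  "mono_ftor m \<phi> =
     \<lparr>ObjMap = \<lambda>i\<in>Obj (ord_cat m). \<phi> i,
      ArrMap = \<lambda>(i, j)\<in>Arr (ord_cat m). (\<phi> i, \<phi> j)\<rparr>"

definition coface :: "nat \<Rightarrow> nat \<Rightarrow> nat" where
  "coface i k = (if k < i then k else k + 1)"

definition codegen :: "nat \<Rightarrow> nat \<Rightarrow> nat" where
  "codegen j k = (if k \<le> j then k else k - 1)"

type_synonym ('o, 'a) nerve_obj = "(nat, nat \<times> nat, 'o, 'a) ftor"

type_synonym ('o, 'a) nerve_arr =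
  "('o, 'a) nerve_obj \<times> ('o, 'a) nerve_obj \<times> (nat \<Rightarrow> 'a)"

definition nerve ::
  "('o, 'a) cat \<Rightarrow> (('o, 'a) nerve_obj, ('o, 'a) nerve_arr) simp_data" where
  "nerve C =
     \<lparr>Lev = \<lambda>n. fun_cat (ord_cat n) C,
      face = \<lambda>n i. precomp (ord_cat (n - 1)) (ord_cat n) C (mono_ftor (n - 1) (coface i)),
      degen = \<lambda>n j. precomp (ord_cat (n + 1)) (ord_cat n) C (mono_ftor (n + 1) (codegen j))\<rparr>"


section \<open>Almost strict supercoherent structures\<close>

record ('o, 'a) supercoh_data = "('o, 'a) simp_data" +
  alpha :: "nat \<Rightarrow> 'o \<Rightarrow> 'a"

locale almost_strict_supercoherent = simplicial_base X
  for X :: "('o, 'a) supercoh_data" +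
  assumes terminal_0: "terminal_cat (Lev X 0)"
    and face_face: "n \<ge> 2 \<Longrightarrow> i < j \<Longrightarrow> j \<le> n \<Longrightarrow> \<not> (i = n - 1 \<and> j = n) \<Longrightarrow>
      face X (n - 1) i \<odot>\<^bsub>Lev X n\<^esub> face X n j = face X (n - 1) (j - 1) \<odot>\<^bsub>Lev X n\<^esub> face X n i"
    and alpha_nat: "n \<ge> 2 \<Longrightarrow> is_nat_trans (Lev X n) (Lev X (n - 2))
      (face X (n - 1) (n - 1) \<odot>\<^bsub>Lev X n\<^esub> face X n n)
      (face X (n - 1) (n - 1) \<odot>\<^bsub>Lev X n\<^esub> face X n (n - 1))
      (alpha X n)"
    and C1: "n \<ge> 3 \<Longrightarrow> i \<le> n - 3 \<Longrightarrow>
      whisker_left (Lev X n) (face X (n - 2) i) (alpha X n) =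
      whisker_right (Lev X n) (alpha X (n - 1)) (face X n i)"
    and C2: "n \<ge> 3 \<Longrightarrow>
      vcomp (Lev X n) (Lev X (n - 3))
        (whisker_right (Lev X n) (alpha X (n - 1)) (face X n (n - 1)))
        (whisker_left (Lev X n) (face X (n - 2) (n - 2)) (alpha X n)) =
      vcomp (Lev X n) (Lev X (n - 3))
        (whisker_right (Lev X n) (alpha X (n - 1)) (face X n (n - 2)))
        (whisker_right (Lev X n) (alpha X (n - 1)) (face X n n))"
    and C3: "n \<ge> 1 \<Longrightarrow>
      whisker_right (Lev X n) (alpha X (n + 1)) (degen X n n) =
        id_nat (Lev X n) (Lev X (n - 1)) (face X n n)"
      "n \<ge> 1 \<Longrightarrow>
      whisker_right (Lev X n) (alpha X (n + 1)) (degen X n (n - 1)) =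
        id_nat (Lev X n) (Lev X (n - 1)) (face X n n)"
    and C4: "n \<ge> 2 \<Longrightarrow> k \<le> n - 2 \<Longrightarrow>
      whisker_right (Lev X n) (alpha X (n + 1)) (degen X n k) =
      whisker_left (Lev X n) (degen X (n - 2) k) (alpha X n)"

definition dec :: "('o, 'a) supercoh_data \<Rightarrow> ('o, 'a) simp_data" where
  "dec X =
     \<lparr>Lev = \<lambda>n. Lev X (n + 1),
      face = \<lambda>n i. face X (n + 1) i,
      degen = \<lambda>n j. degen X (n + 1) j\<rparr>"


section \<open>The nerve and the upper decalage are simplicial objects\<close>

lemma simplicial_object_dec:
  assumes "almost_strict_supercoherent X"
  shows "simplicial_object (dec X)"
proof -
  interpret almost_strict_supercoherent X by fact
  show ?thesis
  proof (intro simplicial_object.intro simplicial_base.intro simplicial_object_axioms.intro)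
    fix n i j :: nat
    show "category (Lev (dec X) n)" by (simp add: dec_def category_Lev)
    show "is_functor (Lev (dec X) n) (Lev (dec X) (n - 1)) (face (dec X) n i)"
      if "n \<ge> 1" "i \<le> n" using that face_functor[of "n + 1" i] by (simp add: dec_def)
    show "is_functor (Lev (dec X) n) (Lev (dec X) (n + 1)) (degen (dec X) n j)"
      if "j \<le> n" using that degen_functor[of j "n + 1"] by (simp add: dec_def)
    show "degen (dec X) (n + 1) i \<odot>\<^bsub>Lev (dec X) n\<^esub> degen (dec X) n j =
          degen (dec X) (n + 1) (j + 1) \<odot>\<^bsub>Lev (dec X) n\<^esub> degen (dec X) n i"
      if "i \<le> j" "j \<le> n" using that degen_degen[of i j "n + 1"] by (simp add: dec_def)
    show "face (dec X) (n + 1) i \<odot>\<^bsub>Lev (dec X) n\<^esub> degen (dec X) n j =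
          degen (dec X) (n - 1) (j - 1) \<odot>\<^bsub>Lev (dec X) n\<^esub> face (dec X) n i"
      if "i < j" "j \<le> n" using that face_degen_less[of i j "n + 1"] by (simp add: dec_def)
    show "face (dec X) (n + 1) i \<odot>\<^bsub>Lev (dec X) n\<^esub> degen (dec X) n j = id_ftor (Lev (dec X) n)"
      if "j \<le> n" "i = j \<or> i = j + 1"
      using that face_degen_id[of j "n + 1" i] by (simp add: dec_def)
    show "face (dec X) (n + 1) i \<odot>\<^bsub>Lev (dec X) n\<^esub> degen (dec X) n j =
          degen (dec X) (n - 1) j \<odot>\<^bsub>Lev (dec X) n\<^esub> face (dec X) n (i - 1)"
      if "j + 1 < i" "i \<le> n + 1"
      using that face_degen_greater[of j i "n + 1"] by (simp add: dec_def)
    show "face (dec X) (n - 1) i \<odot>\<^bsub>Lev (dec X) n\<^esub> face (dec X) n j =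
          face (dec X) (n - 1) (j - 1) \<odot>\<^bsub>Lev (dec X) n\<^esub> face (dec X) n i"
      if "n \<ge> 2" "i < j" "j \<le> n" using that face_face[of "n + 1" i j] by (simp add: dec_def)
  qed
qed

lemma category_ord_cat: "category (ord_cat n)"
  by unfold_locales (auto simp: ord_cat_def hom_def)

lemma is_functor_comp:
  assumes "is_functor A B F" "is_functor B C G"
  shows "is_functor A C (G \<odot>\<^bsub>A\<^esub> F)"
proof -
  interpret F: is_functor A B F by fact
  interpret G: is_functor B C G by fact
  have ob: "a \<in> Obj A" "b \<in> Obj A" "f \<in> Arr A" if "f \<in> hom A a b" for f a b
    using that F.A.Dom_Obj F.A.Cod_Obj by (auto simp: hom_def)
  have F_ob: "ObjMap F a \<in> Obj B" if "a \<in> Obj A" for a using that F.ObjMap_ext by auto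
  have G_ob: "ObjMap G a \<in> Obj C" if "a \<in> Obj B" for a using that G.ObjMap_ext by auto
  show ?thesis
  proof
    show "ObjMap (G \<odot>\<^bsub>A\<^esub> F) \<in> Obj A \<rightarrow>\<^sub>E Obj C" by (simp add: comp_ftor_def F_ob G_ob)
    show "ArrMap (G \<odot>\<^bsub>A\<^esub> F) \<in> extensional (Arr A)" by (simp add: comp_ftor_def)
  next
    fix f a b assume f: "f \<in> hom A a b"
    show "ArrMap (G \<odot>\<^bsub>A\<^esub> F) f \<in> hom C (ObjMap (G \<odot>\<^bsub>A\<^esub> F) a) (ObjMap (G \<odot>\<^bsub>A\<^esub> F) b)"
      using G.ArrMap_hom[OF F.ArrMap_hom[OF f]] ob[OF f] by (simp add: comp_ftor_def)
  next
    fix a assume a: "a \<in> Obj A"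
    show "ArrMap (G \<odot>\<^bsub>A\<^esub> F) (Idt A a) = Idt C (ObjMap (G \<odot>\<^bsub>A\<^esub> F) a)"
      using a ob(3)[OF F.A.Idt_hom[OF a]]
      by (simp add: comp_ftor_def F.ArrMap_Idt G.ArrMap_Idt F_ob)
  next
    fix f g a b c assume f: "f \<in> hom A a b" and g: "g \<in> hom A b c"
    show "ArrMap (G \<odot>\<^bsub>A\<^esub> F) (g \<cdot>\<^bsub>A\<^esub> f) = ArrMap (G \<odot>\<^bsub>A\<^esub> F) g \<cdot>\<^bsub>C\<^esub> ArrMap (G \<odot>\<^bsub>A\<^esub> F) f"
      using ob(3)[OF f] ob(3)[OF g] ob(3)[OF F.A.Cmp_hom[OF f g]]
        F.ArrMap_Cmp[OF f g] G.ArrMap_Cmp[OF F.ArrMap_hom[OF f] F.ArrMap_hom[OF g]]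
      by (simp add: comp_ftor_def)
  qed
qed

lemma is_nat_trans_id:
  assumes "is_functor A B F"
  shows "is_nat_trans A B F F (id_nat A B F)"
proof -
  interpret is_functor A B F by fact
  have ob: "a \<in> Obj A" "b \<in> Obj A" if "f \<in> hom A a b" for f a b
    using that A.Dom_Obj A.Cod_Obj by (auto simp: hom_def)
  show ?thesis
  proof
    show "id_nat A B F \<in> extensional (Obj A)" by (simp add: id_nat_def)
    show "id_nat A B F a \<in> hom B (ObjMap F a) (ObjMap F a)" if "a \<in> Obj A" for a
      using that ObjMap_ext B.Idt_hom by (auto simp: id_nat_def)
    show "id_nat A B F b \<cdot>\<^bsub>B\<^esub> ArrMap F f = ArrMap F f \<cdot>\<^bsub>B\<^esub> id_nat A B F a"
      if "f \<in> hom A a b" for f a b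
      using ob[OF that] ArrMap_hom[OF that] B.Cmp_Idt B.Idt_Cmp by (simp add: id_nat_def)
  qed
qed

lemma is_nat_trans_vcomp:
  assumes "is_nat_trans A B F G \<tau>" "is_nat_trans A B G H \<sigma>"
  shows "is_nat_trans A B F H (vcomp A B \<sigma> \<tau>)"
proof -
  interpret t: is_nat_trans A B F G \<tau> by fact
  interpret s: is_nat_trans A B G H \<sigma> by fact
  have ob: "a \<in> Obj A" "b \<in> Obj A" if "f \<in> hom A a b" for f a b
    using that t.F.A.Dom_Obj t.F.A.Cod_Obj by (auto simp: hom_def)
  show ?thesis
  proof
    show "vcomp A B \<sigma> \<tau> \<in> extensional (Obj A)" by (simp add: vcomp_def)
    show "vcomp A B \<sigma> \<tau> a \<in> hom B (ObjMap F a) (ObjMap H a)" if "a \<in> Obj A" for a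
      using t.F.B.Cmp_hom[OF t.component_hom[OF that] s.component_hom[OF that]] that
      by (simp add: vcomp_def)
    show "vcomp A B \<sigma> \<tau> b \<cdot>\<^bsub>B\<^esub> ArrMap F f = ArrMap H f \<cdot>\<^bsub>B\<^esub> vcomp A B \<sigma> \<tau> a"
      if f: "f \<in> hom A a b" for f a b
    proof -
      note t.component_hom[OF ob(1)[OF f]] t.component_hom[OF ob(2)[OF f]]
        s.component_hom[OF ob(1)[OF f]] s.component_hom[OF ob(2)[OF f]]
        t.F.ArrMap_hom[OF f] t.G.ArrMap_hom[OF f] s.G.ArrMap_hom[OF f]
      note h = this
      have "(\<sigma> b \<cdot>\<^bsub>B\<^esub> \<tau> b) \<cdot>\<^bsub>B\<^esub> ArrMap F f = \<sigma> b \<cdot>\<^bsub>B\<^esub> (ArrMap G f \<cdot>\<^bsub>B\<^esub> \<tau> a)"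
        using t.F.B.Cmp_assoc[OF h(5) h(2) h(4)] t.naturality[OF f] by simp
      also have "\<dots> = (ArrMap H f \<cdot>\<^bsub>B\<^esub> \<sigma> a) \<cdot>\<^bsub>B\<^esub> \<tau> a"
        using t.F.B.Cmp_assoc[OF h(1) h(6) h(4)] s.naturality[OF f] by simp
      also have "\<dots> = ArrMap H f \<cdot>\<^bsub>B\<^esub> (\<sigma> a \<cdot>\<^bsub>B\<^esub> \<tau> a)"
        using t.F.B.Cmp_assoc[OF h(1) h(3) h(7)] .
      finally show ?thesis using ob[OF f] by (simp add: vcomp_def)
    qed
  qed
qed

lemma is_nat_trans_whisker_right:
  assumes "is_functor A B K" "is_nat_trans B C F G \<tau>"
  shows "is_nat_trans A C (F \<odot>\<^bsub>A\<^esub> K) (G \<odot>\<^bsub>A\<^esub> K) (whisker_right A \<tau> K)"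
proof -
  interpret K: is_functor A B K by fact
  interpret t: is_nat_trans B C F G \<tau> by fact
  interpret FK: is_functor A C "F \<odot>\<^bsub>A\<^esub> K"
    using is_functor_comp[OF assms(1) t.F.is_functor_axioms] .
  interpret GK: is_functor A C "G \<odot>\<^bsub>A\<^esub> K"
    using is_functor_comp[OF assms(1) t.G.is_functor_axioms] .
  show ?thesis
  proof
    show "whisker_right A \<tau> K \<in> extensional (Obj A)" by (simp add: whisker_right_def)
    show "whisker_right A \<tau> K a \<in> hom C (ObjMap (F \<odot>\<^bsub>A\<^esub> K) a) (ObjMap (G \<odot>\<^bsub>A\<^esub> K) a)"
      if "a \<in> Obj A" for a
      using that K.ObjMap_ext t.component_hom[of "ObjMap K a"]
      by (auto simp: whisker_right_def comp_ftor_def)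
    show "whisker_right A \<tau> K b \<cdot>\<^bsub>C\<^esub> ArrMap (F \<odot>\<^bsub>A\<^esub> K) f =
          ArrMap (G \<odot>\<^bsub>A\<^esub> K) f \<cdot>\<^bsub>C\<^esub> whisker_right A \<tau> K a" if "f \<in> hom A a b" for f a b
      using that t.naturality[OF K.ArrMap_hom[OF that]] K.A.Dom_Obj K.A.Cod_Obj
      by (auto simp: whisker_right_def comp_ftor_def hom_def)
  qed
qed

lemma fun_cat_hom:
  "x \<in> hom (fun_cat A B) F G \<longleftrightarrow> (\<exists>\<tau>. x = (F, G, \<tau>) \<and> is_nat_trans A B F G \<tau>)"
  by (auto simp: hom_def fun_cat_def)

lemma category_fun_cat:
  assumes "category B"
  shows "category (fun_cat A B)"
proof -
  interpret B: category B by fact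
  have ext: "\<sigma> = \<tau>" if "\<sigma> \<in> extensional S" "\<tau> \<in> extensional S" "\<And>a. a \<in> S \<Longrightarrow> \<sigma> a = \<tau> a"
    for \<sigma> \<tau> and S :: "'x set" using that by (rule extensionalityI)
  show ?thesis
  proof
    fix f assume "f \<in> Arr (fun_cat A B)"
    then show "Dom (fun_cat A B) f \<in> Obj (fun_cat A B)" "Cod (fun_cat A B) f \<in> Obj (fun_cat A B)"
      by (auto simp: fun_cat_def is_nat_trans_def)
  next
    fix F assume "F \<in> Obj (fun_cat A B)"
    then show "Idt (fun_cat A B) F \<in> hom (fun_cat A B) F F"
      unfolding fun_cat_hom using is_nat_trans_id by (auto simp: fun_cat_def)
  next
    fix f g F G H assume "f \<in> hom (fun_cat A B) F G" "g \<in> hom (fun_cat A B) G H"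
    then obtain \<tau> \<sigma> where e: "f = (F, G, \<tau>)" "g = (G, H, \<sigma>)"
      and t: "is_nat_trans A B F G \<tau>" "is_nat_trans A B G H \<sigma>"
      unfolding fun_cat_hom by auto
    show "g \<cdot>\<^bsub>fun_cat A B\<^esub> f \<in> hom (fun_cat A B) F H"
      unfolding fun_cat_hom using is_nat_trans_vcomp[OF t] by (simp add: fun_cat_def e)
  next
    fix f F G assume "f \<in> hom (fun_cat A B) F G"
    then obtain \<tau> where f: "f = (F, G, \<tau>)" and t: "is_nat_trans A B F G \<tau>"
      unfolding fun_cat_hom by auto
    interpret is_nat_trans A B F G \<tau> by fact
    have "vcomp A B \<tau> (id_nat A B F) = \<tau>"
      by (rule ext[of _ "Obj A"])
        (use component_ext B.Cmp_Idt[OF component_hom] in \<open>auto simp: vcomp_def id_nat_def\<close>)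
    then show "f \<cdot>\<^bsub>fun_cat A B\<^esub> Idt (fun_cat A B) F = f" by (simp add: f fun_cat_def)
    have "vcomp A B (id_nat A B G) \<tau> = \<tau>"
      by (rule ext[of _ "Obj A"])
        (use component_ext B.Idt_Cmp[OF component_hom] in \<open>auto simp: vcomp_def id_nat_def\<close>)
    then show "Idt (fun_cat A B) G \<cdot>\<^bsub>fun_cat A B\<^esub> f = f" by (simp add: f fun_cat_def)
  next
    fix f g h F G H K
    assume "f \<in> hom (fun_cat A B) F G" "g \<in> hom (fun_cat A B) G H" "h \<in> hom (fun_cat A B) H K"
    then obtain \<tau> \<sigma> \<rho> where e: "f = (F, G, \<tau>)" "g = (G, H, \<sigma>)" "h = (H, K, \<rho>)"
      and t: "is_nat_trans A B F G \<tau>" "is_nat_trans A B G H \<sigma>" "is_nat_trans A B H K \<rho>"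
      unfolding fun_cat_hom by auto
    have "vcomp A B (vcomp A B \<rho> \<sigma>) \<tau> = vcomp A B \<rho> (vcomp A B \<sigma> \<tau>)"
      by (rule ext[of _ "Obj A"])
        (use B.Cmp_assoc[OF t[THEN is_nat_trans.component_hom]] in \<open>auto simp: vcomp_def\<close>)
    then show "(h \<cdot>\<^bsub>fun_cat A B\<^esub> g) \<cdot>\<^bsub>fun_cat A B\<^esub> f = h \<cdot>\<^bsub>fun_cat A B\<^esub> (g \<cdot>\<^bsub>fun_cat A B\<^esub> f)"
      by (simp add: e fun_cat_def)
  qed
qed

lemma comp_ftor_assoc:
  assumes "is_functor A B F"
  shows "(H \<odot>\<^bsub>B\<^esub> G) \<odot>\<^bsub>A\<^esub> F = H \<odot>\<^bsub>A\<^esub> (G \<odot>\<^bsub>A\<^esub> F)"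
proof -
  interpret is_functor A B F by fact
  have "ArrMap F f \<in> Arr B" if "f \<in> Arr A" for f
    using that ArrMap_hom[of f "Dom A f" "Cod A f"] by (auto simp: hom_def)
  then show ?thesis
    using ObjMap_ext by (auto simp: comp_ftor_def fun_eq_iff restrict_def)
qed

lemma is_functor_precomp:
  assumes "is_functor A B K" "category C"
  shows "is_functor (fun_cat B C) (fun_cat A C) (precomp A B C K)"
proof -
  interpret K: is_functor A B K by fact
  interpret BC: category "fun_cat B C" using category_fun_cat[OF assms(2)] .
  interpret AC: category "fun_cat A C" using category_fun_cat[OF assms(2)] .
  have Ob: "F \<in> Obj (fun_cat B C) \<longleftrightarrow> is_functor B C F" for F by (simp add: fun_cat_def)
  have fB: "is_functor B C F" "is_functor B C G" if "is_nat_trans B C F G \<tau>" for F G \<tau>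
    using that by (auto simp: is_nat_trans_def)
  have Ar: "(F, G, \<tau>) \<in> Arr (fun_cat B C) \<longleftrightarrow> is_nat_trans B C F G \<tau>" for F G \<tau>
    by (simp add: fun_cat_def)
  show ?thesis
  proof
    show "ObjMap (precomp A B C K) \<in> Obj (fun_cat B C) \<rightarrow>\<^sub>E Obj (fun_cat A C)"
      using is_functor_comp[OF assms(1)] by (auto simp: precomp_def fun_cat_def)
    show "ArrMap (precomp A B C K) \<in> extensional (Arr (fun_cat B C))"
      by (simp add: precomp_def)
  next
    fix f F G assume "f \<in> hom (fun_cat B C) F G"
    then show "ArrMap (precomp A B C K) f \<in>
        hom (fun_cat A C) (ObjMap (precomp A B C K) F) (ObjMap (precomp A B C K) G)"
      unfolding fun_cat_hom using is_nat_trans_whisker_right[OF assms(1)]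
      by (auto simp: precomp_def Ob Ar fB)
  next
    fix F assume F: "F \<in> Obj (fun_cat B C)"
    have "whisker_right A (id_nat B C F) K = id_nat A C (F \<odot>\<^bsub>A\<^esub> K)"
      using K.ObjMap_ext by (auto simp: whisker_right_def id_nat_def comp_ftor_def fun_eq_iff restrict_def)
    then show "ArrMap (precomp A B C K) (Idt (fun_cat B C) F) =
        Idt (fun_cat A C) (ObjMap (precomp A B C K) F)"
      using F is_nat_trans_id[of B C F] by (simp add: precomp_def fun_cat_def)
  next
    fix f g F G H assume "f \<in> hom (fun_cat B C) F G" "g \<in> hom (fun_cat B C) G H"
    then obtain \<tau> \<sigma> where e: "f = (F, G, \<tau>)" "g = (G, H, \<sigma>)"
      and t: "is_nat_trans B C F G \<tau>" "is_nat_trans B C G H \<sigma>"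
      unfolding fun_cat_hom by auto
    have "whisker_right A (vcomp B C \<sigma> \<tau>) K = vcomp A C (whisker_right A \<sigma> K) (whisker_right A \<tau> K)"
      using K.ObjMap_ext by (auto simp: whisker_right_def vcomp_def fun_eq_iff restrict_def)
    then show "ArrMap (precomp A B C K) (g \<cdot>\<^bsub>fun_cat B C\<^esub> f) =
        ArrMap (precomp A B C K) g \<cdot>\<^bsub>fun_cat A C\<^esub> ArrMap (precomp A B C K) f"
      using t is_nat_trans_vcomp[OF t] by (simp add: precomp_def fun_cat_def e)
  qed
qed

lemma precomp_comp:
  assumes K: "is_functor A B K" and L: "is_functor B D L"
  shows "precomp A B C K \<odot>\<^bsub>fun_cat D C\<^esub> precomp B D C L = precomp A D C (L \<odot>\<^bsub>A\<^esub> K)"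
proof -
  interpret K: is_functor A B K by fact
  have w: "whisker_right A (whisker_right B \<tau> L) K = whisker_right A \<tau> (L \<odot>\<^bsub>A\<^esub> K)" for \<tau> :: "_ \<Rightarrow> 'x"
    using K.ObjMap_ext by (auto simp: whisker_right_def comp_ftor_def fun_eq_iff restrict_def)
  show ?thesis
    using is_functor_comp[OF L, of C] is_nat_trans_whisker_right[OF L, of C]
    by (subst (1) comp_ftor_def)
      (auto simp: precomp_def fun_cat_def comp_ftor_assoc[OF K] w fun_eq_iff restrict_def)
qed

lemma comp_id_ftor:
  assumes "is_functor A B F"
  shows "F \<odot>\<^bsub>A\<^esub> id_ftor A = F"
  using is_functor.ObjMap_ext[OF assms] is_functor.ArrMap_ext[OF assms]
  by (cases F) (auto simp: comp_ftor_def id_ftor_def fun_eq_iff restrict_def extensional_def PiE_def)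

lemma precomp_id: "precomp A A C (id_ftor A) = id_ftor (fun_cat A C)"
proof -
  have "whisker_right A \<tau> (id_ftor A) = \<tau>" if "is_nat_trans A C F G \<tau>" for F G \<tau>
    using is_nat_trans.component_ext[OF that]
    by (auto simp: whisker_right_def id_ftor_def fun_eq_iff restrict_def extensional_def)
  then show ?thesis
    by (subst (2) id_ftor_def)
      (auto simp: precomp_def fun_cat_def fun_eq_iff restrict_def comp_id_ftor is_nat_trans_def)
qed

lemma is_functor_mono_ftor:
  assumes "\<And>i j. i \<le> j \<Longrightarrow> j \<le> m \<Longrightarrow> \<phi> i \<le> \<phi> j" "\<And>i. i \<le> m \<Longrightarrow> \<phi> i \<le> n"
  shows "is_functor (ord_cat m) (ord_cat n) (mono_ftor m \<phi>)"
proof -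
  interpret A: category "ord_cat m" by (rule category_ord_cat)
  interpret B: category "ord_cat n" by (rule category_ord_cat)
  show ?thesis
    by unfold_locales (use assms in \<open>auto simp: ord_cat_def mono_ftor_def hom_def\<close>)
qed

lemma comp_mono_ftor:
  assumes "\<And>i j. i \<le> j \<Longrightarrow> j \<le> m \<Longrightarrow> \<phi> i \<le> \<phi> j" "\<And>i. i \<le> m \<Longrightarrow> \<phi> i \<le> n"
  shows "mono_ftor n \<psi> \<odot>\<^bsub>ord_cat m\<^esub> mono_ftor m \<phi> = mono_ftor m (\<lambda>k. \<psi> (\<phi> k))"
  using assms by (auto simp: comp_ftor_def mono_ftor_def ord_cat_def fun_eq_iff restrict_def)

lemma mono_ftor_cong: "(\<And>k. k \<le> m \<Longrightarrow> \<phi> k = \<psi> k) \<Longrightarrow> mono_ftor m \<phi> = mono_ftor m \<psi>"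
  by (auto simp: mono_ftor_def ord_cat_def fun_eq_iff restrict_def)

lemma simplicial_object_nerve:
  assumes "category C"
  shows "simplicial_object (nerve C)"
proof -
  define P where "P m n \<phi> = precomp (ord_cat m) (ord_cat n) C (mono_ftor m \<phi>)" for m n \<phi>
  define M where "M m n \<phi> \<longleftrightarrow> (\<forall>i j. i \<le> j \<longrightarrow> j \<le> m \<longrightarrow> \<phi> i \<le> \<phi> j) \<and> (\<forall>i \<le> m. \<phi> i \<le> n)"
    for m n and \<phi> :: "nat \<Rightarrow> nat"
  have M: "is_functor (ord_cat m) (ord_cat n) (mono_ftor m \<phi>)" if "M m n \<phi>" for m n \<phi>
    using that is_functor_mono_ftor unfolding M_def by blast
  have comp: "P l m \<phi> \<odot>\<^bsub>fun_cat (ord_cat n) C\<^esub> P m n \<psi> = P l n (\<lambda>k. \<psi> (\<phi> k))"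
    if "M l m \<phi>" "M m n \<psi>" for l m n \<phi> \<psi>
  proof -
    have "mono_ftor m \<psi> \<odot>\<^bsub>ord_cat l\<^esub> mono_ftor l \<phi> = mono_ftor l (\<lambda>k. \<psi> (\<phi> k))"
      by (rule comp_mono_ftor) (use that(1) in \<open>auto simp: M_def\<close>)
    then show ?thesis unfolding P_def using precomp_comp[OF M[OF that(1)] M[OF that(2)]] by simp
  qed
  have cong: "P l n \<phi> = P l n \<psi>" if "\<And>k. k \<le> l \<Longrightarrow> \<phi> k = \<psi> k" for l n \<phi> \<psi>
    unfolding P_def using mono_ftor_cong[of l \<phi> \<psi>] that by simp
  have comp2: "P l m \<phi> \<odot>\<^bsub>fun_cat (ord_cat n) C\<^esub> P m n \<psi> =
      P l m' \<phi>' \<odot>\<^bsub>fun_cat (ord_cat n) C\<^esub> P m' n \<psi>'"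
    if "M l m \<phi>" "M m n \<psi>" "M l m' \<phi>'" "M m' n \<psi>'" "\<And>k. k \<le> l \<Longrightarrow> \<psi> (\<phi> k) = \<psi>' (\<phi>' k)"
    for l m m' n \<phi> \<psi> \<phi>' \<psi>'
    using comp[OF that(1,2)] comp[OF that(3,4)] cong[OF that(5)] by simp
  have id: "P n n (\<lambda>k. k) = id_ftor (fun_cat (ord_cat n) C)" for n
  proof -
    have "mono_ftor n (\<lambda>k. k) = id_ftor (ord_cat n)"
      by (auto simp: mono_ftor_def id_ftor_def fun_eq_iff restrict_def)
    then show ?thesis unfolding P_def using precomp_id by simp
  qed
  have Mf: "M n (Suc n) (coface i)" if "i \<le> Suc n" for n i
    using that by (auto simp: M_def coface_def)
  have Md: "M (Suc n) n (codegen j)" if "j \<le> n" for n j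
    using that by (auto simp: M_def codegen_def)
  have Lev: "Lev (nerve C) n = fun_cat (ord_cat n) C" for n by (simp add: nerve_def)
  have face: "face (nerve C) (Suc n) i = P n (Suc n) (coface i)" for n i
    by (simp add: nerve_def P_def)
  have degen: "degen (nerve C) n j = P (Suc n) n (codegen j)" for n j
    by (simp add: nerve_def P_def)
  note simps = Lev face degen Suc_eq_plus1[symmetric] diff_Suc_1
  show ?thesis
  proof (intro simplicial_object.intro simplicial_base.intro simplicial_object_axioms.intro)
    fix n i j :: nat
    show "category (Lev (nerve C) n)" by (simp add: Lev category_fun_cat[OF assms])
    show "is_functor (Lev (nerve C) n) (Lev (nerve C) (n - 1)) (face (nerve C) n i)"
      if h: "n \<ge> 1" "i \<le> n"
    proof -
      obtain m where n: "n = Suc m" using h(1) by (cases n) auto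
      show ?thesis unfolding n simps P_def
        by (intro is_functor_precomp M Mf assms) (use h n in simp)
    qed
    show "is_functor (Lev (nerve C) n) (Lev (nerve C) (n + 1)) (degen (nerve C) n j)"
      if "j \<le> n" unfolding simps P_def by (intro is_functor_precomp M Md assms that)
    show "degen (nerve C) (n + 1) i \<odot>\<^bsub>Lev (nerve C) n\<^esub> degen (nerve C) n j =
          degen (nerve C) (n + 1) (j + 1) \<odot>\<^bsub>Lev (nerve C) n\<^esub> degen (nerve C) n i"
      if "i \<le> j" "j \<le> n" unfolding simps
      by (rule comp2) (use that in \<open>auto simp: codegen_def intro!: Md\<close>)
    show "face (nerve C) (n + 1) i \<odot>\<^bsub>Lev (nerve C) n\<^esub> degen (nerve C) n j =
          degen (nerve C) (n - 1) (j - 1) \<odot>\<^bsub>Lev (nerve C) n\<^esub> face (nerve C) n i"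
      if h: "i < j" "j \<le> n"
    proof -
      obtain m where n: "n = Suc m" using h by (cases n) auto
      show ?thesis unfolding n simps
        by (rule comp2) (use h n in \<open>auto simp: codegen_def coface_def intro!: Md Mf\<close>)
    qed
    show "face (nerve C) (n + 1) i \<odot>\<^bsub>Lev (nerve C) n\<^esub> degen (nerve C) n j = id_ftor (Lev (nerve C) n)"
      if "j \<le> n" "i = j \<or> i = j + 1"
    proof -
      have "P n (Suc n) (coface i) \<odot>\<^bsub>fun_cat (ord_cat n) C\<^esub> P (Suc n) n (codegen j) =
            P n n (\<lambda>k. codegen j (coface i k))"
        by (rule comp) (use that in \<open>auto intro!: Md Mf\<close>)
      also have "\<dots> = P n n (\<lambda>k. k)"
        by (rule cong) (use that in \<open>auto simp: codegen_def coface_def\<close>)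
      finally show ?thesis unfolding simps id .
    qed
    show "face (nerve C) (n + 1) i \<odot>\<^bsub>Lev (nerve C) n\<^esub> degen (nerve C) n j =
          degen (nerve C) (n - 1) j \<odot>\<^bsub>Lev (nerve C) n\<^esub> face (nerve C) n (i - 1)"
      if h: "j + 1 < i" "i \<le> n + 1"
    proof -
      obtain m where n: "n = Suc m" using h by (cases n) auto
      show ?thesis unfolding n simps
        by (rule comp2) (use h n in \<open>auto simp: codegen_def coface_def intro!: Md Mf\<close>)
    qed
    show "face (nerve C) (n - 1) i \<odot>\<^bsub>Lev (nerve C) n\<^esub> face (nerve C) n j =
          face (nerve C) (n - 1) (j - 1) \<odot>\<^bsub>Lev (nerve C) n\<^esub> face (nerve C) n i"
      if h: "n \<ge> 2" "i < j" "j \<le> n"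
    proof -
      obtain m where n: "n = Suc (Suc m)" using h(1) by (metis One_nat_def Suc_1 Suc_le_D Suc_le_mono)
      show ?thesis unfolding n simps
        by (rule comp2) (use h n in \<open>auto simp: coface_def intro!: Mf\<close>)
    qed
  qed
qed

end

theory Submission
  imports Defs
begin

text \<open>Reading a chain of length \<open>n\<close> as a chain of length \<open>n + 1\<close> ending in the zero object, the
  forgotten top degeneracy appends a zero object, and the forgotten top face sends
  \<open>a\<^sub>0 \<rightarrow> \<dots> \<rightarrow> a\<^sub>n\<close> to the chain of kernels of the maps \<open>a\<^sub>i \<rightarrow> a\<^sub>n\<close>.  The latter comes from a comonad
  \<open>\<iota> : L \<Rightarrow> id\<close> on chains with \<open>L \<iota> = id\<close>, compatible with all simplicial operators that preserve
  the last vertex.  With \<open>\<alpha> = L (d (\<iota> d))\<close> all coherences reduce to naturality of \<open>\<iota>\<close> and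
  these identities.

  Conversely, let \<open>K\<close> be \<open>d\<^sub>2\<close> as a functor on arrows and \<open>\<epsilon> a : a \<rightarrow> e\<close> be \<open>s\<^sub>1 a\<close>.  The kernel
  arrow of \<open>f : a \<rightarrow> b\<close> is \<open>K\<close> of the square \<open>(id, \<epsilon> b) : f \<rightarrow> \<epsilon> a\<close>.  Factorisations are obtained by
  applying \<open>K\<close> to squares; they are unique because naturality of \<open>\<alpha>\<^sub>3\<close> at the morphism
  \<open>(id, id, \<epsilon> b)\<close> from \<open>a \<rightarrow> b = b\<close> to \<open>a \<rightarrow> b \<rightarrow> e\<close>, together with (C3), shows that \<open>K\<close> sends the
  square from \<open>\<epsilon> (K f)\<close> to \<open>f\<close> given by the kernel arrow to an identity.\<close>

section \<open>Zero arrows and kernels\<close>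

text \<open>The relaxed relation fails for chosen kernels because two top faces in a row take a
  kernel of a kernel: for \<open>a -> b -> c\<close>, the object
  \<open>ker (ker (a -> c) -> ker (b -> c))\<close> is canonically isomorphic to
  \<open>ker (a -> b)\<close>, but the two choices need not be equal. The transformation \<alpha> is
  this comparison. All other relations must hold as equations, and this is what the two
  normalisations of \<kappa> achieve: the one at identities makes a chain of kernels end in
  \<open>z\<close> itself, so that it is again a chain ending in zero, and the one at arrows into
  \<open>z\<close> makes \<open>L\<close> fix such chains.

  In the converse the structure knows nothing of the given \<open>z\<close>. It offers only the
  object \<open>e\<close> that \<open>s_0\<close> assigns to the point of \<open>X_0\<close>. The
  equations for \<epsilon> make \<open>e\<close> terminal, hence zero because the category is
  pointed, and this suffices to recognise zero arrows as those that factor through \<open>e\<close>.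
  The normalised choice is made only after kernels of all arrows are known to exist.\<close>

context category
begin

lemma in_hom_Obj: "f \<in> hom C a b \<Longrightarrow> a \<in> Obj C \<and> b \<in> Obj C"
  using Dom_Obj Cod_Obj by (auto simp: hom_def)

lemma Arr_hom: "f \<in> Arr C \<Longrightarrow> f \<in> hom C (Dom C f) (Cod C f)"
  by (simp add: hom_def)

lemma hom_D: "f \<in> hom C a b \<Longrightarrow> f \<in> Arr C \<and> Dom C f = a \<and> Cod C f = b"
  by (simp add: hom_def)

end

context pointed_category
begin

lemma to_zero_hom: "a \<in> Obj C \<Longrightarrow> to_zero C z a \<in> hom C a z"
  unfolding to_zero_def by (rule theI') (rule z_terminal)

lemma from_zero_hom: "a \<in> Obj C \<Longrightarrow> from_zero C z a \<in> hom C z a"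
  unfolding from_zero_def by (rule theI') (rule z_initial)

lemma to_zero_unique: "f \<in> hom C a z \<Longrightarrow> f = to_zero C z a"
  using z_terminal to_zero_hom in_hom_Obj by blast

lemma from_zero_unique: "f \<in> hom C z a \<Longrightarrow> f = from_zero C z a"
  using z_initial from_zero_hom in_hom_Obj by blast

lemma to_zero_z: "to_zero C z z = Idt C z"
  using to_zero_unique[OF Idt_hom[OF z_Obj]] by simp

lemma from_zero_z: "from_zero C z z = Idt C z"
  using from_zero_unique[OF Idt_hom[OF z_Obj]] by simp

text \<open>Both factors through \<open>z\<close> are forced, so there is exactly one zero arrow
  between two objects, and comparisons of zero arrows become equations.\<close>

lemma zero_arrow_iff:
  assumes "f \<in> hom C a b"
  shows "zero_arrow C z f \<longleftrightarrow> f = from_zero C z b \<cdot> to_zero C z a"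
  using hom_D[OF assms] in_hom_Obj[OF assms] to_zero_hom from_zero_hom
  unfolding zero_arrow_def by (metis to_zero_unique from_zero_unique)

lemma zero_arrow_through:
  assumes "g \<in> hom C a z" "h \<in> hom C z b"
  shows "zero_arrow C z (h \<cdot> g)"
  using hom_D[OF Cmp_hom[OF assms]] assms unfolding zero_arrow_def by auto

lemma zero_arrow_Cmp_right:
  assumes "zero_arrow C z g" "f \<in> hom C a b" "g \<in> hom C b c"
  shows "zero_arrow C z (g \<cdot> f)"
proof -
  have o: "b \<in> Obj C" "c \<in> Obj C" using in_hom_Obj assms by auto
  have "g \<cdot> f = from_zero C z c \<cdot> (to_zero C z b \<cdot> f)"
    using assms(1) zero_arrow_iff[OF assms(3)]
      Cmp_assoc[OF assms(2) to_zero_hom[OF o(1)] from_zero_hom[OF o(2)]] by simp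
  then show ?thesis
    using zero_arrow_through[OF Cmp_hom[OF assms(2) to_zero_hom] from_zero_hom] o by simp
qed

lemma zero_arrow_Cmp_left:
  assumes "zero_arrow C z f" "f \<in> hom C a b" "g \<in> hom C b c"
  shows "zero_arrow C z (g \<cdot> f)"
proof -
  have o: "a \<in> Obj C" "b \<in> Obj C" using in_hom_Obj assms by auto
  have "g \<cdot> f = (g \<cdot> from_zero C z b) \<cdot> to_zero C z a"
    using assms(1) zero_arrow_iff[OF assms(2)]
      Cmp_assoc[OF to_zero_hom[OF o(1)] from_zero_hom[OF o(2)] assms(3)] by simp
  then show ?thesis
    using zero_arrow_through[OF to_zero_hom Cmp_hom[OF from_zero_hom assms(3)]] o by simp
qed

section \<open>Kernels of single arrows, before any normalisation\<close>

definition is_kernel :: "'a \<Rightarrow> 'a \<Rightarrow> bool" where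
  "is_kernel f k \<longleftrightarrow> k \<in> Arr C \<and> Cod C k = Dom C f \<and> zero_arrow C z (f \<cdot> k) \<and>
     (\<forall>g \<in> Arr C. Cod C g = Dom C f \<longrightarrow> zero_arrow C z (f \<cdot> g) \<longrightarrow>
        (\<exists>!h. h \<in> hom C (Dom C g) (Dom C k) \<and> k \<cdot> h = g))"

lemma is_kernel_Idt:
  assumes "a \<in> Obj C"
  shows "is_kernel (Idt C a) (from_zero C z a)"
proof -
  have i: "Idt C a \<in> hom C a a" and k: "from_zero C z a \<in> hom C z a"
    using assms Idt_hom from_zero_hom by auto
  have "\<exists>!h. h \<in> hom C (Dom C g) z \<and> from_zero C z a \<cdot> h = g"
    if g: "g \<in> Arr C" "Cod C g = a" "zero_arrow C z (Idt C a \<cdot> g)" for g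
  proof -
    have h: "g \<in> hom C (Dom C g) a" using g by (simp add: hom_def)
    have "g = from_zero C z a \<cdot> to_zero C z (Dom C g)"
      using g(3) Idt_Cmp[OF h] zero_arrow_iff[OF h] by simp
    then show ?thesis
      using to_zero_unique to_zero_hom in_hom_Obj[OF h] by metis
  qed
  moreover have "zero_arrow C z (Idt C a \<cdot> from_zero C z a)"
    using zero_arrow_through[OF Idt_hom[OF z_Obj] k] Cmp_Idt[OF k] Idt_Cmp[OF k] by simp
  ultimately show ?thesis
    using hom_D[OF i] hom_D[OF k] unfolding is_kernel_def by auto
qed

lemma is_kernel_to_zero:
  assumes "a \<in> Obj C"
  shows "is_kernel (to_zero C z a) (Idt C a)"
proof -
  have i: "Idt C a \<in> hom C a a" and k: "to_zero C z a \<in> hom C a z"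
    using assms Idt_hom to_zero_hom by auto
  have "\<exists>!h. h \<in> hom C (Dom C g) a \<and> Idt C a \<cdot> h = g" if g: "g \<in> Arr C" "Cod C g = a" for g
  proof -
    have h: "g \<in> hom C (Dom C g) a" using g by (simp add: hom_def)
    then show ?thesis using Idt_Cmp by metis
  qed
  moreover have "zero_arrow C z (to_zero C z a \<cdot> Idt C a)"
    using zero_arrow_through[OF k Idt_hom[OF z_Obj]] Cmp_Idt[OF k] Idt_Cmp[OF k] by simp
  ultimately show ?thesis
    using hom_D[OF i] hom_D[OF k] unfolding is_kernel_def by auto
qed

text \<open>The two normalisations of a kernel choice are compatible, because an identity that is
  also an arrow to the zero object is the identity of the zero object.\<close>

lemma has_kernelsI:
  assumes ex: "\<And>f. f \<in> Arr C \<Longrightarrow> \<exists>k. is_kernel f k"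
  shows "has_kernels C z"
proof -
  define \<kappa> where "\<kappa> f =
    (if Cod C f = z then Idt C (Dom C f)
     else if f = Idt C (Dom C f) then from_zero C z (Dom C f) else SOME k. is_kernel f k)" for f
  have ker: "is_kernel f (\<kappa> f)" if f: "f \<in> Arr C" for f
  proof -
    have d: "Dom C f \<in> Obj C" using Dom_Obj f .
    consider "Cod C f = z" | "Cod C f \<noteq> z" "f = Idt C (Dom C f)"
      | "Cod C f \<noteq> z" "f \<noteq> Idt C (Dom C f)" by blast
    then show ?thesis
    proof cases
      case 1
      then show ?thesis
        using is_kernel_to_zero[OF d] to_zero_unique[of f "Dom C f"] f by (simp add: \<kappa>_def hom_def)
    next
      case 2
      then show ?thesis using is_kernel_Idt[OF d] by (simp add: \<kappa>_def)
    next
      case 3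
      then show ?thesis using someI_ex[OF ex[OF f]] by (simp add: \<kappa>_def)
    qed
  qed
  have i: "\<kappa> (Idt C a) = from_zero C z a" if "a \<in> Obj C" for a
    using hom_D[OF Idt_hom[OF that]] by (cases "a = z") (auto simp: \<kappa>_def from_zero_z)
  have t: "\<kappa> (to_zero C z a) = Idt C a" if "a \<in> Obj C" for a
    using hom_D[OF to_zero_hom[OF that]] by (simp add: \<kappa>_def)
  have "kernel_choice C z \<kappa>"
    unfolding kernel_choice_def using ker i t unfolding is_kernel_def by auto
  then show ?thesis unfolding has_kernels_def by blast
qed

text \<open>The functor \<open>K\<close> on the arrow category stands for \<open>d\<^sub>2\<close>, and \<open>\<epsilon> a : a \<rightarrow> e\<close> for \<open>s\<^sub>1 a\<close>.\<close>

lemma is_kernel_of_functor: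
  assumes e: "e \<in> Obj C"
    and eps_hom: "\<And>a. a \<in> Obj C \<Longrightarrow> \<epsilon> a \<in> hom C a e"
    and eps_nat: "\<And>f a b. f \<in> hom C a b \<Longrightarrow> \<epsilon> b \<cdot> f = \<epsilon> a"
    and eps_e: "\<epsilon> e = Idt C e"
    and K_hom: "\<And>f a b f' a' b' u v. f \<in> hom C a b \<Longrightarrow> f' \<in> hom C a' b' \<Longrightarrow> u \<in> hom C a a' \<Longrightarrow>
       v \<in> hom C b b' \<Longrightarrow> v \<cdot> f = f' \<cdot> u \<Longrightarrow> KA f f' u v \<in> hom C (K f) (K f')"
    and K_Cmp: "\<And>f a b f' a' b' u v f'' a'' b'' u' v'. f \<in> hom C a b \<Longrightarrow> f' \<in> hom C a' b' \<Longrightarrow>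
       f'' \<in> hom C a'' b'' \<Longrightarrow> u \<in> hom C a a' \<Longrightarrow> v \<in> hom C b b' \<Longrightarrow> v \<cdot> f = f' \<cdot> u \<Longrightarrow>
       u' \<in> hom C a' a'' \<Longrightarrow> v' \<in> hom C b' b'' \<Longrightarrow> v' \<cdot> f' = f'' \<cdot> u' \<Longrightarrow>
       KA f' f'' u' v' \<cdot> KA f f' u v = KA f f'' (u' \<cdot> u) (v' \<cdot> v)"
    and K_Idt: "\<And>a. a \<in> Obj C \<Longrightarrow> K (Idt C a) = e"
    and K_eps: "\<And>a. a \<in> Obj C \<Longrightarrow> K (\<epsilon> a) = a"
    and KA_eps: "\<And>u a b. u \<in> hom C a b \<Longrightarrow> KA (\<epsilon> a) (\<epsilon> b) u (Idt C e) = u"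
    and KA_ker: "\<And>f a b. f \<in> hom C a b \<Longrightarrow>
       \<exists>w. w \<in> hom C e b \<and> w \<cdot> \<epsilon> (K f) = f \<cdot> KA f (\<epsilon> a) (Idt C a) (\<epsilon> b) \<and>
           KA (\<epsilon> (K f)) f (KA f (\<epsilon> a) (Idt C a) (\<epsilon> b)) w = Idt C (K f)"
    and f: "f \<in> hom C a b"
  shows "is_kernel f (KA f (\<epsilon> a) (Idt C a) (\<epsilon> b))"
proof -
  have o: "a \<in> Obj C" "b \<in> Obj C" using in_hom_Obj[OF f] by auto
  note ia = Idt_hom[OF o(1)] and ib = Idt_hom[OF o(2)] and ie = Idt_hom[OF e]
  \<comment> \<open>Naturality of \<epsilon> at \<open>g\<close>, read with
    \<open>\<epsilon> e = Idt C e\<close>, leaves no arrow into \<open>e\<close> other than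
    \<epsilon>: the object \<open>e\<close> is terminal.\<close>
  have e_term: "g = \<epsilon> c" if "g \<in> hom C c e" for g c
    using eps_nat[OF that] Idt_Cmp[OF that] by (simp add: eps_e)
  \<comment> \<open>An endomorphism of the terminal object \<open>e\<close> is the identity. So the
    identity of \<open>e\<close> factors through \<open>z\<close>, and every arrow out of
    \<open>e\<close> is zero.\<close>
  have ze: "from_zero C z e \<cdot> to_zero C z e = Idt C e"
    using e_term[OF Cmp_hom[OF to_zero_hom[OF e] from_zero_hom[OF e]]] eps_e by simp
  have e_init: "w = from_zero C z c \<cdot> to_zero C z e" if w: "w \<in> hom C e c" for w c
  proof -
    have "w = w \<cdot> (from_zero C z e \<cdot> to_zero C z e)" using Cmp_Idt[OF w] ze by simp
    also have "\<dots> = (w \<cdot> from_zero C z e) \<cdot> to_zero C z e"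
      using Cmp_assoc[OF to_zero_hom[OF e] from_zero_hom[OF e] w] by simp
    finally show ?thesis using from_zero_unique[OF Cmp_hom[OF from_zero_hom[OF e] w]] by simp
  qed
  have through_e: "zero_arrow C z (w \<cdot> g)" if g: "g \<in> hom C c e" and w: "w \<in> hom C e d" for g w c d
    using zero_arrow_Cmp_right[OF _ g w] zero_arrow_iff[OF w] e_init[OF w] by simp
  let ?k = "KA f (\<epsilon> a) (Idt C a) (\<epsilon> b)"
  note eb = eps_hom[OF o(2)] and ea = eps_hom[OF o(1)]
  have sq: "\<epsilon> b \<cdot> f = \<epsilon> a \<cdot> Idt C a" using eps_nat[OF f] Cmp_Idt[OF ea] by simp
  have k: "?k \<in> hom C (K f) a" using K_hom[OF f ea ia eb sq] K_eps o by simp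
  obtain w where w: "w \<in> hom C e b" and wsq: "w \<cdot> \<epsilon> (K f) = f \<cdot> ?k"
    and wid: "KA (\<epsilon> (K f)) f ?k w = Idt C (K f)"
    using KA_ker[OF f] by blast
  have Kf: "K f \<in> Obj C" using in_hom_Obj[OF k] by blast
  note eK = eps_hom[OF Kf]
  have z: "zero_arrow C z (f \<cdot> ?k)" using through_e[OF eK w] wsq by simp
  have "\<exists>!h. h \<in> hom C c (K f) \<and> ?k \<cdot> h = g"
    if g: "g \<in> hom C c a" and fg: "zero_arrow C z (f \<cdot> g)" for g c
  \<comment> \<open>The witness is \<open>K\<close> of the square from \<open>\<epsilon> c\<close>
    to \<open>f\<close> with sides \<open>g\<close> and \<open>w\<close>; by \<open>K_eps\<close>
    its source is \<open>c\<close>. The square commutes because both ways round are zero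
    arrows.\<close>
  proof (rule ex1I[of _ "KA (\<epsilon> c) f g w"], intro conjI)
    have c: "c \<in> Obj C" using in_hom_Obj[OF g] by blast
    note ec = eps_hom[OF c]
    have gs: "w \<cdot> \<epsilon> c = f \<cdot> g"
      using through_e[OF ec w] fg zero_arrow_iff[OF Cmp_hom[OF g f]]
        zero_arrow_iff[OF Cmp_hom[OF ec w]] by simp
    show "KA (\<epsilon> c) f g w \<in> hom C c (K f)" using K_hom[OF ec f g w gs] K_eps c by simp
    \<comment> \<open>Pasting with the square that defines \<open>?k\<close> gives the square with
      sides \<open>g\<close> and \<open>Idt C e\<close> from \<open>\<epsilon> c\<close> to
      \<open>\<epsilon> a\<close>, on which \<open>K\<close> is \<open>g\<close>.\<close>
    have "\<epsilon> b \<cdot> w = Idt C e" using eps_nat[OF w] eps_e by simp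
    then show "?k \<cdot> KA (\<epsilon> c) f g w = g"
      using K_Cmp[OF ec f ea g w gs ia eb sq] Idt_Cmp[OF g] KA_eps[OF g] by simp
    \<comment> \<open>Uniqueness: \<open>h\<close> is \<open>K\<close> of the square with sides
      \<open>h\<close> and \<open>Idt C e\<close> from \<open>\<epsilon> c\<close> to
      \<open>\<epsilon> (K f)\<close>. Composing with the square that \<open>wid\<close> makes an
      identity yields the square of the witness.\<close>
    fix h assume h: "h \<in> hom C c (K f) \<and> ?k \<cdot> h = g"
    have hs: "Idt C e \<cdot> \<epsilon> c = \<epsilon> (K f) \<cdot> h"
      using h eps_nat[of h c "K f"] Idt_Cmp[OF ec] by simp
    have "KA (\<epsilon> (K f)) f ?k w \<cdot> KA (\<epsilon> c) (\<epsilon> (K f)) h (Idt C e) = KA (\<epsilon> c) f (?k \<cdot> h) (w \<cdot> Idt C e)"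
      using K_Cmp[OF ec eK f _ ie hs k w wsq] h by simp
    then show "h = KA (\<epsilon> c) f g w"
      using h KA_eps[of h c "K f"] Idt_Cmp[of h c "K f"] Cmp_Idt[OF w] wid by simp
  qed
  then show ?thesis
    using hom_D[OF k] hom_D[OF f] z unfolding is_kernel_def
    by (metis hom_D Arr_hom)
qed

end

section \<open>Chains of arrows\<close>

text \<open>All composites are part of the data, since a functor on \<open>ord_cat n\<close> has
  them among its values; the restrictions meet the convention that functors are extensional.\<close>

definition mk_chain :: "nat \<Rightarrow> (nat \<Rightarrow> 'o) \<Rightarrow> (nat \<Rightarrow> nat \<Rightarrow> 'a) \<Rightarrow> ('o, 'a) nerve_obj" where
  "mk_chain n ob ar = \<lparr>ObjMap = \<lambda>i\<in>{..n}. ob i, ArrMap = \<lambda>(i, j)\<in>{(i, j). i \<le> j \<and> j \<le> n}. ar i j\<rparr>"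

lemma mk_chain_simps [simp]:
  "i \<le> n \<Longrightarrow> ObjMap (mk_chain n ob ar) i = ob i"
  "i \<le> j \<Longrightarrow> j \<le> n \<Longrightarrow> ArrMap (mk_chain n ob ar) (i, j) = ar i j"
  by (auto simp: mk_chain_def)

lemma ord_cat_simps [simp]:
  "Obj (ord_cat n) = {..n}"
  "Arr (ord_cat n) = {(i, j). i \<le> j \<and> j \<le> n}"
  "Idt (ord_cat n) i = (i, i)"
  "Cmp (ord_cat n) g f = (fst f, snd g)"
  "Dom (ord_cat n) = fst" "Cod (ord_cat n) = snd"
  by (auto simp: ord_cat_def)

lemma ord_cat_hom: "f \<in> hom (ord_cat n) i j \<longleftrightarrow> f = (i, j) \<and> i \<le> j \<and> j \<le> n"
  by (cases f) (auto simp: hom_def)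

lemma fun_cat_simps [simp]:
  "F \<in> Obj (fun_cat A B) \<longleftrightarrow> is_functor A B F"
  "(F, G, \<tau>) \<in> Arr (fun_cat A B) \<longleftrightarrow> is_nat_trans A B F G \<tau>"
  "Dom (fun_cat A B) (F, G, \<tau>) = F"
  "Cod (fun_cat A B) (F, G, \<tau>) = G"
  "Idt (fun_cat A B) F = (F, F, id_nat A B F)"
  "Cmp (fun_cat A B) (F', G', \<sigma>) (F, G, \<tau>) = (F, G', vcomp A B \<sigma> \<tau>)"
  by (auto simp: fun_cat_def)

lemma is_functor_mk_chain:
  assumes "category C"
    and "\<And>i. i \<le> n \<Longrightarrow> ob i \<in> Obj C"
    and "\<And>i j. i \<le> j \<Longrightarrow> j \<le> n \<Longrightarrow> ar i j \<in> hom C (ob i) (ob j)"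
    and "\<And>i. i \<le> n \<Longrightarrow> ar i i = Idt C (ob i)"
    and "\<And>i j k. i \<le> j \<Longrightarrow> j \<le> k \<Longrightarrow> k \<le> n \<Longrightarrow> ar j k \<cdot>\<^bsub>C\<^esub> ar i j = ar i k"
  shows "is_functor (ord_cat n) C (mk_chain n ob ar)"
proof -
  interpret C: category C by fact
  interpret O: category "ord_cat n" by (rule category_ord_cat)
  show ?thesis
    by unfold_locales
      (use assms(2-) in \<open>auto simp: mk_chain_def ord_cat_hom extensional_def\<close>)
qed

context category
begin

context
  fixes n F
  assumes F: "is_functor (ord_cat n) C F"
begin

lemma chain_Obj: "i \<le> n \<Longrightarrow> ObjMap F i \<in> Obj C"
  using is_functor.ObjMap_ext[OF F] by auto

lemma chain_hom: "i \<le> j \<Longrightarrow> j \<le> n \<Longrightarrow> ArrMap F (i, j) \<in> hom C (ObjMap F i) (ObjMap F j)"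
  using is_functor.ArrMap_hom[OF F, of "(i, j)" i j] by (simp add: ord_cat_hom)

lemma chain_Idt: "i \<le> n \<Longrightarrow> ArrMap F (i, i) = Idt C (ObjMap F i)"
  using is_functor.ArrMap_Idt[OF F, of i] by simp

lemma chain_Cmp: "i \<le> j \<Longrightarrow> j \<le> k \<Longrightarrow> k \<le> n \<Longrightarrow> ArrMap F (j, k) \<cdot> ArrMap F (i, j) = ArrMap F (i, k)"
  using is_functor.ArrMap_Cmp[OF F, of "(i, j)" i j "(j, k)" k] by (simp add: ord_cat_hom)

lemma chain_eqI:
  assumes G: "is_functor (ord_cat n) C G"
    and "\<And>i. i \<le> n \<Longrightarrow> ObjMap F i = ObjMap G i"
    and "\<And>i j. i \<le> j \<Longrightarrow> j \<le> n \<Longrightarrow> ArrMap F (i, j) = ArrMap G (i, j)"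
  shows "F = G"
proof -
  have "ObjMap F = ObjMap G"
    by (rule extensionalityI[of _ "{..n}"])
      (use assms is_functor.ObjMap_ext[OF F] is_functor.ObjMap_ext[OF G] in \<open>auto simp: PiE_def\<close>)
  moreover have "ArrMap F = ArrMap G"
    by (rule extensionalityI[of _ "{(i, j). i \<le> j \<and> j \<le> n}"])
      (use assms is_functor.ArrMap_ext[OF F] is_functor.ArrMap_ext[OF G] in auto)
  ultimately show ?thesis by (cases F; cases G) simp
qed

text \<open>An ordinal is generated by its consecutive arrows; the other values follow by
  composition, with induction on the target.\<close>

lemma chain_eqI_Suc:
  assumes G: "is_functor (ord_cat n) C G"
    and o: "\<And>i. i \<le> n \<Longrightarrow> ObjMap F i = ObjMap G i"
    and s: "\<And>i. i < n \<Longrightarrow> ArrMap F (i, Suc i) = ArrMap G (i, Suc i)"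
  shows "F = G"
proof (rule chain_eqI[OF G o])
  interpret G: is_functor "ord_cat n" C G by fact
  fix i j :: nat
  assume "i \<le> j" "j \<le> n"
  then show "ArrMap F (i, j) = ArrMap G (i, j)"
  proof (induction j rule: dec_induct)
    case base
    then show ?case
      using o chain_Idt G.ArrMap_Idt[of i] by simp
  next
    case (step j)
    then show ?case
      using chain_Cmp[of i j "Suc j"] G.ArrMap_Cmp[of "(i, j)" i j "(j, Suc j)" "Suc j"] s[of j]
      by (simp add: ord_cat_hom)
  qed
qed

end

text \<open>Pasting consecutive squares, by induction on the target, yields all the other naturality
  squares.\<close>

lemma nat_transI:
  assumes F: "is_functor (ord_cat n) C F" and G: "is_functor (ord_cat n) C G"
    and t: "\<And>i. i \<le> n \<Longrightarrow> t i \<in> hom C (ObjMap F i) (ObjMap G i)"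
    and s: "\<And>i. i < n \<Longrightarrow> t (Suc i) \<cdot> ArrMap F (i, Suc i) = ArrMap G (i, Suc i) \<cdot> t i"
  shows "is_nat_trans (ord_cat n) C F G (\<lambda>i\<in>{..n}. t i)"
proof -
  interpret F: is_functor "ord_cat n" C F by fact
  interpret G: is_functor "ord_cat n" C G by fact
  have nat: "t j \<cdot> ArrMap F (i, j) = ArrMap G (i, j) \<cdot> t i" if "i \<le> j" "j \<le> n" for i j
    using that
  proof (induction j rule: dec_induct)
    case base
    then show ?case using chain_Idt[OF F] chain_Idt[OF G] Idt_Cmp[OF t] Cmp_Idt[OF t] by simp
  next
    case (step j)
    have h: "ArrMap F (i, j) \<in> hom C (ObjMap F i) (ObjMap F j)"
      "ArrMap F (j, Suc j) \<in> hom C (ObjMap F j) (ObjMap F (Suc j))"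
      "ArrMap G (i, j) \<in> hom C (ObjMap G i) (ObjMap G j)"
      "ArrMap G (j, Suc j) \<in> hom C (ObjMap G j) (ObjMap G (Suc j))"
      using step chain_hom[OF F] chain_hom[OF G] by auto
    have t': "t i \<in> hom C (ObjMap F i) (ObjMap G i)" "t j \<in> hom C (ObjMap F j) (ObjMap G j)"
      "t (Suc j) \<in> hom C (ObjMap F (Suc j)) (ObjMap G (Suc j))"
      using t step by auto
    have "t (Suc j) \<cdot> ArrMap F (i, Suc j) = (t (Suc j) \<cdot> ArrMap F (j, Suc j)) \<cdot> ArrMap F (i, j)"
      using chain_Cmp[OF F, of i j "Suc j"] step Cmp_assoc[OF h(1,2) t'(3)] by simp
    also have "\<dots> = ArrMap G (j, Suc j) \<cdot> (t j \<cdot> ArrMap F (i, j))"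
      using s[of j] step Cmp_assoc[OF h(1) t'(2) h(4)] by simp
    also have "\<dots> = ArrMap G (i, Suc j) \<cdot> t i"
      using chain_Cmp[OF G, of i j "Suc j"] step Cmp_assoc[OF t'(1) h(3,4)] by simp
    finally show ?case .
  qed
  show ?thesis
    by unfold_locales (use t nat in \<open>auto simp: ord_cat_hom\<close>)
qed

lemma nat_trans_component:
  "is_nat_trans (ord_cat n) C F G t \<Longrightarrow> i \<le> n \<Longrightarrow> t i \<in> hom C (ObjMap F i) (ObjMap G i)"
  using is_nat_trans.component_hom[of "ord_cat n" C F G t i] by simp

lemma nat_trans_naturality:
  "is_nat_trans (ord_cat n) C F G t \<Longrightarrow> i \<le> j \<Longrightarrow> j \<le> n \<Longrightarrow>
   t j \<cdot> ArrMap F (i, j) = ArrMap G (i, j) \<cdot> t i"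
  using is_nat_trans.naturality[of "ord_cat n" C F G t "(i, j)" i j] by (simp add: ord_cat_hom)

lemma nat_trans_functors:
  "is_nat_trans (ord_cat n) C F G t \<Longrightarrow> is_functor (ord_cat n) C F \<and> is_functor (ord_cat n) C G"
  by (simp add: is_nat_trans_def)

lemma nat_trans_eqI:
  assumes "is_nat_trans (ord_cat n) C F G t" "is_nat_trans (ord_cat n) C F' G' t'"
    and "\<And>i. i \<le> n \<Longrightarrow> t i = t' i"
  shows "t = t'"
proof (rule extensionalityI)
  show "t \<in> extensional {..n}" "t' \<in> extensional {..n}"
    using is_nat_trans.component_ext[OF assms(1)] is_nat_trans.component_ext[OF assms(2)] by simp_all
  show "\<And>i. i \<in> {..n} \<Longrightarrow> t i = t' i" using assms(3) by blast
qed

end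

section \<open>Pointwise form of functors and of the operators of the nerve\<close>

lemma mono_ftor_simps [simp]:
  "i \<le> m \<Longrightarrow> ObjMap (mono_ftor m \<phi>) i = \<phi> i"
  "i \<le> j \<Longrightarrow> j \<le> m \<Longrightarrow> ArrMap (mono_ftor m \<phi>) (i, j) = (\<phi> i, \<phi> j)"
  by (auto simp: mono_ftor_def)

lemma comp_ftor_simps [simp]:
  "x \<in> Obj A \<Longrightarrow> ObjMap (G \<odot>\<^bsub>A\<^esub> F) x = ObjMap G (ObjMap F x)"
  "f \<in> Arr A \<Longrightarrow> ArrMap (G \<odot>\<^bsub>A\<^esub> F) f = ArrMap G (ArrMap F f)"
  by (auto simp: comp_ftor_def)

text \<open>Simplicial identities are equations between composite functors; this and
  \<open>comp_ftor_idD\<close> apply them to single objects and arrows.\<close>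

lemma comp_ftor_eqD:
  assumes "G \<odot>\<^bsub>A\<^esub> F = G' \<odot>\<^bsub>A\<^esub> F'"
  shows "x \<in> Obj A \<Longrightarrow> ObjMap G (ObjMap F x) = ObjMap G' (ObjMap F' x)"
    and "f \<in> Arr A \<Longrightarrow> ArrMap G (ArrMap F f) = ArrMap G' (ArrMap F' f)"
  using comp_ftor_simps[of _ A G F] comp_ftor_simps[of _ A G' F'] assms by metis+

lemma id_ftor_simps [simp]:
  "x \<in> Obj A \<Longrightarrow> ObjMap (id_ftor A) x = x"
  "f \<in> Arr A \<Longrightarrow> ArrMap (id_ftor A) f = f"
  by (auto simp: id_ftor_def)

lemma comp_ftor_idD:
  assumes "G \<odot>\<^bsub>A\<^esub> F = id_ftor A"
  shows "x \<in> Obj A \<Longrightarrow> ObjMap G (ObjMap F x) = x"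
    and "f \<in> Arr A \<Longrightarrow> ArrMap G (ArrMap F f) = f"
  using comp_ftor_simps[of _ A G F] assms by auto

lemma is_functor_Obj: "is_functor A B F \<Longrightarrow> x \<in> Obj A \<Longrightarrow> ObjMap F x \<in> Obj B"
  using is_functor.ObjMap_ext[of A B F] by auto

lemma is_functor_Arr: "is_functor A B F \<Longrightarrow> f \<in> Arr A \<Longrightarrow> ArrMap F f \<in> Arr B"
  using is_functor.ArrMap_hom[of A B F f "Dom A f" "Cod A f"] by (auto simp: hom_def)

lemma Lev_nerve [simp]: "Lev (nerve C) n = fun_cat (ord_cat n) C"
  by (simp add: nerve_def)

lemma precomp_simps [simp]:
  "is_functor B C F \<Longrightarrow> ObjMap (precomp A B C K) F = F \<odot>\<^bsub>A\<^esub> K"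
  "is_nat_trans B C F G t \<Longrightarrow>
    ArrMap (precomp A B C K) (F, G, t) = (F \<odot>\<^bsub>A\<^esub> K, G \<odot>\<^bsub>A\<^esub> K, whisker_right A t K)"
  by (auto simp: precomp_def)

lemma whisker_right_mono_ftor [simp]:
  "i \<le> m \<Longrightarrow> whisker_right (ord_cat m) t (mono_ftor m \<phi>) i = t (\<phi> i)"
  by (simp add: whisker_right_def mono_ftor_def)

lemma face_nerve: "face (nerve C) n i = precomp (ord_cat (n - 1)) (ord_cat n) C (mono_ftor (n - 1) (coface i))"
  by (simp add: nerve_def)

lemma degen_nerve: "degen (nerve C) n j = precomp (ord_cat (n + 1)) (ord_cat n) C (mono_ftor (n + 1) (codegen j))"
  by (simp add: nerve_def)

lemma face_nerve_simps [simp]: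
  "is_functor (ord_cat (Suc n)) C F \<Longrightarrow> k \<le> n \<Longrightarrow>
     ObjMap (ObjMap (face (nerve C) (Suc n) i) F) k = ObjMap F (coface i k)"
  "is_functor (ord_cat (Suc n)) C F \<Longrightarrow> j \<le> k \<Longrightarrow> k \<le> n \<Longrightarrow>
     ArrMap (ObjMap (face (nerve C) (Suc n) i) F) (j, k) = ArrMap F (coface i j, coface i k)"
  "is_nat_trans (ord_cat (Suc n)) C F G t \<Longrightarrow> k \<le> n \<Longrightarrow>
     snd (snd (ArrMap (face (nerve C) (Suc n) i) (F, G, t))) k = t (coface i k)"
  by (simp_all add: face_nerve)

lemma degen_nerve_simps [simp]:
  "is_functor (ord_cat n) C F \<Longrightarrow> k \<le> Suc n \<Longrightarrow>
     ObjMap (ObjMap (degen (nerve C) n i) F) k = ObjMap F (codegen i k)"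
  "is_functor (ord_cat n) C F \<Longrightarrow> j \<le> k \<Longrightarrow> k \<le> Suc n \<Longrightarrow>
     ArrMap (ObjMap (degen (nerve C) n i) F) (j, k) = ArrMap F (codegen i j, codegen i k)"
  by (simp_all add: degen_nerve)

lemma dec_simps [simp]:
  "Lev (dec X) n = Lev X (n + 1)"
  "face (dec X) n i = face X (n + 1) i"
  "degen (dec X) n j = degen X (n + 1) j"
  by (auto simp: dec_def)

section \<open>Kernels from a supercoherent structure\<close>

locale decalage_iso = pointed_category C z + X: almost_strict_supercoherent X +
    N: simplicial_iso "nerve C" "dec X" \<Phi>
  for C :: "('o, 'a) cat" (structure) and z and X :: "('x, 'y) supercoh_data" and \<Phi>
begin

section \<open>Transport of the operators of \<open>X\<close> to the nerve\<close>

definition \<Psi> where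
  "\<Psi> n = (SOME G. is_functor (Lev X (Suc n)) (Lev (nerve C) n) G \<and>
     G \<odot>\<^bsub>Lev (nerve C) n\<^esub> \<Phi> n = id_ftor (Lev (nerve C) n) \<and>
     \<Phi> n \<odot>\<^bsub>Lev X (Suc n)\<^esub> G = id_ftor (Lev X (Suc n)))"

lemma Phi_functor: "is_functor (Lev (nerve C) n) (Lev X (Suc n)) (\<Phi> n)"
  using N.iso_Lev[of n] by (simp add: iso_ftor_def)

lemma
  shows Psi_functor: "is_functor (Lev X (Suc n)) (Lev (nerve C) n) (\<Psi> n)"
    and Psi_Phi_ftor: "\<Psi> n \<odot>\<^bsub>Lev (nerve C) n\<^esub> \<Phi> n = id_ftor (Lev (nerve C) n)"
    and Phi_Psi_ftor: "\<Phi> n \<odot>\<^bsub>Lev X (Suc n)\<^esub> \<Psi> n = id_ftor (Lev X (Suc n))"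
proof -
  have "\<exists>G. is_functor (Lev X (Suc n)) (Lev (nerve C) n) G \<and>
     G \<odot>\<^bsub>Lev (nerve C) n\<^esub> \<Phi> n = id_ftor (Lev (nerve C) n) \<and>
     \<Phi> n \<odot>\<^bsub>Lev X (Suc n)\<^esub> G = id_ftor (Lev X (Suc n))"
    using N.iso_Lev[of n] by (simp add: iso_ftor_def)
  from someI_ex[OF this]
  show "is_functor (Lev X (Suc n)) (Lev (nerve C) n) (\<Psi> n)"
    "\<Psi> n \<odot>\<^bsub>Lev (nerve C) n\<^esub> \<Phi> n = id_ftor (Lev (nerve C) n)"
    "\<Phi> n \<odot>\<^bsub>Lev X (Suc n)\<^esub> \<Psi> n = id_ftor (Lev X (Suc n))"
    by (simp_all add: \<Psi>_def)
qed

lemmas Psi_Phi = comp_ftor_idD[OF Psi_Phi_ftor]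
lemmas Phi_Psi = comp_ftor_idD[OF Phi_Psi_ftor]
lemmas Phi_mem = is_functor_Obj[OF Phi_functor] is_functor_Arr[OF Phi_functor]
lemmas Psi_mem = is_functor_Obj[OF Psi_functor] is_functor_Arr[OF Psi_functor]

lemma X_face_functor: "i \<le> Suc n \<Longrightarrow> is_functor (Lev X (Suc n)) (Lev X n) (face X (Suc n) i)"
  using X.face_functor[of "Suc n" i] by simp

lemma X_degen_functor: "j \<le> n \<Longrightarrow> is_functor (Lev X n) (Lev X (Suc n)) (degen X n j)"
  using X.degen_functor[of j n] by simp

lemmas X_mem = X_face_functor[THEN is_functor_Obj] X_face_functor[THEN is_functor_Arr]
  X_degen_functor[THEN is_functor_Obj] X_degen_functor[THEN is_functor_Arr]

lemma N_face_functor: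
  "i \<le> Suc n \<Longrightarrow> is_functor (Lev (nerve C) (Suc n)) (Lev (nerve C) n) (face (nerve C) (Suc n) i)"
  using N.S.face_functor[of "Suc n" i] by simp

lemma N_degen_functor:
  "j \<le> n \<Longrightarrow> is_functor (Lev (nerve C) n) (Lev (nerve C) (Suc n)) (degen (nerve C) n j)"
  using N.S.degen_functor[of j n] by simp

lemmas N_mem = N_face_functor[THEN is_functor_Obj] N_face_functor[THEN is_functor_Arr]
  N_degen_functor[THEN is_functor_Obj] N_degen_functor[THEN is_functor_Arr]

lemma Phi_face:
  assumes "i \<le> Suc n"
  shows "x \<in> Obj (Lev (nerve C) (Suc n)) \<Longrightarrow>
      ObjMap (\<Phi> n) (ObjMap (face (nerve C) (Suc n) i) x) =
      ObjMap (face X (Suc (Suc n)) i) (ObjMap (\<Phi> (Suc n)) x)"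
    and "f \<in> Arr (Lev (nerve C) (Suc n)) \<Longrightarrow>
      ArrMap (\<Phi> n) (ArrMap (face (nerve C) (Suc n) i) f) =
      ArrMap (face X (Suc (Suc n)) i) (ArrMap (\<Phi> (Suc n)) f)"
  using comp_ftor_eqD[OF N.iso_face[of "Suc n" i]] assms by simp_all

lemma Phi_degen:
  assumes "j \<le> n"
  shows "x \<in> Obj (Lev (nerve C) n) \<Longrightarrow>
      ObjMap (\<Phi> (Suc n)) (ObjMap (degen (nerve C) n j) x) =
      ObjMap (degen X (Suc n) j) (ObjMap (\<Phi> n) x)"
    and "f \<in> Arr (Lev (nerve C) n) \<Longrightarrow>
      ArrMap (\<Phi> (Suc n)) (ArrMap (degen (nerve C) n j) f) =
      ArrMap (degen X (Suc n) j) (ArrMap (\<Phi> n) f)"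
  using comp_ftor_eqD[OF N.iso_degen[of j n]] assms by simp_all

lemma Psi_face:
  assumes i: "i \<le> Suc n"
  shows "x \<in> Obj (Lev X (Suc (Suc n))) \<Longrightarrow>
      ObjMap (face (nerve C) (Suc n) i) (ObjMap (\<Psi> (Suc n)) x) =
      ObjMap (\<Psi> n) (ObjMap (face X (Suc (Suc n)) i) x)"
    and "f \<in> Arr (Lev X (Suc (Suc n))) \<Longrightarrow>
      ArrMap (face (nerve C) (Suc n) i) (ArrMap (\<Psi> (Suc n)) f) =
      ArrMap (\<Psi> n) (ArrMap (face X (Suc (Suc n)) i) f)"
proof -
  assume x: "x \<in> Obj (Lev X (Suc (Suc n)))"
  note m = Psi_mem(1)[OF x]
  show "ObjMap (face (nerve C) (Suc n) i) (ObjMap (\<Psi> (Suc n)) x) =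
      ObjMap (\<Psi> n) (ObjMap (face X (Suc (Suc n)) i) x)"
    using Phi_face(1)[OF i m] Psi_Phi(1)[OF N_mem(1)[OF i m]] Phi_Psi(1)[OF x] by simp
next
  assume x: "f \<in> Arr (Lev X (Suc (Suc n)))"
  note m = Psi_mem(2)[OF x]
  show "ArrMap (face (nerve C) (Suc n) i) (ArrMap (\<Psi> (Suc n)) f) =
      ArrMap (\<Psi> n) (ArrMap (face X (Suc (Suc n)) i) f)"
    using Phi_face(2)[OF i m] Psi_Phi(2)[OF N_mem(2)[OF i m]] Phi_Psi(2)[OF x] by simp
qed

text \<open>\<open>D\<close> and \<open>S\<close> are the face and the degeneracy that
  \<open>dec\<close> forgets, conjugated by \<Phi>. Level \<open>n\<close> of the nerve is level
  \<open>n + 1\<close> of \<open>X\<close>, hence the shift of the indices.\<close>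

definition D where
  "D n = \<Psi> n \<odot>\<^bsub>Lev (nerve C) (Suc n)\<^esub>
     (face X (Suc (Suc n)) (Suc (Suc n)) \<odot>\<^bsub>Lev (nerve C) (Suc n)\<^esub> \<Phi> (Suc n))"

definition S where
  "S n = \<Psi> (Suc n) \<odot>\<^bsub>Lev (nerve C) n\<^esub> (degen X (Suc n) (Suc n) \<odot>\<^bsub>Lev (nerve C) n\<^esub> \<Phi> n)"

lemma D_functor: "is_functor (Lev (nerve C) (Suc n)) (Lev (nerve C) n) (D n)"
  unfolding D_def
  by (rule is_functor_comp[OF is_functor_comp[OF Phi_functor X_face_functor] Psi_functor]) simp

lemma S_functor: "is_functor (Lev (nerve C) n) (Lev (nerve C) (Suc n)) (S n)"
  unfolding S_def
  by (rule is_functor_comp[OF is_functor_comp[OF Phi_functor X_degen_functor] Psi_functor]) simp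

lemma D_apply:
  "x \<in> Obj (Lev (nerve C) (Suc n)) \<Longrightarrow>
     ObjMap (D n) x = ObjMap (\<Psi> n) (ObjMap (face X (Suc (Suc n)) (Suc (Suc n))) (ObjMap (\<Phi> (Suc n)) x))"
  "f \<in> Arr (Lev (nerve C) (Suc n)) \<Longrightarrow>
     ArrMap (D n) f = ArrMap (\<Psi> n) (ArrMap (face X (Suc (Suc n)) (Suc (Suc n))) (ArrMap (\<Phi> (Suc n)) f))"
  unfolding D_def by (simp_all del: Lev_nerve)

lemma S_apply:
  "x \<in> Obj (Lev (nerve C) n) \<Longrightarrow>
     ObjMap (S n) x = ObjMap (\<Psi> (Suc n)) (ObjMap (degen X (Suc n) (Suc n)) (ObjMap (\<Phi> n) x))"
  "f \<in> Arr (Lev (nerve C) n) \<Longrightarrow>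
     ArrMap (S n) f = ArrMap (\<Psi> (Suc n)) (ArrMap (degen X (Suc n) (Suc n)) (ArrMap (\<Phi> n) f))"
  unfolding S_def by (simp_all del: Lev_nerve)

lemmas DS_mem = is_functor_Obj[OF D_functor] is_functor_Arr[OF D_functor]
  is_functor_Obj[OF S_functor] is_functor_Arr[OF S_functor]
lemmas mem = Phi_mem Psi_mem X_mem N_mem DS_mem

lemma D_S:
  "x \<in> Obj (Lev (nerve C) n) \<Longrightarrow> ObjMap (D n) (ObjMap (S n) x) = x"
  "f \<in> Arr (Lev (nerve C) n) \<Longrightarrow> ArrMap (D n) (ArrMap (S n) f) = f"
  using comp_ftor_idD[OF X.face_degen_id[of "Suc n" "Suc n" "Suc (Suc n)"]]
  by (simp_all add: D_apply mem Phi_Psi Psi_Phi S_apply del: Lev_nerve)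

lemma face_top_S:
  "x \<in> Obj (Lev (nerve C) n) \<Longrightarrow> ObjMap (face (nerve C) (Suc n) (Suc n)) (ObjMap (S n) x) = x"
  "f \<in> Arr (Lev (nerve C) n) \<Longrightarrow> ArrMap (face (nerve C) (Suc n) (Suc n)) (ArrMap (S n) f) = f"
  using comp_ftor_idD[OF X.face_degen_id[of "Suc n" "Suc n" "Suc n"]]
  by (simp_all add: Psi_face mem Psi_Phi S_apply del: Lev_nerve)

lemma face_S:
  assumes "i \<le> Suc n"
  shows "x \<in> Obj (Lev (nerve C) (Suc n)) \<Longrightarrow>
      ObjMap (face (nerve C) (Suc (Suc n)) i) (ObjMap (S (Suc n)) x) =
      ObjMap (S n) (ObjMap (face (nerve C) (Suc n) i) x)"
  using comp_ftor_eqD(1)[OF X.face_degen_less[of i "Suc (Suc n)" "Suc (Suc n)"]] assms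
  by (simp add: Psi_face mem Phi_face S_apply del: Lev_nerve)

text \<open>The relation \<open>d_i s_j = s_j d_(i-1)\<close> for the top face and
  \<open>i = j + 2\<close>. It is the reason why \<open>D\<close> sends the chain
  \<open>a -> b = b\<close> to an arrow of the form \<open>eps\<close>.\<close>

lemma D_degen_top:
  assumes "x \<in> Obj (Lev (nerve C) (Suc n))"
  shows "ObjMap (D (Suc n)) (ObjMap (degen (nerve C) (Suc n) (Suc n)) x) = ObjMap (S n) (ObjMap (D n) x)"
  using comp_ftor_eqD(1)[OF X.face_degen_greater[of "Suc n" "Suc (Suc (Suc n))" "Suc (Suc n)"]] assms
  by (simp add: D_apply mem Phi_Psi Phi_degen S_apply del: Lev_nerve)

text \<open>The last face of the nerve, \<open>i = Suc n\<close>, is included: the relation relaxed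
  in \<open>X\<close> concerns the face \<open>Suc (Suc n)\<close> and the top one.\<close>

lemma face_D:
  assumes "i \<le> Suc n" "f \<in> Arr (Lev (nerve C) (Suc (Suc n)))"
  shows "ArrMap (face (nerve C) (Suc n) i) (ArrMap (D (Suc n)) f) =
    ArrMap (D n) (ArrMap (face (nerve C) (Suc (Suc n)) i) f)"
  using comp_ftor_eqD(2)[OF X.face_face[of "Suc (Suc (Suc n))" i "Suc (Suc (Suc n))"]] assms
  by (simp add: D_apply mem Psi_face Phi_face del: Lev_nerve)

text \<open>The image of the point of \<open>X_0\<close> under \<open>s_0\<close>. It will be a zero
  object, though not necessarily the given \<open>z\<close>.\<close>

definition e0 where
  "e0 = ObjMap (\<Psi> 0) (ObjMap (degen X 0 0) (SOME p. p \<in> Obj (Lev X 0)))"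

lemma X0_Obj: "x \<in> Obj (Lev X 0) \<Longrightarrow> x = (SOME p. p \<in> Obj (Lev X 0))"
  and X0_ne: "(SOME p. p \<in> Obj (Lev X 0)) \<in> Obj (Lev X 0)"
  and X0_Arr: "f \<in> Arr (Lev X 0) \<Longrightarrow> f = Idt (Lev X 0) (SOME p. p \<in> Obj (Lev X 0))"
proof -
  obtain p g where p: "Obj (Lev X 0) = {p}" and g: "Arr (Lev X 0) = {g}"
    using X.terminal_0 unfolding terminal_cat_def by blast
  interpret X0: category "Lev X 0" by (rule X.category_Lev)
  show "x \<in> Obj (Lev X 0) \<Longrightarrow> x = (SOME p. p \<in> Obj (Lev X 0))" using p by simp
  show "(SOME p. p \<in> Obj (Lev X 0)) \<in> Obj (Lev X 0)" using p by simp
  show "f \<in> Arr (Lev X 0) \<Longrightarrow> f = Idt (Lev X 0) (SOME p. p \<in> Obj (Lev X 0))"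
    using p g X0.Idt_hom[of p] by (simp add: hom_def)
qed

lemma e0_Obj: "e0 \<in> Obj (Lev (nerve C) 0)"
  unfolding e0_def using mem X0_ne by simp

lemma Psi_degen_0:
  "x \<in> Obj (Lev X 0) \<Longrightarrow> ObjMap (\<Psi> 0) (ObjMap (degen X 0 0) x) = e0"
  "f \<in> Arr (Lev X 0) \<Longrightarrow> ArrMap (\<Psi> 0) (ArrMap (degen X 0 0) f) = Idt (Lev (nerve C) 0) e0"
proof -
  show "x \<in> Obj (Lev X 0) \<Longrightarrow> ObjMap (\<Psi> 0) (ObjMap (degen X 0 0) x) = e0"
    using X0_Obj by (simp add: e0_def)
  show "f \<in> Arr (Lev X 0) \<Longrightarrow> ArrMap (\<Psi> 0) (ArrMap (degen X 0 0) f) = Idt (Lev (nerve C) 0) e0"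
    using X0_Arr[of f] is_functor.ArrMap_Idt[OF X_degen_functor[of 0 0] X0_ne]
      is_functor.ArrMap_Idt[OF Psi_functor[of 0] X_mem(3)[OF _ X0_ne, of 0]]
    by (simp add: e0_def)
qed

text \<open>By \<open>d_0 s_1 = s_0 d_0\<close> these composites pass through the terminal category
  \<open>X_0\<close>, so every object goes to \<open>e0\<close> and every arrow to its
  identity.\<close>

lemma face_0_S:
  "x \<in> Obj (Lev (nerve C) 0) \<Longrightarrow> ObjMap (face (nerve C) (Suc 0) 0) (ObjMap (S 0) x) = e0"
  "f \<in> Arr (Lev (nerve C) 0) \<Longrightarrow>
     ArrMap (face (nerve C) (Suc 0) 0) (ArrMap (S 0) f) = Idt (Lev (nerve C) 0) e0"
  using comp_ftor_eqD[OF X.face_degen_less[of 0 "Suc 0" "Suc 0"]]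
  by (simp_all add: Psi_face mem S_apply Psi_degen_0 del: Lev_nerve)

text \<open>From \<open>s_1 s_0 = s_0 s_0\<close> on \<open>X_0\<close>; it later makes
  \<open>eps e\<close> an identity.\<close>

lemma S_e0: "ObjMap (S 0) e0 = ObjMap (degen (nerve C) 0 0) e0"
proof -
  have "ObjMap (S 0) e0 = ObjMap (\<Psi> (Suc 0)) (ObjMap (degen X (Suc 0) 0) (ObjMap (\<Phi> 0) e0))"
    using comp_ftor_eqD(1)[OF X.degen_degen[of 0 0 0]] X0_ne e0_Obj
    by (simp add: S_apply e0_def Phi_Psi mem del: Lev_nerve)
  then show ?thesis
    using Phi_degen(1)[of 0 0 e0] e0_Obj Psi_Phi(1)[OF N_mem(3)[OF _ e0_Obj, of 0]] by simp
qed

text \<open>From \<open>d_2 s_0 = s_0 d_1\<close>, which again passes through \<open>X_0\<close>: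
  the kernel of an identity is \<open>e\<close>.\<close>

lemma D_degen_0:
  assumes "x \<in> Obj (Lev (nerve C) 0)"
  shows "ObjMap (D 0) (ObjMap (degen (nerve C) 0 0) x) = e0"
  using comp_ftor_eqD(1)[OF X.face_degen_greater[of 0 "Suc (Suc 0)" "Suc 0"]] assms
  by (simp add: D_apply mem Phi_degen Psi_degen_0 del: Lev_nerve)

text \<open>By (C3) the components of \<open>\<alpha>\<close> at both ends of \<open>m\<close> are identities, so that
  naturality of \<open>\<alpha>\<close> degenerates to an equation of arrows.\<close>

lemma D_D_eq:
  assumes f: "f \<in> Obj (Lev (nerve C) (Suc n))"
    and m: "m \<in> hom (Lev (nerve C) (Suc (Suc n)))
          (ObjMap (degen (nerve C) (Suc n) (Suc n)) f) (ObjMap (S (Suc n)) f)"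
  shows "ArrMap (D n) (ArrMap (D (Suc n)) m) =
    ArrMap (D n) (ArrMap (face (nerve C) (Suc (Suc n)) (Suc (Suc n))) m)"
proof -
  let ?k = "Suc (Suc n)"
  let ?y = "ObjMap (\<Phi> (Suc n)) f"
  let ?F = "face X ?k ?k \<odot>\<^bsub>Lev X (Suc ?k)\<^esub> face X (Suc ?k) (Suc ?k)"
  let ?G = "face X ?k ?k \<odot>\<^bsub>Lev X (Suc ?k)\<^esub> face X (Suc ?k) ?k"
  have mA: "m \<in> Arr (Lev (nerve C) ?k)" using m by (simp add: hom_def)
  have y: "?y \<in> Obj (Lev X ?k)" using mem(1)[OF f] .
  interpret \<alpha>: is_nat_trans "Lev X (Suc ?k)" "Lev X (Suc n)" ?F ?G "alpha X (Suc ?k)"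
    using X.alpha_nat[of "Suc ?k"] by simp
  let ?m = "ArrMap (\<Phi> ?k) m"
  have e: "ObjMap (\<Phi> ?k) (ObjMap (degen (nerve C) (Suc n) (Suc n)) f) = ObjMap (degen X ?k (Suc n)) ?y"
    "ObjMap (\<Phi> ?k) (ObjMap (S (Suc n)) f) = ObjMap (degen X ?k ?k) ?y"
    using f by (simp_all add: Phi_degen S_apply mem Phi_Psi del: Lev_nerve)
  have mh: "?m \<in> hom (Lev X (Suc ?k)) (ObjMap (degen X ?k (Suc n)) ?y) (ObjMap (degen X ?k ?k) ?y)"
    using is_functor.ArrMap_hom[OF Phi_functor m] by (simp only: e)
  then have mA': "?m \<in> Arr (Lev X (Suc ?k))" by (simp add: hom_def)
  have a: "alpha X (Suc ?k) (ObjMap (degen X ?k ?k) ?y) = Idt (Lev X (Suc n)) (ObjMap (face X ?k ?k) ?y)"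
    "alpha X (Suc ?k) (ObjMap (degen X ?k (Suc n)) ?y) = Idt (Lev X (Suc n)) (ObjMap (face X ?k ?k) ?y)"
    using fun_cong[OF X.C3(1)[of ?k], of ?y] fun_cong[OF X.C3(2)[of ?k], of ?y] y
    by (simp_all add: whisker_right_def id_nat_def)
  have fy: "ObjMap ?F (ObjMap (degen X ?k ?k) ?y) = ObjMap (face X ?k ?k) ?y"
    "ObjMap ?G (ObjMap (degen X ?k (Suc n)) ?y) = ObjMap (face X ?k ?k) ?y"
    using y comp_ftor_idD(1)[OF X.face_degen_id[of ?k ?k "Suc ?k"] y]
      comp_ftor_idD(1)[OF X.face_degen_id[of "Suc n" ?k ?k] y]
    by (simp_all add: mem)
  have "ArrMap ?F ?m = ArrMap ?G ?m"
    using \<alpha>.naturality[OF mh] \<alpha>.F.B.Idt_Cmp[OF \<alpha>.F.ArrMap_hom[OF mh]]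
      \<alpha>.F.B.Cmp_Idt[OF \<alpha>.G.ArrMap_hom[OF mh]] by (simp only: a fy)
  then have "ArrMap (face X ?k ?k) (ArrMap (face X (Suc ?k) (Suc ?k)) ?m) =
      ArrMap (face X ?k ?k) (ArrMap (face X (Suc ?k) ?k) ?m)"
    using mA' by simp
  \<comment> \<open>Out of level \<open>Suc ?k\<close> of \<open>X\<close> the face
    \<open>?k\<close> is not the top one, so under \<Phi> it is the last face of the nerve, while
    the top faces become \<open>D\<close>.\<close>
  then show ?thesis
    using mA by (simp add: D_apply mem Phi_Psi Phi_face del: Lev_nerve)
qed


subsection \<open>Arrows and commutative squares\<close>

definition c0 where "c0 a = mk_chain 0 (\<lambda>_. a) (\<lambda>_ _. Idt C a)"

definition c1 where
  "c1 f = mk_chain 1 (\<lambda>i. if i = 0 then Dom C f else Cod C f)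
     (\<lambda>i j. if j = 0 then Idt C (Dom C f) else if i = 0 then f else Idt C (Cod C f))"

definition a0 where "a0 a b u = (c0 a, c0 b, \<lambda>i\<in>{..0::nat}. u)"

text \<open>A square as a ladder between chains of length one. The term carries only the sides;
  commutativity is a hypothesis of the lemmas.\<close>

definition sq where "sq f f' u v = (c1 f, c1 f', \<lambda>i\<in>{..1::nat}. if i = 0 then u else v)"

lemma c0_functor: "a \<in> Obj C \<Longrightarrow> is_functor (ord_cat 0) C (c0 a)"
  unfolding c0_def by (rule is_functor_mk_chain) (auto simp: category_axioms Idt_hom Idt_Cmp[OF Idt_hom])

lemma c1_functor:
  assumes "f \<in> hom C a b"
  shows "is_functor (ord_cat (Suc 0)) C (c1 f)"
proof -
  have o: "a \<in> Obj C" "b \<in> Obj C" using in_hom_Obj[OF assms] by auto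
  have "is_functor (ord_cat 1) C (c1 f)"
    unfolding c1_def
    by (rule is_functor_mk_chain)
      (use assms hom_D[OF assms] o Cmp_Idt[OF assms] Idt_Cmp[OF assms]
        in \<open>auto simp: category_axioms Idt_hom Idt_Cmp[OF Idt_hom] le_Suc_eq\<close>)
  then show ?thesis by simp
qed

lemma c0_simps [simp]: "ObjMap (c0 a) 0 = a"
  by (simp add: c0_def)

lemma c1_simps [simp]:
  "ObjMap (c1 f) 0 = Dom C f" "ObjMap (c1 f) (Suc 0) = Cod C f" "ArrMap (c1 f) (0, Suc 0) = f"
  by (simp_all add: c1_def)

lemma c0_eqI: "is_functor (ord_cat 0) C F \<Longrightarrow> ObjMap F 0 = a \<Longrightarrow> F = c0 a"
  by (rule chain_eqI_Suc) (use chain_Obj[of 0 F 0] in \<open>auto intro: c0_functor\<close>)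

lemma c1_eqI:
  assumes F: "is_functor (ord_cat (Suc 0)) C F" and f: "ArrMap F (0, Suc 0) = f"
  shows "F = c1 f"
proof (rule chain_eqI_Suc[OF F])
  have h: "f \<in> hom C (ObjMap F 0) (ObjMap F (Suc 0))" using chain_hom[OF F, of 0 "Suc 0"] f by simp
  show "is_functor (ord_cat (Suc 0)) C (c1 f)" using c1_functor[OF h] .
  show "i \<le> Suc 0 \<Longrightarrow> ObjMap F i = ObjMap (c1 f) i" for i
    using hom_D[OF h] by (cases i) auto
  show "i < Suc 0 \<Longrightarrow> ArrMap F (i, Suc i) = ArrMap (c1 f) (i, Suc i)" for i
    using f by simp
qed

lemma a0_hom: "u \<in> hom C a b \<Longrightarrow> a0 a b u \<in> hom (fun_cat (ord_cat 0) C) (c0 a) (c0 b)"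
  unfolding a0_def fun_cat_hom
  using in_hom_Obj[of u a b] nat_transI[of 0 "c0 a" "c0 b" "\<lambda>_. u"] by (simp add: c0_functor)

lemma sq_hom:
  assumes "f \<in> hom C a b" "f' \<in> hom C a' b'" "u \<in> hom C a a'" "v \<in> hom C b b'" "v \<cdot> f = f' \<cdot> u"
  shows "sq f f' u v \<in> hom (fun_cat (ord_cat (Suc 0)) C) (c1 f) (c1 f')"
proof -
  have "is_nat_trans (ord_cat (Suc 0)) C (c1 f) (c1 f') (\<lambda>i\<in>{..Suc 0}. if i = 0 then u else v)"
    by (rule nat_transI)
      (use assms hom_D[OF assms(1)] hom_D[OF assms(2)] in
        \<open>auto simp: le_Suc_eq intro: c1_functor\<close>)
  then show ?thesis unfolding sq_def fun_cat_hom by simp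
qed

lemma a0_eqI:
  assumes "m \<in> hom (fun_cat (ord_cat 0) C) (c0 a) (c0 b)" "snd (snd m) 0 = u"
  shows "m = a0 a b u"
proof -
  obtain t where m: "m = (c0 a, c0 b, t)" and t: "is_nat_trans (ord_cat 0) C (c0 a) (c0 b) t"
    using assms(1) unfolding fun_cat_hom by blast
  have "u \<in> hom C a b" using nat_trans_component[OF t, of 0] assms(2) m by simp
  then have "is_nat_trans (ord_cat 0) C (c0 a) (c0 b) (\<lambda>i\<in>{..0::nat}. u)"
    using a0_hom unfolding a0_def fun_cat_hom by blast
  then show ?thesis
    unfolding m a0_def using nat_trans_eqI[OF t] assms(2) m by simp
qed

lemma sq_eqI:
  assumes "m \<in> hom (fun_cat (ord_cat (Suc 0)) C) (c1 f) (c1 f')"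
    and f: "f \<in> hom C a b" "f' \<in> hom C a' b'"
    and uv: "snd (snd m) 0 = u" "snd (snd m) (Suc 0) = v"
  shows "m = sq f f' u v"
    and "u \<in> hom C a a'" and "v \<in> hom C b b'" and "v \<cdot> f = f' \<cdot> u"
proof -
  obtain t where m: "m = (c1 f, c1 f', t)" and t: "is_nat_trans (ord_cat (Suc 0)) C (c1 f) (c1 f') t"
    using assms(1) unfolding fun_cat_hom by blast
  show h: "u \<in> hom C a a'" "v \<in> hom C b b'"
    using nat_trans_component[OF t, of 0] nat_trans_component[OF t, of "Suc 0"] uv m
      hom_D[OF f(1)] hom_D[OF f(2)] by auto
  show n: "v \<cdot> f = f' \<cdot> u"
    using nat_trans_naturality[OF t, of 0 "Suc 0"] uv m by simp
  have "is_nat_trans (ord_cat (Suc 0)) C (c1 f) (c1 f') (\<lambda>i\<in>{..Suc 0}. if i = 0 then u else v)"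
    using sq_hom[OF f h n] unfolding sq_def fun_cat_hom by simp
  then have "t = (\<lambda>i\<in>{..Suc 0}. if i = 0 then u else v)"
    by (rule nat_trans_eqI[OF t]) (use uv m in \<open>auto simp: le_Suc_eq\<close>)
  then show "m = sq f f' u v"
    unfolding m sq_def by simp
qed

lemma sq_Cmp:
  assumes "f \<in> hom C a b" "f' \<in> hom C a' b'" "f'' \<in> hom C a'' b''"
    "u \<in> hom C a a'" "v \<in> hom C b b'" "v \<cdot> f = f' \<cdot> u"
    "u' \<in> hom C a' a''" "v' \<in> hom C b' b''" "v' \<cdot> f' = f'' \<cdot> u'"
  shows "sq f' f'' u' v' \<cdot>\<^bsub>fun_cat (ord_cat (Suc 0)) C\<^esub> sq f f' u v = sq f f'' (u' \<cdot> u) (v' \<cdot> v)"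
  by (auto simp: sq_def vcomp_def fun_eq_iff le_Suc_eq)

section \<open>The arrows \<open>eps\<close> and the functor \<open>K\<close>, read off in the
  lowest degrees\<close>

definition e where "e = ObjMap e0 0"
definition eps where "eps a = ArrMap (ObjMap (S 0) (c0 a)) (0, Suc 0)"
definition K where "K f = ObjMap (ObjMap (D 0) (c1 f)) 0"
definition KA where "KA f f' u v = snd (snd (ArrMap (D 0) (sq f f' u v))) 0"

lemma e0_eq: "e0 = c0 e"
  using e0_Obj by (auto simp: e_def intro: c0_eqI)

lemma e_Obj: "e \<in> Obj C"
  using e0_Obj chain_Obj[of 0 e0 0] by (simp add: e_def)

text \<open>The two vertices are found by faces: the last face undoes \<open>S\<close>, and the face
  \<open>0\<close> after \<open>S\<close> is \<open>e0\<close>.\<close>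

lemma
  assumes a: "a \<in> Obj C"
  shows S_c0: "ObjMap (S 0) (c0 a) = c1 (eps a)"
    and eps_hom: "eps a \<in> hom C a e"
proof -
  let ?y = "ObjMap (S 0) (c0 a)"
  have c: "c0 a \<in> Obj (Lev (nerve C) 0)" using c0_functor[OF a] by simp
  have y: "is_functor (ord_cat (Suc 0)) C ?y" using DS_mem(3)[OF c] by simp
  have "ObjMap ?y 0 = a"
    using face_top_S(1)[OF c] face_nerve_simps(1)[OF y, of 0 "Suc 0"] by (simp add: coface_def)
  moreover have "ObjMap ?y (Suc 0) = e"
    using face_0_S(1)[OF c] face_nerve_simps(1)[OF y, of 0 0] by (simp add: coface_def e_def)
  ultimately show "eps a \<in> hom C a e" using chain_hom[OF y, of 0 "Suc 0"] by (simp add: eps_def)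
  show "?y = c1 (eps a)" by (rule c1_eqI[OF y]) (simp add: eps_def)
qed

text \<open>Naturality of \<open>eps\<close> is the commutativity of the square that
  \<open>S 0\<close> makes of \<open>u\<close>; its second side is \<open>Idt C e\<close> because it
  comes from the terminal category.\<close>

lemma
  assumes u: "u \<in> hom C a b"
  shows S_a0: "ArrMap (S 0) (a0 a b u) = sq (eps a) (eps b) u (Idt C e)"
    and eps_nat: "eps b \<cdot> u = eps a"
proof -
  let ?y = "ArrMap (S 0) (a0 a b u)"
  have o: "a \<in> Obj C" "b \<in> Obj C" using in_hom_Obj[OF u] by auto
  note ea = eps_hom[OF o(1)] and eb = eps_hom[OF o(2)]
  have c: "a0 a b u \<in> Arr (Lev (nerve C) 0)" using a0_hom[OF u] by (simp add: hom_def)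
  have h: "?y \<in> hom (fun_cat (ord_cat (Suc 0)) C) (c1 (eps a)) (c1 (eps b))"
    using is_functor.ArrMap_hom[OF S_functor[of 0], of "a0 a b u" "c0 a" "c0 b"] a0_hom[OF u]
      S_c0 o by simp
  then obtain t where y: "?y = (c1 (eps a), c1 (eps b), t)"
    and t: "is_nat_trans (ord_cat (Suc 0)) C (c1 (eps a)) (c1 (eps b)) t"
    unfolding fun_cat_hom by blast
  have "t 0 = u"
    using face_top_S(2)[OF c] face_nerve_simps(3)[OF t, of 0 "Suc 0"] y
    by (simp add: coface_def a0_def)
  moreover have "t (Suc 0) = Idt C e"
    using face_0_S(2)[OF c] face_nerve_simps(3)[OF t, of 0 0] y
    by (simp add: coface_def e0_eq id_nat_def)
  ultimately have uv: "snd (snd ?y) 0 = u" "snd (snd ?y) (Suc 0) = Idt C e"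
    using y by simp_all
  show "?y = sq (eps a) (eps b) u (Idt C e)" by (rule sq_eqI(1)[OF h ea eb uv])
  show "eps b \<cdot> u = eps a"
    using sq_eqI(4)[OF h ea eb uv] Idt_Cmp[OF ea] by simp
qed

lemma degen_c0: "a \<in> Obj C \<Longrightarrow> ObjMap (degen (nerve C) 0 0) (c0 a) = c1 (Idt C a)"
  by (rule c1_eqI)
    (use N_mem(3)[of 0 0 "c0 a"] c0_functor[of a] chain_Idt[OF c0_functor, of a 0]
      in \<open>auto simp: codegen_def\<close>)

lemma eps_e: "eps e = Idt C e"
  using S_e0 S_c0[OF e_Obj] degen_c0[OF e_Obj] c1_simps(3) by (metis e0_eq)

lemma K_Idt: "a \<in> Obj C \<Longrightarrow> K (Idt C a) = e"
  using D_degen_0[of "c0 a"] degen_c0[of a] c0_functor[of a] by (simp add: K_def e_def)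

lemma K_eps: "a \<in> Obj C \<Longrightarrow> K (eps a) = a"
  using D_S(1)[of "c0 a" 0] S_c0[of a] c0_functor[of a] by (simp add: K_def)

lemma KA_eps:
  assumes u: "u \<in> hom C a b"
  shows "KA (eps a) (eps b) u (Idt C e) = u"
  using D_S(2)[of "a0 a b u" 0] S_a0[OF u] a0_hom[OF u] by (simp add: KA_def a0_def hom_def)

lemma D_c1: "f \<in> hom C a b \<Longrightarrow> ObjMap (D 0) (c1 f) = c0 (K f)"
  using c1_functor DS_mem(1)[of "c1 f" 0] by (auto simp: K_def intro: c0_eqI)

lemma
  assumes "f \<in> hom C a b" "f' \<in> hom C a' b'" "u \<in> hom C a a'" "v \<in> hom C b b'" "v \<cdot> f = f' \<cdot> u"
  shows KA_hom: "KA f f' u v \<in> hom C (K f) (K f')"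
    and D_sq: "ArrMap (D 0) (sq f f' u v) = a0 (K f) (K f') (KA f f' u v)"
proof -
  have h: "ArrMap (D 0) (sq f f' u v) \<in> hom (fun_cat (ord_cat 0) C) (c0 (K f)) (c0 (K f'))"
    using is_functor.ArrMap_hom[OF D_functor[of 0], of "sq f f' u v" "c1 f" "c1 f'"] sq_hom[OF assms]
      D_c1[OF assms(1)] D_c1[OF assms(2)] by simp
  then obtain t where y: "ArrMap (D 0) (sq f f' u v) = (c0 (K f), c0 (K f'), t)"
    and t: "is_nat_trans (ord_cat 0) C (c0 (K f)) (c0 (K f')) t"
    unfolding fun_cat_hom by blast
  show "KA f f' u v \<in> hom C (K f) (K f')"
    using nat_trans_component[OF t, of 0] y by (simp add: KA_def)
  show "ArrMap (D 0) (sq f f' u v) = a0 (K f) (K f') (KA f f' u v)"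
    by (rule a0_eqI[OF h]) (simp add: KA_def)
qed

lemma KA_Cmp:
  assumes "f \<in> hom C a b" "f' \<in> hom C a' b'" "f'' \<in> hom C a'' b''"
    "u \<in> hom C a a'" "v \<in> hom C b b'" "v \<cdot> f = f' \<cdot> u"
    "u' \<in> hom C a' a''" "v' \<in> hom C b' b''" "v' \<cdot> f' = f'' \<cdot> u'"
  shows "KA f' f'' u' v' \<cdot> KA f f' u v = KA f f'' (u' \<cdot> u) (v' \<cdot> v)"
proof -
  have "ArrMap (D 0) (sq f f'' (u' \<cdot> u) (v' \<cdot> v)) =
      ArrMap (D 0) (sq f' f'' u' v') \<cdot>\<^bsub>fun_cat (ord_cat 0) C\<^esub> ArrMap (D 0) (sq f f' u v)"
    using is_functor.ArrMap_Cmp[OF D_functor[of 0], of "sq f f' u v" _ _ "sq f' f'' u' v'"]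
      sq_hom[OF assms(1,2,4-6)] sq_hom[OF assms(2,3,7-9)] sq_Cmp[OF assms] by simp
  then show ?thesis
    unfolding D_sq[OF assms(1,2,4-6)] D_sq[OF assms(2,3,7-9)]
    by (subst (3) KA_def) (simp add: a0_def vcomp_def)
qed

text \<open>\<open>D\<close> turns the morphism of chains with components \<open>Idt C a\<close>,
  \<open>Idt C b\<close>, \<open>eps b\<close> into a square from \<open>eps (K f)\<close> to
  \<open>f\<close>. Its first side is the kernel arrow because faces commute with \<open>D\<close>,
  and its second side serves as \<open>w\<close>. A further \<open>D\<close> makes it an identity by
  \<open>D_D_eq\<close>, since dropping the last vertex of the morphism leaves an identity.\<close>

lemma KA_ker:
  assumes f: "f \<in> hom C a b"
  shows "\<exists>w. w \<in> hom C e b \<and> w \<cdot> eps (K f) = f \<cdot> KA f (eps a) (Idt C a) (eps b) \<and>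
    KA (eps (K f)) f (KA f (eps a) (Idt C a) (eps b)) w = Idt C (K f)"
proof -
  have o: "a \<in> Obj C" "b \<in> Obj C" using in_hom_Obj[OF f] by auto
  note ia = Idt_hom[OF o(1)] and ib = Idt_hom[OF o(2)]
  note ea = eps_hom[OF o(1)] and eb = eps_hom[OF o(2)]
  have c: "c1 f \<in> Obj (Lev (nerve C) (Suc 0))" using c1_functor[OF f] by simp
  let ?x = "ObjMap (degen (nerve C) (Suc 0) (Suc 0)) (c1 f)"
  let ?y = "ObjMap (S (Suc 0)) (c1 f)"
  have xF: "is_functor (ord_cat (Suc (Suc 0))) C ?x" using N_mem(3)[OF _ c, of "Suc 0"] by simp
  have yF: "is_functor (ord_cat (Suc (Suc 0))) C ?y" using DS_mem(3)[OF c] by simp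
  have x: "ObjMap ?x 0 = a" "ObjMap ?x (Suc 0) = b" "ObjMap ?x (Suc (Suc 0)) = b"
    "ArrMap ?x (0, Suc 0) = f" "ArrMap ?x (Suc 0, Suc (Suc 0)) = Idt C b"
    "ArrMap ?x (0, Suc (Suc 0)) = f"
    using c1_functor[OF f] hom_D[OF f] chain_Idt[OF c1_functor[OF f], of "Suc 0"]
    by (simp_all add: codegen_def)
  have y1: "ObjMap ?y 0 = a" "ObjMap ?y (Suc 0) = b" "ArrMap ?y (0, Suc 0) = f"
    using face_top_S(1)[OF c] face_nerve_simps(1)[OF yF, of 0 "Suc (Suc 0)"]
      face_nerve_simps(1)[OF yF, of "Suc 0" "Suc (Suc 0)"]
      face_nerve_simps(2)[OF yF, of 0 "Suc 0" "Suc (Suc 0)"] hom_D[OF f]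
    by (simp_all add: coface_def)
  have "ObjMap (face (nerve C) (Suc 0) 0) (c1 f) = c0 b"
    using N_mem(1)[OF _ c, of 0] c1_functor[OF f] hom_D[OF f]
    by (intro c0_eqI) (auto simp: coface_def)
  then have "ObjMap (face (nerve C) (Suc (Suc 0)) 0) ?y = c1 (eps b)"
    using face_S[OF _ c, of 0] S_c0[OF o(2)] by simp
  then have y2: "ArrMap ?y (Suc 0, Suc (Suc 0)) = eps b" "ObjMap ?y (Suc (Suc 0)) = e"
    using face_nerve_simps(2)[OF yF, of 0 "Suc 0" 0] face_nerve_simps(1)[OF yF, of "Suc 0" 0]
      hom_D[OF eb] by (simp_all add: coface_def)
  have y3: "ArrMap ?y (0, Suc (Suc 0)) = eps a"
    using chain_Cmp[OF yF, of 0 "Suc 0" "Suc (Suc 0)"] y1 y2 eps_nat[OF f] by simp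
  define t where "t i = (if i = 0 then Idt C a else if i = 1 then Idt C b else eps b)" for i :: nat
  define m where "m = (?x, ?y, \<lambda>i\<in>{..Suc (Suc 0)}. t i)"
  have mt: "is_nat_trans (ord_cat (Suc (Suc 0))) C ?x ?y (\<lambda>i\<in>{..Suc (Suc 0)}. t i)"
  proof (rule nat_transI[OF xF yF])
    show "i \<le> Suc (Suc 0) \<Longrightarrow> t i \<in> hom C (ObjMap ?x i) (ObjMap ?y i)" for i
      using ia ib eb x(1-3) y1(1,2) y2(2) by (auto simp: t_def le_Suc_eq simp del: degen_nerve_simps)
    fix i :: nat assume "i < Suc (Suc 0)"
    then consider "i = 0" | "i = 1" by linarith
    then show "t (Suc i) \<cdot> ArrMap ?x (i, Suc i) = ArrMap ?y (i, Suc i) \<cdot> t i"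
      by cases (use x(4,5) y1(3) y2(1) Cmp_Idt[OF f] Idt_Cmp[OF f]
        in \<open>simp_all add: t_def del: degen_nerve_simps\<close>)
  qed
  then have mh: "m \<in> hom (Lev (nerve C) (Suc (Suc 0))) ?x ?y"
    unfolding m_def by (simp add: fun_cat_hom)
  then have mA: "m \<in> Arr (Lev (nerve C) (Suc (Suc 0)))" by (simp add: hom_def)
  let ?k = "KA f (eps a) (Idt C a) (eps b)"
  have Kf: "K f \<in> Obj C"
    using chain_Obj[of 0 "ObjMap (D 0) (c1 f)" 0] DS_mem(1)[OF c] by (simp add: K_def)
  note eK = eps_hom[OF Kf]
  let ?d = "ArrMap (D (Suc 0)) m"
  \<comment> \<open>The source is \<open>D\<close> of a degenerate chain, that is \<open>S\<close>
    of \<open>D\<close>; at the target \<open>D\<close> undoes \<open>S\<close>.\<close>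
  have dh: "?d \<in> hom (fun_cat (ord_cat (Suc 0)) C) (c1 (eps (K f))) (c1 f)"
    using is_functor.ArrMap_hom[OF D_functor[of "Suc 0"] mh] D_degen_top[OF c] D_S(1)[OF c]
      D_c1[OF f] S_c0[OF Kf] by simp
  have sqs: "eps b \<cdot> f = eps a \<cdot> Idt C a" using eps_nat[OF f] Cmp_Idt[OF ea] by simp
  \<comment> \<open>Dropping the middle vertex leaves the square whose image under \<open>K\<close>
    is the kernel arrow.\<close>
  have d1m: "ArrMap (face (nerve C) (Suc (Suc 0)) (Suc 0)) m = sq f (eps a) (Idt C a) (eps b)"
  proof (rule sq_eqI(1)[OF _ f ea])
    have "ObjMap (face (nerve C) (Suc (Suc 0)) (Suc 0)) ?x = c1 f"
      by (rule c1_eqI) (use N_mem(1)[of "Suc 0" "Suc 0" ?x] xF x(6) in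
        \<open>simp_all add: coface_def del: degen_nerve_simps\<close>)
    moreover have "ObjMap (face (nerve C) (Suc (Suc 0)) (Suc 0)) ?y = c1 (eps a)"
      by (rule c1_eqI) (use N_mem(1)[of "Suc 0" "Suc 0" ?y] yF y3 in \<open>simp_all add: coface_def\<close>)
    ultimately show "ArrMap (face (nerve C) (Suc (Suc 0)) (Suc 0)) m \<in>
        hom (fun_cat (ord_cat (Suc 0)) C) (c1 f) (c1 (eps a))"
      using is_functor.ArrMap_hom[OF N_face_functor[of "Suc 0" "Suc 0"] mh] by simp
    show "snd (snd (ArrMap (face (nerve C) (Suc (Suc 0)) (Suc 0)) m)) 0 = Idt C a"
      "snd (snd (ArrMap (face (nerve C) (Suc (Suc 0)) (Suc 0)) m)) (Suc 0) = eps b"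
      unfolding m_def by (simp_all add: face_nerve_simps(3)[OF mt] coface_def) (simp_all add: t_def)
  qed
  have d2m: "ArrMap (face (nerve C) (Suc (Suc 0)) (Suc (Suc 0))) m =
      Idt (Lev (nerve C) (Suc 0)) (c1 f)"
  proof -
    have "ObjMap (face (nerve C) (Suc (Suc 0)) (Suc (Suc 0))) ?x = c1 f"
      by (rule c1_eqI) (use N_mem(1)[of "Suc (Suc 0)" "Suc 0" ?x] xF x(4) in
        \<open>simp_all add: coface_def del: degen_nerve_simps\<close>)
    moreover have "ObjMap (face (nerve C) (Suc (Suc 0)) (Suc (Suc 0))) ?y = c1 f"
      by (rule c1_eqI) (use N_mem(1)[of "Suc (Suc 0)" "Suc 0" ?y] yF y1(3) in \<open>simp_all add: coface_def\<close>)
    ultimately have h: "ArrMap (face (nerve C) (Suc (Suc 0)) (Suc (Suc 0))) m \<in>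
        hom (fun_cat (ord_cat (Suc 0)) C) (c1 f) (c1 f)"
      using is_functor.ArrMap_hom[OF N_face_functor[of "Suc (Suc 0)" "Suc 0"] mh] by simp
    have "ArrMap (face (nerve C) (Suc (Suc 0)) (Suc (Suc 0))) m = sq f f (Idt C a) (Idt C b)"
      by (rule sq_eqI(1)[OF h f f]) (simp_all add: m_def face_nerve_simps(3)[OF mt] coface_def, simp_all add: t_def)
    also have "\<dots> = Idt (Lev (nerve C) (Suc 0)) (c1 f)"
      using hom_D[OF f] by (auto simp: sq_def id_nat_def le_Suc_eq fun_eq_iff restrict_def)
    finally show ?thesis .
  qed
  \<comment> \<open>The first side of a square is its last face, and \<open>face_D\<close> moves
    this face past \<open>D\<close>.\<close>
  have comp0: "snd (snd ?d) 0 = ?k"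
  proof -
    obtain s where d: "?d = (c1 (eps (K f)), c1 f, s)"
      and s: "is_nat_trans (ord_cat (Suc 0)) C (c1 (eps (K f))) (c1 f) s"
      using dh unfolding fun_cat_hom by blast
    have "s 0 = snd (snd (ArrMap (face (nerve C) (Suc 0) (Suc 0)) ?d)) 0"
      unfolding d using s by (simp add: coface_def)
    also have "\<dots> = ?k"
      using face_D[OF _ mA, of "Suc 0"] d1m by (simp add: KA_def)
    finally show ?thesis using d by simp
  qed
  note w = sq_eqI[OF dh eK f comp0 refl]
  let ?w = "snd (snd ?d) (Suc 0)"
  have "ArrMap (D 0) ?d = Idt (Lev (nerve C) 0) (c0 (K f))"
    using D_D_eq[OF c mh] d2m is_functor.ArrMap_Idt[OF D_functor[of 0] c] D_c1[OF f] by simp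
  then have "KA (eps (K f)) f ?k ?w = Idt C (K f)"
    by (subst KA_def) (simp add: w(1)[symmetric] id_nat_def)
  then show ?thesis using w(3,4) by blast
qed

lemma nerve_has_kernels: "has_kernels C z"
proof (rule has_kernelsI)
  fix f assume "f \<in> Arr C"
  note f = Arr_hom[OF this]
  have "is_kernel f (KA f (eps (Dom C f)) (Idt C (Dom C f)) (eps (Cod C f)))"
    by (rule is_kernel_of_functor[where e = e and K = K])
      (rule e_Obj eps_hom eps_nat eps_e KA_hom KA_Cmp K_Idt K_eps KA_eps KA_ker f; assumption)+
  then show "\<exists>k. is_kernel f k" ..
qed

end

section \<open>The kernel comonad on chains\<close>

locale kernels = pointed_category C z for C :: "('o, 'a) cat" (structure) and z +
  fixes \<kappa> :: "'a \<Rightarrow> 'a"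
  assumes kernel_choice: "kernel_choice C z \<kappa>"
begin

definition ker :: "'a \<Rightarrow> 'o" where "ker f = Dom C (\<kappa> f)"

lemma kappa_hom: "f \<in> hom C a b \<Longrightarrow> \<kappa> f \<in> hom C (ker f) a"
  using kernel_choice unfolding kernel_choice_def ker_def hom_def by auto

lemma kappa_zero: "f \<in> hom C a b \<Longrightarrow> zero_arrow C z (f \<cdot> \<kappa> f)"
  using kernel_choice unfolding kernel_choice_def hom_def by auto

lemma kappa_Idt: "a \<in> Obj C \<Longrightarrow> \<kappa> (Idt C a) = from_zero C z a"
  using kernel_choice unfolding kernel_choice_def by auto

lemma kappa_to_zero:
  assumes "f \<in> hom C a z"
  shows "\<kappa> f = Idt C a"
  using kernel_choice to_zero_unique[OF assms] in_hom_Obj[OF assms]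
  unfolding kernel_choice_def by auto

lemma ker_to_zero: "f \<in> hom C a z \<Longrightarrow> ker f = a"
  using kappa_to_zero[of f a] in_hom_Obj[of f a z] hom_D[OF Idt_hom, of a] by (simp add: ker_def)

lemma ker_Idt: "a \<in> Obj C \<Longrightarrow> ker (Idt C a) = z"
  using kappa_Idt[of a] hom_D[OF from_zero_hom, of a] by (simp add: ker_def)

lemma kappa_lift:
  assumes "f \<in> hom C a b" "g \<in> hom C c a" "zero_arrow C z (f \<cdot> g)"
  shows "\<exists>!h. h \<in> hom C c (ker f) \<and> \<kappa> f \<cdot> h = g"
proof -
  have "\<forall>f \<in> Arr C. \<forall>g \<in> Arr C. Cod C g = Dom C f \<longrightarrow> zero_arrow C z (f \<cdot> g) \<longrightarrow>
      (\<exists>!h. h \<in> hom C (Dom C g) (Dom C (\<kappa> f)) \<and> \<kappa> f \<cdot> h = g)"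
    using kernel_choice unfolding kernel_choice_def by (elim conjE)
  from this[rule_format, of f g] show ?thesis
    using hom_D[OF assms(1)] hom_D[OF assms(2)] assms(3) by (simp add: ker_def)
qed

lemma kappa_mono:
  assumes f: "f \<in> hom C a b" and h: "h \<in> hom C c (ker f)" "h' \<in> hom C c (ker f)"
    and e: "\<kappa> f \<cdot> h = \<kappa> f \<cdot> h'"
  shows "h = h'"
proof -
  note k = kappa_hom[OF f]
  have "zero_arrow C z (f \<cdot> (\<kappa> f \<cdot> h))"
    using zero_arrow_Cmp_right[OF kappa_zero[OF f] h(1) Cmp_hom[OF k f]] Cmp_assoc[OF h(1) k f] by simp
  then show ?thesis using kappa_lift[OF f Cmp_hom[OF h(1) k]] h e by metis
qed

definition kmap :: "'a \<Rightarrow> 'a \<Rightarrow> 'a \<Rightarrow> 'a" where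
  "kmap f f' u = (THE h. h \<in> hom C (ker f) (ker f') \<and> \<kappa> f' \<cdot> h = u \<cdot> \<kappa> f)"

text \<open>Since \<open>\<kappa> f'\<close> is monic, an equation for \<open>kmap\<close> can be
  tested after composition with it; the computations of \<open>kmap\<close> below go this
  way.\<close>

lemma kmap_unique:
  assumes f: "f \<in> hom C a b" "f' \<in> hom C a' b'" and h: "h \<in> hom C (ker f) (ker f')" "\<kappa> f' \<cdot> h = u \<cdot> \<kappa> f"
  shows "kmap f f' u = h"
  unfolding kmap_def
proof (rule the_equality)
  show "h \<in> hom C (ker f) (ker f') \<and> \<kappa> f' \<cdot> h = u \<cdot> \<kappa> f" using h by simp
  show "h' = h" if "h' \<in> hom C (ker f) (ker f') \<and> \<kappa> f' \<cdot> h' = u \<cdot> \<kappa> f" for h'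
    using kappa_mono[OF f(2), of h' "ker f" h] h that by simp
qed

text \<open>The arrow \<open>v\<close> only has to exist: it turns \<open>f' u (\<kappa> f)\<close>
  into \<open>v f (\<kappa> f)\<close>, which is zero. The lift is determined by \<open>u\<close>,
  so \<open>v\<close> is not an argument of \<open>kmap\<close>.\<close>

lemma
  assumes f: "f \<in> hom C a b" "f' \<in> hom C a' b'" and u: "u \<in> hom C a a'" and v: "v \<in> hom C b b'"
    and s: "f' \<cdot> u = v \<cdot> f"
  shows kmap_hom: "kmap f f' u \<in> hom C (ker f) (ker f')"
    and kappa_kmap: "\<kappa> f' \<cdot> kmap f f' u = u \<cdot> \<kappa> f"
proof -
  note k = kappa_hom[OF f(1)]
  have "f' \<cdot> (u \<cdot> \<kappa> f) = v \<cdot> (f \<cdot> \<kappa> f)"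
    using Cmp_assoc[OF k u f(2)] Cmp_assoc[OF k f(1) v] s by metis
  then have "zero_arrow C z (f' \<cdot> (u \<cdot> \<kappa> f))"
    using zero_arrow_Cmp_left[OF kappa_zero[OF f(1)] Cmp_hom[OF k f(1)] v] by simp
  from kappa_lift[OF f(2) Cmp_hom[OF k u] this]
  have "\<exists>!h. h \<in> hom C (ker f) (ker f') \<and> \<kappa> f' \<cdot> h = u \<cdot> \<kappa> f" .
  from theI'[OF this] show "kmap f f' u \<in> hom C (ker f) (ker f')" "\<kappa> f' \<cdot> kmap f f' u = u \<cdot> \<kappa> f"
    by (simp_all add: kmap_def)
qed

lemma kmap_Idt:
  assumes f: "f \<in> hom C a b"
  shows "kmap f f (Idt C a) = Idt C (ker f)"
proof (rule kmap_unique[OF f f])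
  note k = kappa_hom[OF f]
  show "Idt C (ker f) \<in> hom C (ker f) (ker f)" using Idt_hom in_hom_Obj[OF k] by blast
  show "\<kappa> f \<cdot> Idt C (ker f) = Idt C a \<cdot> \<kappa> f" using Cmp_Idt[OF k] Idt_Cmp[OF k] by simp
qed

lemma kmap_Cmp:
  assumes f: "f \<in> hom C a b" "f' \<in> hom C a' b'" "f'' \<in> hom C a'' b''"
    and u: "u \<in> hom C a a'" "u' \<in> hom C a' a''" and v: "v \<in> hom C b b'" "v' \<in> hom C b' b''"
    and s: "f' \<cdot> u = v \<cdot> f" "f'' \<cdot> u' = v' \<cdot> f'"
  shows "kmap f' f'' u' \<cdot> kmap f f' u = kmap f f'' (u' \<cdot> u)"
proof (rule kmap_unique[OF f(1,3), symmetric])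
  note k = kmap_hom[OF f(1,2) u(1) v(1) s(1)] and k' = kmap_hom[OF f(2,3) u(2) v(2) s(2)]
  show "kmap f' f'' u' \<cdot> kmap f f' u \<in> hom C (ker f) (ker f'')" using Cmp_hom[OF k k'] .
  show "\<kappa> f'' \<cdot> (kmap f' f'' u' \<cdot> kmap f f' u) = (u' \<cdot> u) \<cdot> \<kappa> f"
    using Cmp_assoc[OF k k' kappa_hom[OF f(3)]] Cmp_assoc[OF k kappa_hom[OF f(2)] u(2)]
      Cmp_assoc[OF kappa_hom[OF f(1)] u]
      kappa_kmap[OF f(1,2) u(1) v(1) s(1)] kappa_kmap[OF f(2,3) u(2) v(2) s(2)] by metis
qed

lemma kmap_to_zero:
  assumes "f \<in> hom C a z" "f' \<in> hom C a' z" "u \<in> hom C a a'"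
  shows "kmap f f' u = u"
  by (rule kmap_unique[OF assms(1,2)])
    (use assms kappa_to_zero ker_to_zero Cmp_Idt[OF assms(3)] Idt_Cmp[OF assms(3)] in simp_all)

section \<open>The endofunctor of kernels of the maps into the last vertex, and its counit\<close>

definition LO :: "nat \<Rightarrow> ('o, 'a) nerve_obj \<Rightarrow> ('o, 'a) nerve_obj" where
  "LO n F = mk_chain n (\<lambda>i. ker (ArrMap F (i, n)))
     (\<lambda>i j. kmap (ArrMap F (i, n)) (ArrMap F (j, n)) (ArrMap F (i, j)))"

definition L :: "nat \<Rightarrow> (('o, 'a) nerve_obj, ('o, 'a) nerve_arr, ('o, 'a) nerve_obj, ('o, 'a) nerve_arr) ftor"
  where
  "L n = \<lparr>ObjMap = \<lambda>F\<in>Obj (fun_cat (ord_cat n) C). LO n F,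
    ArrMap = \<lambda>(F, G, t)\<in>Arr (fun_cat (ord_cat n) C).
      (LO n F, LO n G, \<lambda>i\<in>{..n}. kmap (ArrMap F (i, n)) (ArrMap G (i, n)) (t i))\<rparr>"

definition \<iota> :: "nat \<Rightarrow> ('o, 'a) nerve_obj \<Rightarrow> ('o, 'a) nerve_arr" where
  "\<iota> n F = (LO n F, F, \<lambda>i\<in>{..n}. \<kappa> (ArrMap F (i, n)))"

lemma L_Obj [simp]: "is_functor (ord_cat n) C F \<Longrightarrow> ObjMap (L n) F = LO n F"
  by (simp add: L_def)

lemma L_Arr [simp]: "is_nat_trans (ord_cat n) C F G t \<Longrightarrow> ArrMap (L n) (F, G, t) =
    (LO n F, LO n G, \<lambda>i\<in>{..n}. kmap (ArrMap F (i, n)) (ArrMap G (i, n)) (t i))"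
  by (simp add: L_def)

lemma LO_simps [simp]:
  "i \<le> n \<Longrightarrow> ObjMap (LO n F) i = ker (ArrMap F (i, n))"
  "i \<le> j \<Longrightarrow> j \<le> n \<Longrightarrow>
     ArrMap (LO n F) (i, j) = kmap (ArrMap F (i, n)) (ArrMap F (j, n)) (ArrMap F (i, j))"
  by (simp_all add: LO_def)

context
  fixes n F
  assumes F: "is_functor (ord_cat n) C F"
begin

text \<open>The identity on the right gives the shape that the lemmas on \<open>kmap\<close> expect:
  a square between two arrows into the same last vertex.\<close>

lemma chain_square:
  assumes "i \<le> j" "j \<le> n"
  shows "ArrMap F (j, n) \<cdot> ArrMap F (i, j) = Idt C (ObjMap F n) \<cdot> ArrMap F (i, n)"
  using chain_Cmp[OF F assms le_refl] Idt_Cmp[OF chain_hom[OF F, of i n]] assms by simp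

lemma chain_Idt_hom: "Idt C (ObjMap F n) \<in> hom C (ObjMap F n) (ObjMap F n)"
  using Idt_hom chain_Obj[OF F] by simp

lemma kmap_chain_hom:
  assumes "i \<le> j" "j \<le> n"
  shows "kmap (ArrMap F (i, n)) (ArrMap F (j, n)) (ArrMap F (i, j)) \<in>
    hom C (ker (ArrMap F (i, n))) (ker (ArrMap F (j, n)))"
  by (rule kmap_hom[OF _ _ _ chain_Idt_hom chain_square]) (use assms chain_hom[OF F] in auto)

lemma LO_functor: "is_functor (ord_cat n) C (LO n F)"
  unfolding LO_def
proof (rule is_functor_mk_chain[OF category_axioms])
  show "i \<le> n \<Longrightarrow> ker (ArrMap F (i, n)) \<in> Obj C" for i
    using in_hom_Obj[OF kappa_hom[OF chain_hom[OF F, of i n]]] by simp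
  show "kmap (ArrMap F (i, n)) (ArrMap F (j, n)) (ArrMap F (i, j)) \<in>
      hom C (ker (ArrMap F (i, n))) (ker (ArrMap F (j, n)))" if "i \<le> j" "j \<le> n" for i j
    using kmap_chain_hom[OF that] .
  show "kmap (ArrMap F (i, n)) (ArrMap F (i, n)) (ArrMap F (i, i)) = Idt C (ker (ArrMap F (i, n)))"
    if "i \<le> n" for i
    using kmap_Idt[OF chain_hom[OF F, of i n]] chain_Idt[OF F that] that by simp
  show "kmap (ArrMap F (j, n)) (ArrMap F (k, n)) (ArrMap F (j, k)) \<cdot>
      kmap (ArrMap F (i, n)) (ArrMap F (j, n)) (ArrMap F (i, j)) =
      kmap (ArrMap F (i, n)) (ArrMap F (k, n)) (ArrMap F (i, k))"
    if h: "i \<le> j" "j \<le> k" "k \<le> n" for i j k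
  proof -
    have "j \<le> n" "i \<le> n" using h by auto
    note le = this h(3)
    show ?thesis
      using kmap_Cmp[OF chain_hom[OF F le(2) le_refl] chain_hom[OF F le(1) le_refl]
          chain_hom[OF F le(3) le_refl] chain_hom[OF F h(1) le(1)] chain_hom[OF F h(2,3)]
          chain_Idt_hom chain_Idt_hom chain_square[OF h(1) le(1)] chain_square[OF h(2,3)]]
      by (simp add: chain_Cmp[OF F h])
  qed
qed

text \<open>The last entry is the kernel of an identity; the normalisation at identities makes it
  \<open>z\<close> itself and not merely some zero object.\<close>

lemma LO_top: "ObjMap (LO n F) n = z"
  using chain_Idt[OF F, of n] chain_Obj[OF F, of n] by (simp add: ker_Idt)

text \<open>The normalisation at arrows into \<open>z\<close> enters here: their kernels are
  identities, so the induced arrows are the original ones.\<close>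

lemma LO_eq:
  assumes z: "ObjMap F n = z"
  shows "LO n F = F"
proof (rule chain_eqI[OF LO_functor F])
  have h: "ArrMap F (i, n) \<in> hom C (ObjMap F i) z" if "i \<le> n" for i
    using chain_hom[OF F that] z by simp
  show "ObjMap (LO n F) i = ObjMap F i" if "i \<le> n" for i
    using ker_to_zero[OF h[OF that]] that by simp
  show "ArrMap (LO n F) (i, j) = ArrMap F (i, j)" if "i \<le> j" "j \<le> n" for i j
    using kmap_to_zero[OF h h chain_hom[OF F that]] that by simp
qed

lemma iota_nat: "is_nat_trans (ord_cat n) C (LO n F) F (\<lambda>i\<in>{..n}. \<kappa> (ArrMap F (i, n)))"
proof (rule nat_transI[OF LO_functor F])
  show "i \<le> n \<Longrightarrow> \<kappa> (ArrMap F (i, n)) \<in> hom C (ObjMap (LO n F) i) (ObjMap F i)" for i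
    using kappa_hom[OF chain_hom[OF F, of i n]] by simp
  show "\<kappa> (ArrMap F (Suc i, n)) \<cdot> ArrMap (LO n F) (i, Suc i) =
      ArrMap F (i, Suc i) \<cdot> \<kappa> (ArrMap F (i, n))" if "i < n" for i
    using that kappa_kmap[OF chain_hom[OF F] chain_hom[OF F] chain_hom[OF F] chain_Idt_hom chain_square,
        of i "Suc i"] by simp
qed

lemma iota_hom: "\<iota> n F \<in> hom (fun_cat (ord_cat n) C) (LO n F) F"
  unfolding \<iota>_def fun_cat_hom using iota_nat by blast

lemma iota_eq:
  assumes z: "ObjMap F n = z"
  shows "\<iota> n F = Idt (fun_cat (ord_cat n) C) F"
proof -
  have "\<kappa> (ArrMap F (i, n)) = Idt C (ObjMap F i)" if "i \<le> n" for i
    using chain_hom[OF F that] z by (intro kappa_to_zero) simp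
  then show ?thesis by (auto simp: \<iota>_def LO_eq[OF z] id_nat_def fun_eq_iff restrict_def)
qed

text \<open>In \<open>LO n F\<close> the arrows into the last vertex end in \<open>z\<close>, so
  their kernels are identities. The arrow \<open>h\<close> induced by the kernel \<open>k\<close> of
  a map is then characterised by \<open>k h = k\<close>, which the identity satisfies.\<close>

lemma L_iota: "ArrMap (L n) (\<iota> n F) = Idt (fun_cat (ord_cat n) C) (LO n F)"
proof -
  have "kmap (ArrMap (LO n F) (i, n)) (ArrMap F (i, n)) (\<kappa> (ArrMap F (i, n))) =
      Idt C (ker (ArrMap F (i, n)))" if i: "i \<le> n" for i
  proof -
    note f = chain_hom[OF F i le_refl]
    have g: "ArrMap (LO n F) (i, n) \<in> hom C (ker (ArrMap F (i, n))) z"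
      using chain_hom[OF LO_functor i le_refl] LO_top i by simp
    have I: "Idt C (ker (ArrMap F (i, n))) \<in> hom C (ker (ArrMap F (i, n))) (ker (ArrMap F (i, n)))"
      using Idt_hom in_hom_Obj[OF g] by blast
    show ?thesis
      by (rule kmap_unique[OF g f]) (use I kappa_to_zero[OF g] ker_to_zero[OF g] in simp_all)
  qed
  then show ?thesis
    using iota_nat LO_functor
    by (auto simp: \<iota>_def id_nat_def fun_eq_iff restrict_def kernels.LO_eq[OF kernels_axioms LO_functor LO_top])
qed

end

context
  fixes n F G t
  assumes t: "is_nat_trans (ord_cat n) C F G t"
begin

lemma nat_square: "i \<le> n \<Longrightarrow> ArrMap G (i, n) \<cdot> t i = t n \<cdot> ArrMap F (i, n)"
  using nat_trans_naturality[OF t] by simp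

lemma
  assumes i: "i \<le> n"
  shows nat_kmap_hom: "kmap (ArrMap F (i, n)) (ArrMap G (i, n)) (t i) \<in>
      hom C (ker (ArrMap F (i, n))) (ker (ArrMap G (i, n)))"
    and nat_kappa_kmap: "\<kappa> (ArrMap G (i, n)) \<cdot> kmap (ArrMap F (i, n)) (ArrMap G (i, n)) (t i) =
      t i \<cdot> \<kappa> (ArrMap F (i, n))"
proof -
  have FG: "is_functor (ord_cat n) C F" "is_functor (ord_cat n) C G"
    using nat_trans_functors[OF t] by auto
  note h = chain_hom[OF FG(1) i le_refl] chain_hom[OF FG(2) i le_refl]
    nat_trans_component[OF t i] nat_trans_component[OF t le_refl] nat_square[OF i]
  show "kmap (ArrMap F (i, n)) (ArrMap G (i, n)) (t i) \<in>
      hom C (ker (ArrMap F (i, n))) (ker (ArrMap G (i, n)))" by (rule kmap_hom[OF h])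
  show "\<kappa> (ArrMap G (i, n)) \<cdot> kmap (ArrMap F (i, n)) (ArrMap G (i, n)) (t i) =
      t i \<cdot> \<kappa> (ArrMap F (i, n))" by (rule kappa_kmap[OF h])
qed

lemma L_nat_trans: "is_nat_trans (ord_cat n) C (LO n F) (LO n G)
    (\<lambda>i\<in>{..n}. kmap (ArrMap F (i, n)) (ArrMap G (i, n)) (t i))"
proof -
  have F: "is_functor (ord_cat n) C F" and G: "is_functor (ord_cat n) C G"
    using nat_trans_functors[OF t] by auto
  show ?thesis
  proof (rule nat_transI[OF LO_functor[OF F] LO_functor[OF G]])
    show "i \<le> n \<Longrightarrow> kmap (ArrMap F (i, n)) (ArrMap G (i, n)) (t i) \<in>
        hom C (ObjMap (LO n F) i) (ObjMap (LO n G) i)" for i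
      using nat_kmap_hom by simp
    fix i assume i: "i < n"
    then have i': "i \<le> n" "Suc i \<le> n" "i \<le> Suc i" by auto
    show "kmap (ArrMap F (Suc i, n)) (ArrMap G (Suc i, n)) (t (Suc i)) \<cdot> ArrMap (LO n F) (i, Suc i) =
        ArrMap (LO n G) (i, Suc i) \<cdot> kmap (ArrMap F (i, n)) (ArrMap G (i, n)) (t i)"
      using kmap_Cmp[OF chain_hom[OF F i'(1) le_refl] chain_hom[OF F i'(2) le_refl]
          chain_hom[OF G i'(2) le_refl] chain_hom[OF F i'(3,2)] nat_trans_component[OF t i'(2)]
          chain_Idt_hom[OF F] nat_trans_component[OF t le_refl] chain_square[OF F i'(3,2)]
          nat_square[OF i'(2)]]
        kmap_Cmp[OF chain_hom[OF F i'(1) le_refl] chain_hom[OF G i'(1) le_refl]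
          chain_hom[OF G i'(2) le_refl] nat_trans_component[OF t i'(1)] chain_hom[OF G i'(3,2)]
          nat_trans_component[OF t le_refl] chain_Idt_hom[OF G] nat_square[OF i'(1)]
          chain_square[OF G i'(3,2)]]
        nat_trans_naturality[OF t i'(3,2)] i' by simp
  qed
qed

lemma iota_natural:
  "\<iota> n G \<cdot>\<^bsub>fun_cat (ord_cat n) C\<^esub> ArrMap (L n) (F, G, t) = (F, G, t) \<cdot>\<^bsub>fun_cat (ord_cat n) C\<^esub> \<iota> n F"
  using t nat_kappa_kmap by (auto simp: \<iota>_def vcomp_def fun_eq_iff restrict_def)

lemma L_Arr_eq:
  assumes "ObjMap F n = z" "ObjMap G n = z"
  shows "ArrMap (L n) (F, G, t) = (F, G, t)"
proof -
  have F: "is_functor (ord_cat n) C F" and G: "is_functor (ord_cat n) C G"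
    using nat_trans_functors[OF t] by auto
  have "(\<lambda>i\<in>{..n}. kmap (ArrMap F (i, n)) (ArrMap G (i, n)) (t i)) = t"
  proof (rule nat_trans_eqI[OF L_nat_trans t])
    fix i assume i: "i \<le> n"
    show "(\<lambda>i\<in>{..n}. kmap (ArrMap F (i, n)) (ArrMap G (i, n)) (t i)) i = t i"
      using kmap_to_zero[OF _ _ nat_trans_component[OF t i]] chain_hom[OF F i le_refl]
        chain_hom[OF G i le_refl] i assms by simp
  qed
  then show ?thesis using t LO_eq[OF F] LO_eq[OF G] assms by simp
qed

end

lemma L_functor: "is_functor (fun_cat (ord_cat n) C) (fun_cat (ord_cat n) C) (L n)"
proof -
  interpret N: category "fun_cat (ord_cat n) C" by (rule category_fun_cat[OF category_axioms])
  show ?thesis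
  proof
    show "ObjMap (L n) \<in> Obj (fun_cat (ord_cat n) C) \<rightarrow>\<^sub>E Obj (fun_cat (ord_cat n) C)"
      using LO_functor by (auto simp: L_def)
    show "ArrMap (L n) \<in> extensional (Arr (fun_cat (ord_cat n) C))" by (simp add: L_def)
  next
    fix f F G assume "f \<in> hom (fun_cat (ord_cat n) C) F G"
    then show "ArrMap (L n) f \<in> hom (fun_cat (ord_cat n) C) (ObjMap (L n) F) (ObjMap (L n) G)"
      unfolding fun_cat_hom using nat_trans_functors L_nat_trans by fastforce
  next
    fix F assume "F \<in> Obj (fun_cat (ord_cat n) C)"
    then have F: "is_functor (ord_cat n) C F" by simp
    have "kmap (ArrMap F (i, n)) (ArrMap F (i, n)) (Idt C (ObjMap F i)) = Idt C (ker (ArrMap F (i, n)))"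
      if "i \<le> n" for i
      using kmap_Idt[OF chain_hom[OF F that le_refl]] .
    then show "ArrMap (L n) (Idt (fun_cat (ord_cat n) C) F) = Idt (fun_cat (ord_cat n) C) (ObjMap (L n) F)"
      using F is_nat_trans_id[OF F] by (auto simp: id_nat_def fun_eq_iff restrict_def)
  next
    fix f g F G H assume "f \<in> hom (fun_cat (ord_cat n) C) F G" "g \<in> hom (fun_cat (ord_cat n) C) G H"
    then obtain t s where e: "f = (F, G, t)" "g = (G, H, s)"
      and t: "is_nat_trans (ord_cat n) C F G t" and s: "is_nat_trans (ord_cat n) C G H s"
      unfolding fun_cat_hom by auto
    have FGH: "is_functor (ord_cat n) C F" "is_functor (ord_cat n) C G" "is_functor (ord_cat n) C H"
      using nat_trans_functors t s by auto
    have "kmap (ArrMap F (i, n)) (ArrMap H (i, n)) (s i \<cdot> t i) =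
        kmap (ArrMap G (i, n)) (ArrMap H (i, n)) (s i) \<cdot> kmap (ArrMap F (i, n)) (ArrMap G (i, n)) (t i)"
      if i: "i \<le> n" for i
      using kmap_Cmp[OF FGH[THEN chain_hom, OF i le_refl] nat_trans_component[OF t i]
          nat_trans_component[OF s i] nat_trans_component[OF t le_refl]
          nat_trans_component[OF s le_refl] nat_square[OF t i] nat_square[OF s i]] by simp
    then show "ArrMap (L n) (g \<cdot>\<^bsub>fun_cat (ord_cat n) C\<^esub> f) =
        ArrMap (L n) g \<cdot>\<^bsub>fun_cat (ord_cat n) C\<^esub> ArrMap (L n) f"
      using t s is_nat_trans_vcomp[OF t s]
      by (auto simp: e vcomp_def fun_eq_iff restrict_def)
  qed
qed

section \<open>Reindexing along maps that preserve the last vertex\<close>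

context
  fixes m n :: nat and \<phi> :: "nat \<Rightarrow> nat"
  assumes mono: "\<And>i j. i \<le> j \<Longrightarrow> j \<le> m \<Longrightarrow> \<phi> i \<le> \<phi> j" and top: "\<phi> m = n"
begin

lemma phi_le: "i \<le> m \<Longrightarrow> \<phi> i \<le> n"
  using mono[of i m] top by simp

lemma mono_functor: "is_functor (ord_cat m) (ord_cat n) (mono_ftor m \<phi>)"
  using is_functor_mono_ftor[OF mono phi_le] .

text \<open>\<open>LO\<close> looks only at arrows into the last vertex, and
  \<open>\<phi> m = n\<close> makes those of the reindexed chain arrows into the last vertex of
  \<open>F\<close>.\<close>

lemma LO_precomp:
  assumes F: "is_functor (ord_cat n) C F"
  shows "LO m (F \<odot>\<^bsub>ord_cat m\<^esub> mono_ftor m \<phi>) = LO n F \<odot>\<^bsub>ord_cat m\<^esub> mono_ftor m \<phi>"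
proof (rule chain_eqI)
  note Fm = is_functor_comp[OF mono_functor F]
  show "is_functor (ord_cat m) C (LO m (F \<odot>\<^bsub>ord_cat m\<^esub> mono_ftor m \<phi>))" using LO_functor[OF Fm] .
  show "is_functor (ord_cat m) C (LO n F \<odot>\<^bsub>ord_cat m\<^esub> mono_ftor m \<phi>)"
    using is_functor_comp[OF mono_functor LO_functor[OF F]] .
qed (use phi_le mono top in simp_all)

lemma L_precomp:
  shows "F \<in> Obj (fun_cat (ord_cat n) C) \<Longrightarrow>
      ObjMap (L m) (ObjMap (precomp (ord_cat m) (ord_cat n) C (mono_ftor m \<phi>)) F) =
      ObjMap (precomp (ord_cat m) (ord_cat n) C (mono_ftor m \<phi>)) (ObjMap (L n) F)"
    and "f \<in> Arr (fun_cat (ord_cat n) C) \<Longrightarrow>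
      ArrMap (L m) (ArrMap (precomp (ord_cat m) (ord_cat n) C (mono_ftor m \<phi>)) f) =
      ArrMap (precomp (ord_cat m) (ord_cat n) C (mono_ftor m \<phi>)) (ArrMap (L n) f)"
proof -
  show "F \<in> Obj (fun_cat (ord_cat n) C) \<Longrightarrow>
      ObjMap (L m) (ObjMap (precomp (ord_cat m) (ord_cat n) C (mono_ftor m \<phi>)) F) =
      ObjMap (precomp (ord_cat m) (ord_cat n) C (mono_ftor m \<phi>)) (ObjMap (L n) F)"
    using is_functor_comp[OF mono_functor, of C F] LO_functor[of n F] by (simp add: LO_precomp)
  assume "f \<in> Arr (fun_cat (ord_cat n) C)"
  then obtain F G t where f: "f = (F, G, t)" and t: "is_nat_trans (ord_cat n) C F G t"
    by (auto simp: fun_cat_def)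
  have FG: "is_functor (ord_cat n) C F" "is_functor (ord_cat n) C G"
    using nat_trans_functors[OF t] by auto
  show "ArrMap (L m) (ArrMap (precomp (ord_cat m) (ord_cat n) C (mono_ftor m \<phi>)) f) =
      ArrMap (precomp (ord_cat m) (ord_cat n) C (mono_ftor m \<phi>)) (ArrMap (L n) f)"
    unfolding f using t L_nat_trans[OF t] is_nat_trans_whisker_right[OF mono_functor t] FG phi_le mono top
    by (auto simp: LO_precomp whisker_right_def fun_eq_iff restrict_def)
qed

lemma iota_precomp:
  assumes "F \<in> Obj (fun_cat (ord_cat n) C)"
  shows "ArrMap (precomp (ord_cat m) (ord_cat n) C (mono_ftor m \<phi>)) (\<iota> n F) =
    \<iota> m (ObjMap (precomp (ord_cat m) (ord_cat n) C (mono_ftor m \<phi>)) F)"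
proof -
  have F: "is_functor (ord_cat n) C F" using assms by simp
  show ?thesis
    using F iota_nat[OF F] phi_le mono top
    by (auto simp: \<iota>_def LO_precomp whisker_right_def fun_eq_iff restrict_def)
qed

end

end

section \<open>Full subcategories\<close>

definition full_sub :: "('o, 'a) cat \<Rightarrow> 'o set \<Rightarrow> ('o, 'a) cat" where
  "full_sub A P = A\<lparr>Obj := Obj A \<inter> P, Arr := {f \<in> Arr A. Dom A f \<in> P \<and> Cod A f \<in> P}\<rparr>"

text \<open>Cutting the maps back outside \<open>A\<close> keeps functors extensional, so that two
  restrictions are equal as soon as their values on \<open>A\<close> agree.\<close>

definition res_ftor :: "('o, 'a) cat \<Rightarrow> ('o, 'a, 'p, 'b) ftor \<Rightarrow> ('o, 'a, 'p, 'b) ftor" where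
  "res_ftor A F = \<lparr>ObjMap = restrict (ObjMap F) (Obj A), ArrMap = restrict (ArrMap F) (Arr A)\<rparr>"

lemma full_sub_simps [simp]:
  "Obj (full_sub A P) = Obj A \<inter> P"
  "f \<in> Arr (full_sub A P) \<longleftrightarrow> f \<in> Arr A \<and> Dom A f \<in> P \<and> Cod A f \<in> P"
  "Dom (full_sub A P) = Dom A" "Cod (full_sub A P) = Cod A"
  "Idt (full_sub A P) = Idt A" "Cmp (full_sub A P) = Cmp A"
  by (auto simp: full_sub_def)

lemma hom_full_sub: "f \<in> hom (full_sub A P) a b \<longleftrightarrow> f \<in> hom A a b \<and> a \<in> P \<and> b \<in> P"
  by (auto simp: hom_def)

lemma category_full_sub:
  assumes "category A"
  shows "category (full_sub A P)"
proof -
  interpret category A by fact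
  show ?thesis
    by unfold_locales
      (auto simp: hom_full_sub Dom_Obj Cod_Obj Idt_hom Cmp_hom Cmp_Idt Idt_Cmp intro: Cmp_assoc)
qed

lemma res_ftor_simps [simp]:
  "x \<in> Obj A \<Longrightarrow> ObjMap (res_ftor A F) x = ObjMap F x"
  "f \<in> Arr A \<Longrightarrow> ArrMap (res_ftor A F) f = ArrMap F f"
  by (auto simp: res_ftor_def)

lemma res_ftor_cong:
  assumes "\<And>x. x \<in> Obj A \<Longrightarrow> ObjMap F x = ObjMap G x" "\<And>f. f \<in> Arr A \<Longrightarrow> ArrMap F f = ArrMap G f"
  shows "res_ftor A F = res_ftor A G"
  using assms by (auto simp: res_ftor_def fun_eq_iff restrict_def)

lemma comp_ftor_cong:
  assumes "\<And>x. x \<in> Obj A \<Longrightarrow> ObjMap G (ObjMap F x) = ObjMap G' (ObjMap F' x)"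
    and "\<And>f. f \<in> Arr A \<Longrightarrow> ArrMap G (ArrMap F f) = ArrMap G' (ArrMap F' f)"
  shows "G \<odot>\<^bsub>A\<^esub> F = G' \<odot>\<^bsub>A\<^esub> F'"
  using assms by (auto simp: comp_ftor_def fun_eq_iff restrict_def)

text \<open>Arrows of a full subcategory are constrained only by their ends, so a condition on
  objects suffices.\<close>

lemma is_functor_res:
  assumes F: "is_functor A B F" and Q: "\<And>x. x \<in> Obj A \<Longrightarrow> x \<in> P \<Longrightarrow> ObjMap F x \<in> Q"
  shows "is_functor (full_sub A P) (full_sub B Q) (res_ftor (full_sub A P) F)"
proof -
  interpret F: is_functor A B F by fact
  interpret A': category "full_sub A P" by (rule category_full_sub[OF F.A.category_axioms])
  interpret B': category "full_sub B Q" by (rule category_full_sub[OF F.B.category_axioms])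
  have o: "a \<in> Obj A \<and> b \<in> Obj A \<and> f \<in> Arr A \<and> Dom A f = a \<and> Cod A f = b" if "f \<in> hom A a b" for f a b
    using F.A.in_hom_Obj[OF that] F.A.hom_D[OF that] by simp
  show ?thesis
  proof
    show "ObjMap (res_ftor (full_sub A P) F) \<in> Obj (full_sub A P) \<rightarrow>\<^sub>E Obj (full_sub B Q)"
      using is_functor_Obj[OF F] Q by (auto simp: res_ftor_def)
    show "ArrMap (res_ftor (full_sub A P) F) \<in> extensional (Arr (full_sub A P))"
      by (simp add: res_ftor_def)
  next
    fix f a b assume "f \<in> hom (full_sub A P) a b"
    then show "ArrMap (res_ftor (full_sub A P) F) f \<in> hom (full_sub B Q)
        (ObjMap (res_ftor (full_sub A P) F) a) (ObjMap (res_ftor (full_sub A P) F) b)"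
      using F.ArrMap_hom[of f a b] o[of f a b] Q by (simp add: hom_full_sub)
  next
    fix a assume "a \<in> Obj (full_sub A P)"
    then show "ArrMap (res_ftor (full_sub A P) F) (Idt (full_sub A P) a) =
        Idt (full_sub B Q) (ObjMap (res_ftor (full_sub A P) F) a)"
      using F.ArrMap_Idt[of a] o[OF F.A.Idt_hom[of a]] by simp
  next
    fix f g a b c assume "f \<in> hom (full_sub A P) a b" "g \<in> hom (full_sub A P) b c"
    then show "ArrMap (res_ftor (full_sub A P) F) (g \<cdot>\<^bsub>full_sub A P\<^esub> f) =
        ArrMap (res_ftor (full_sub A P) F) g \<cdot>\<^bsub>full_sub B Q\<^esub> ArrMap (res_ftor (full_sub A P) F) f"
      using F.ArrMap_Cmp[of f a b g c] o[of f a b] o[of g b c] o[OF F.A.Cmp_hom[of f a b g c]]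
      by (simp add: hom_full_sub)
  qed
qed

text \<open>It reduces an identity between restricted operators to one between functors on the
  ambient category, which has to be tested on the subcategory only.\<close>

lemma comp_res_ftor:
  assumes F: "is_functor A B F" and Q: "\<And>x. x \<in> Obj A \<Longrightarrow> x \<in> P \<Longrightarrow> ObjMap F x \<in> Q"
  shows "res_ftor (full_sub B Q) G \<odot>\<^bsub>full_sub A P\<^esub> res_ftor (full_sub A P) F =
    res_ftor (full_sub A P) (G \<odot>\<^bsub>A\<^esub> F)"
  unfolding comp_ftor_def[of _ "full_sub A P"] res_ftor_def[of "full_sub A P" "G \<odot>\<^bsub>A\<^esub> F"]
  using is_functor_Obj[OF is_functor_res[where P = P and Q = Q, OF F Q]]
    is_functor_Arr[OF is_functor_res[where P = P and Q = Q, OF F Q]]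
  by (simp add: fun_eq_iff restrict_def)

lemma res_id_ftor: "res_ftor (full_sub A P) (id_ftor A) = id_ftor (full_sub A P)"
  by (auto simp: res_ftor_def id_ftor_def fun_eq_iff restrict_def)

text \<open>The inverse maps respect source and target by injectivity of \<open>Q\<close> on
  objects; the remaining laws follow from injectivity on arrows.\<close>

lemma inverse_functor:
  assumes Q: "is_functor A B Q"
    and bo: "bij_betw (ObjMap Q) (Obj A) (Obj B)" and ba: "bij_betw (ArrMap Q) (Arr A) (Arr B)"
  shows "\<exists>G. is_functor B A G \<and> Q \<odot>\<^bsub>B\<^esub> G = id_ftor B \<and> G \<odot>\<^bsub>A\<^esub> Q = id_ftor A"
proof -
  interpret Q: is_functor A B Q by fact
  define GO where "GO = the_inv_into (Obj A) (ObjMap Q)"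
  define GA where "GA = the_inv_into (Arr A) (ArrMap Q)"
  have io: "inj_on (ObjMap Q) (Obj A)" and ia: "inj_on (ArrMap Q) (Arr A)"
    using bo ba by (auto simp: bij_betw_def)
  have GO: "GO x \<in> Obj A" "ObjMap Q (GO x) = x" if "x \<in> Obj B" for x
    using that bo the_inv_into_into[OF io, of x "Obj A"] f_the_inv_into_f[OF io, of x]
    by (auto simp: GO_def bij_betw_def)
  have GA: "GA f \<in> Arr A" "ArrMap Q (GA f) = f" if "f \<in> Arr B" for f
    using that ba the_inv_into_into[OF ia, of f "Arr A"] f_the_inv_into_f[OF ia, of f]
    by (auto simp: GA_def bij_betw_def)
  have GOQ: "GO (ObjMap Q x) = x" if "x \<in> Obj A" for x
    using the_inv_into_f_f[OF io that] by (simp add: GO_def)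
  have GAQ: "GA (ArrMap Q f) = f" if "f \<in> Arr A" for f
    using the_inv_into_f_f[OF ia that] by (simp add: GA_def)
  define G where "G = \<lparr>ObjMap = \<lambda>x\<in>Obj B. GO x, ArrMap = \<lambda>f\<in>Arr B. GA f\<rparr>"
  have G: "\<And>x. x \<in> Obj B \<Longrightarrow> ObjMap G x = GO x" "\<And>f. f \<in> Arr B \<Longrightarrow> ArrMap G f = GA f"
    by (simp_all add: G_def)
  have hom: "GA f \<in> hom A (GO a) (GO b)" if f: "f \<in> hom B a b" for f a b
  proof -
    note fD = Q.B.hom_D[OF f] Q.B.in_hom_Obj[OF f]
    have g: "GA f \<in> hom A (Dom A (GA f)) (Cod A (GA f))" using GA(1) fD Q.A.Arr_hom by blast
    have "ObjMap Q (Dom A (GA f)) = a" "ObjMap Q (Cod A (GA f)) = b"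
      using Q.B.hom_D[OF Q.ArrMap_hom[OF g]] GA(2) fD by auto
    then show ?thesis using g GOQ Q.A.in_hom_Obj[OF g] by metis
  qed
  have "is_functor B A G"
  proof
    show "ObjMap G \<in> Obj B \<rightarrow>\<^sub>E Obj A" using GO by (auto simp: G_def)
    show "ArrMap G \<in> extensional (Arr B)" by (simp add: G_def)
    show "ArrMap G f \<in> hom A (ObjMap G a) (ObjMap G b)" if "f \<in> hom B a b" for f a b
      using hom[OF that] Q.B.hom_D[OF that] Q.B.in_hom_Obj[OF that] G by simp
    show "ArrMap G (Idt B a) = Idt A (ObjMap G a)" if a: "a \<in> Obj B" for a
      using Q.ArrMap_Idt[OF GO(1)[OF a]] GAQ[of "Idt A (GO a)"] GO[OF a] G
        Q.A.hom_D[OF Q.A.Idt_hom[OF GO(1)[OF a]]] Q.B.hom_D[OF Q.B.Idt_hom[OF a]] a by simp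
    show "ArrMap G (g \<cdot>\<^bsub>B\<^esub> f) = ArrMap G g \<cdot>\<^bsub>A\<^esub> ArrMap G f"
      if f: "f \<in> hom B a b" and g: "g \<in> hom B b c" for f g a b c
    proof -
      have "ArrMap Q (GA g \<cdot>\<^bsub>A\<^esub> GA f) = g \<cdot>\<^bsub>B\<^esub> f"
        using Q.ArrMap_Cmp[OF hom[OF f] hom[OF g]] GA(2) Q.B.hom_D f g by metis
      then have "GA (g \<cdot>\<^bsub>B\<^esub> f) = GA g \<cdot>\<^bsub>A\<^esub> GA f"
        using GAQ[of "GA g \<cdot>\<^bsub>A\<^esub> GA f"] Q.A.hom_D[OF Q.A.Cmp_hom[OF hom[OF f] hom[OF g]]] by simp
      then show ?thesis
        using Q.B.hom_D[OF f] Q.B.hom_D[OF g] Q.B.hom_D[OF Q.B.Cmp_hom[OF f g]] G by simp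
    qed
  qed
  moreover have "Q \<odot>\<^bsub>B\<^esub> G = id_ftor B"
    using GO GA G by (simp add: comp_ftor_def id_ftor_def fun_eq_iff restrict_def)
  moreover have "G \<odot>\<^bsub>A\<^esub> Q = id_ftor A"
    using GOQ GAQ is_functor_Obj[OF Q] is_functor_Arr[OF Q] G
    by (simp add: comp_ftor_def id_ftor_def fun_eq_iff restrict_def)
  ultimately show ?thesis by blast
qed

section \<open>The supercoherent structure given by kernels\<close>

context kernels
begin

section \<open>Operators of the nerve and their interplay with \<open>L\<close> and \<iota>\<close>

definition N where "N n = fun_cat (ord_cat n) C"

abbreviation d where "d \<equiv> face (nerve C)"
abbreviation s where "s \<equiv> degen (nerve C)"

lemma category_N: "category (N n)"
  unfolding N_def by (rule category_fun_cat[OF category_axioms])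

lemma Lev_N: "Lev (nerve C) n = N n"
  by (simp add: N_def)

interpretation NS: simplicial_object "nerve C"
  by (rule simplicial_object_nerve[OF category_axioms])

lemma d_functor: "i \<le> Suc n \<Longrightarrow> is_functor (N (Suc n)) (N n) (d (Suc n) i)"
  using NS.face_functor[of "Suc n" i] by (simp add: N_def)

lemma s_functor: "j \<le> n \<Longrightarrow> is_functor (N n) (N (Suc n)) (s n j)"
  using NS.degen_functor[of j n] by (simp add: N_def)

lemma LN_functor: "is_functor (N n) (N n) (L n)"
  unfolding N_def by (rule L_functor)

lemma d_d:
  assumes "i < j" "j \<le> Suc (Suc n)"
  shows "x \<in> Obj (N (Suc (Suc n))) \<Longrightarrow>
      ObjMap (d (Suc n) i) (ObjMap (d (Suc (Suc n)) j) x) =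
      ObjMap (d (Suc n) (j - 1)) (ObjMap (d (Suc (Suc n)) i) x)"
    and "f \<in> Arr (N (Suc (Suc n))) \<Longrightarrow>
      ArrMap (d (Suc n) i) (ArrMap (d (Suc (Suc n)) j) f) =
      ArrMap (d (Suc n) (j - 1)) (ArrMap (d (Suc (Suc n)) i) f)"
  using comp_ftor_eqD[OF NS.face_face[of "Suc (Suc n)" i j]] assms by (simp_all add: N_def)

lemma d_s_id:
  assumes "j \<le> n" "i = j \<or> i = Suc j"
  shows "x \<in> Obj (N n) \<Longrightarrow> ObjMap (d (Suc n) i) (ObjMap (s n j) x) = x"
    and "f \<in> Arr (N n) \<Longrightarrow> ArrMap (d (Suc n) i) (ArrMap (s n j) f) = f"
  using comp_ftor_idD[OF NS.face_degen_id[of j n i]] assms by (simp_all add: N_def)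

lemma d_s_greater:
  assumes "Suc j < i" "i \<le> Suc (Suc n)"
  shows "x \<in> Obj (N (Suc n)) \<Longrightarrow>
      ObjMap (d (Suc (Suc n)) i) (ObjMap (s (Suc n) j) x) =
      ObjMap (s n j) (ObjMap (d (Suc n) (i - 1)) x)"
    and "f \<in> Arr (N (Suc n)) \<Longrightarrow>
      ArrMap (d (Suc (Suc n)) i) (ArrMap (s (Suc n) j) f) =
      ArrMap (s n j) (ArrMap (d (Suc n) (i - 1)) f)"
  using comp_ftor_eqD[OF NS.face_degen_greater[of j i "Suc n"]] assms by (simp_all add: N_def)

text \<open>The bound on \<open>i\<close> leaves out exactly the last face, the one operator that
  moves the last vertex; all degeneracies qualify in \<open>L_s\<close>.\<close>

lemma L_d:
  assumes "i \<le> n"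
  shows "x \<in> Obj (N (Suc n)) \<Longrightarrow>
      ObjMap (L n) (ObjMap (d (Suc n) i) x) = ObjMap (d (Suc n) i) (ObjMap (L (Suc n)) x)"
    and "f \<in> Arr (N (Suc n)) \<Longrightarrow>
      ArrMap (L n) (ArrMap (d (Suc n) i) f) = ArrMap (d (Suc n) i) (ArrMap (L (Suc n)) f)"
    and iota_d: "x \<in> Obj (N (Suc n)) \<Longrightarrow>
      ArrMap (d (Suc n) i) (\<iota> (Suc n) x) = \<iota> n (ObjMap (d (Suc n) i) x)"
proof -
  have m: "\<And>k l. k \<le> l \<Longrightarrow> l \<le> n \<Longrightarrow> coface i k \<le> coface i l" and t: "coface i n = Suc n"
    using assms by (auto simp: coface_def)
  show "x \<in> Obj (N (Suc n)) \<Longrightarrow>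
      ObjMap (L n) (ObjMap (d (Suc n) i) x) = ObjMap (d (Suc n) i) (ObjMap (L (Suc n)) x)"
    "f \<in> Arr (N (Suc n)) \<Longrightarrow>
      ArrMap (L n) (ArrMap (d (Suc n) i) f) = ArrMap (d (Suc n) i) (ArrMap (L (Suc n)) f)"
    "x \<in> Obj (N (Suc n)) \<Longrightarrow>
      ArrMap (d (Suc n) i) (\<iota> (Suc n) x) = \<iota> n (ObjMap (d (Suc n) i) x)"
    using L_precomp[where m = n and \<phi> = "coface i", OF m t]
      iota_precomp[where m = n and \<phi> = "coface i", OF m t] unfolding N_def face_nerve diff_Suc_1 by auto
qed

lemma L_s:
  assumes "j \<le> n"
  shows "x \<in> Obj (N n) \<Longrightarrow>
      ObjMap (L (Suc n)) (ObjMap (s n j) x) = ObjMap (s n j) (ObjMap (L n) x)"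
    and "f \<in> Arr (N n) \<Longrightarrow>
      ArrMap (L (Suc n)) (ArrMap (s n j) f) = ArrMap (s n j) (ArrMap (L n) f)"
    and iota_s: "x \<in> Obj (N n) \<Longrightarrow> ArrMap (s n j) (\<iota> n x) = \<iota> (Suc n) (ObjMap (s n j) x)"
proof -
  have m: "\<And>k l. k \<le> l \<Longrightarrow> l \<le> Suc n \<Longrightarrow> codegen j k \<le> codegen j l" and t: "codegen j (Suc n) = n"
    using assms by (auto simp: codegen_def)
  show "x \<in> Obj (N n) \<Longrightarrow>
      ObjMap (L (Suc n)) (ObjMap (s n j) x) = ObjMap (s n j) (ObjMap (L n) x)"
    "f \<in> Arr (N n) \<Longrightarrow>
      ArrMap (L (Suc n)) (ArrMap (s n j) f) = ArrMap (s n j) (ArrMap (L n) f)"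
    "x \<in> Obj (N n) \<Longrightarrow> ArrMap (s n j) (\<iota> n x) = \<iota> (Suc n) (ObjMap (s n j) x)"
    using L_precomp[where m = "Suc n" and \<phi> = "codegen j", OF m t]
      iota_precomp[where m = "Suc n" and \<phi> = "codegen j", OF m t] unfolding N_def degen_nerve Suc_eq_plus1[symmetric] by auto
qed

section \<open>Chains ending in zero and the structure on them\<close>

definition Z where "Z n = {F :: ('o, 'a) nerve_obj. ObjMap F n = z}"

lemma L_eq:
  "x \<in> Obj (N n) \<Longrightarrow> x \<in> Z n \<Longrightarrow> ObjMap (L n) x = x"
  "f \<in> Arr (N n) \<Longrightarrow> Dom (N n) f \<in> Z n \<Longrightarrow> Cod (N n) f \<in> Z n \<Longrightarrow> ArrMap (L n) f = f"
proof -
  show "x \<in> Obj (N n) \<Longrightarrow> x \<in> Z n \<Longrightarrow> ObjMap (L n) x = x"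
    by (simp add: N_def Z_def LO_eq)
  show "f \<in> Arr (N n) \<Longrightarrow> Dom (N n) f \<in> Z n \<Longrightarrow> Cod (N n) f \<in> Z n \<Longrightarrow> ArrMap (L n) f = f"
    using L_Arr_eq by (cases f) (auto simp: N_def Z_def simp del: L_Arr)
qed

lemma iotaN_hom: "x \<in> Obj (N n) \<Longrightarrow> \<iota> n x \<in> hom (N n) (ObjMap (L n) x) x"
  using iota_hom[of n x] by (simp add: N_def)

lemma iotaN_eq: "x \<in> Obj (N n) \<Longrightarrow> x \<in> Z n \<Longrightarrow> \<iota> n x = Idt (N n) x"
  using iota_eq[of n x] by (simp add: N_def Z_def)

lemma LN_iota: "x \<in> Obj (N n) \<Longrightarrow> ArrMap (L n) (\<iota> n x) = Idt (N n) (ObjMap (L n) x)"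
  using L_iota[of n x] by (simp add: N_def)

lemma iotaN_natural:
  "f \<in> hom (N n) x y \<Longrightarrow> \<iota> n y \<cdot>\<^bsub>N n\<^esub> ArrMap (L n) f = f \<cdot>\<^bsub>N n\<^esub> \<iota> n x"
  using iota_natural unfolding N_def fun_cat_hom by blast

lemma L_Z: "x \<in> Obj (N n) \<Longrightarrow> ObjMap (L n) x \<in> Z n"
  using LO_top[of n x] by (simp add: N_def Z_def del: LO_simps)

lemma d_Z: "x \<in> Obj (N (Suc n)) \<Longrightarrow> x \<in> Z (Suc n) \<Longrightarrow> i \<le> n \<Longrightarrow> ObjMap (d (Suc n) i) x \<in> Z n"
  by (simp add: N_def Z_def coface_def)

lemma s_Z: "x \<in> Obj (N n) \<Longrightarrow> x \<in> Z n \<Longrightarrow> j \<le> n \<Longrightarrow> ObjMap (s n j) x \<in> Z (Suc n)"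
  by (simp add: N_def Z_def codegen_def)

text \<open>Taking chains that end in \<open>z\<close> instead of a shifted nerve makes level
  \<open>0\<close> terminal without a special case. Every degeneracy is then that of the nerve: the
  top one repeats the final \<open>z\<close>.\<close>

definition XL where "XL n = full_sub (N n) (Z n)"

text \<open>The top face drops the last vertex, and \<open>L\<close> makes the new last vertex
  \<open>z\<close> again.\<close>

definition DD where "DD n i = (if i < n then d n i else L (n - 1) \<odot>\<^bsub>N n\<^esub> d n n)"

definition XF where "XF n i = res_ftor (XL n) (DD n i)"

definition XD where "XD n j = res_ftor (XL n) (s n j)"

text \<open>It makes sense for every chain and is indexed by the level of its value. In
  \<open>kerX\<close> it is evaluated at the chain without its final zero, which accounts for the
  shift by \<open>2\<close> there.\<close>

definition \<alpha> where
  "\<alpha> n x = ArrMap (L n) (ArrMap (d (Suc n) (Suc n)) (\<iota> (Suc n) x))"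

definition kerX :: "(('o, 'a) nerve_obj, ('o, 'a) nerve_arr) supercoh_data" where
  "kerX = \<lparr>Lev = XL, face = XF, degen = XD,
    alpha = \<lambda>n. \<lambda>x\<in>Obj (XL n). \<alpha> (n - 2) (ObjMap (d n n) x)\<rparr>"

lemma kerX_simps [simp]:
  "Lev kerX n = XL n" "face kerX n i = XF n i" "degen kerX n j = XD n j"
  "alpha kerX n = (\<lambda>x\<in>Obj (XL n). \<alpha> (n - 2) (ObjMap (d n n) x))"
  by (simp_all add: kerX_def)

lemma XL_simps [simp]:
  "x \<in> Obj (XL n) \<longleftrightarrow> x \<in> Obj (N n) \<and> x \<in> Z n"
  "f \<in> Arr (XL n) \<longleftrightarrow> f \<in> Arr (N n) \<and> Dom (N n) f \<in> Z n \<and> Cod (N n) f \<in> Z n"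
  "Dom (XL n) = Dom (N n)" "Cod (XL n) = Cod (N n)"
  "Idt (XL n) = Idt (N n)" "Cmp (XL n) = Cmp (N n)"
  by (auto simp: XL_def)

lemma hom_XL: "f \<in> hom (XL n) x y \<longleftrightarrow> f \<in> hom (N n) x y \<and> x \<in> Z n \<and> y \<in> Z n"
  by (simp add: XL_def hom_full_sub)

lemma DD_functor: "i \<le> Suc n \<Longrightarrow> is_functor (N (Suc n)) (N n) (DD (Suc n) i)"
  using d_functor[of i n] is_functor_comp[OF d_functor LN_functor, of "Suc n" n] by (simp add: DD_def)

lemma DD_Z:
  "x \<in> Obj (N (Suc n)) \<Longrightarrow> x \<in> Z (Suc n) \<Longrightarrow> i \<le> Suc n \<Longrightarrow> ObjMap (DD (Suc n) i) x \<in> Z n"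
  using d_Z L_Z is_functor_Obj[OF d_functor, of "Suc n" n x] by (simp add: DD_def)

lemma DD_apply:
  "x \<in> Obj (N (Suc n)) \<Longrightarrow> ObjMap (DD (Suc n) i) x =
    (if i < Suc n then ObjMap (d (Suc n) i) x else ObjMap (L n) (ObjMap (d (Suc n) (Suc n)) x))"
  "f \<in> Arr (N (Suc n)) \<Longrightarrow> ArrMap (DD (Suc n) i) f =
    (if i < Suc n then ArrMap (d (Suc n) i) f else ArrMap (L n) (ArrMap (d (Suc n) (Suc n)) f))"
  by (simp_all add: DD_def)

lemma XF_functor: "i \<le> Suc n \<Longrightarrow> is_functor (XL (Suc n)) (XL n) (XF (Suc n) i)"
  unfolding XF_def XL_def by (rule is_functor_res[OF DD_functor DD_Z])

lemma XD_functor: "j \<le> n \<Longrightarrow> is_functor (XL n) (XL (Suc n)) (XD n j)"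
  unfolding XD_def XL_def by (rule is_functor_res[OF s_functor s_Z])

lemma XF_XF: "j \<le> Suc (Suc n) \<Longrightarrow> XF (Suc n) i \<odot>\<^bsub>XL (Suc (Suc n))\<^esub> XF (Suc (Suc n)) j =
    res_ftor (XL (Suc (Suc n))) (DD (Suc n) i \<odot>\<^bsub>N (Suc (Suc n))\<^esub> DD (Suc (Suc n)) j)"
  unfolding XF_def XL_def by (rule comp_res_ftor[OF DD_functor DD_Z])

lemma XF_XD: "j \<le> n \<Longrightarrow> XF (Suc n) i \<odot>\<^bsub>XL n\<^esub> XD n j =
    res_ftor (XL n) (DD (Suc n) i \<odot>\<^bsub>N n\<^esub> s n j)"
  unfolding XF_def XD_def XL_def by (rule comp_res_ftor[OF s_functor s_Z])

lemma XD_XF: "i \<le> Suc n \<Longrightarrow> XD n j \<odot>\<^bsub>XL (Suc n)\<^esub> XF (Suc n) i =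
    res_ftor (XL (Suc n)) (s n j \<odot>\<^bsub>N (Suc n)\<^esub> DD (Suc n) i)"
  unfolding XF_def XD_def XL_def by (rule comp_res_ftor[OF DD_functor DD_Z])

lemma XD_XD: "j \<le> n \<Longrightarrow> XD (Suc n) i \<odot>\<^bsub>XL n\<^esub> XD n j =
    res_ftor (XL n) (s (Suc n) i \<odot>\<^bsub>N n\<^esub> s n j)"
  unfolding XD_def XL_def by (rule comp_res_ftor[OF s_functor s_Z])

lemmas N_mem = d_functor[THEN is_functor_Obj] d_functor[THEN is_functor_Arr]
  s_functor[THEN is_functor_Obj] s_functor[THEN is_functor_Arr]
  is_functor_Obj[OF LN_functor] is_functor_Arr[OF LN_functor]

lemma iota_Arr: "x \<in> Obj (N n) \<Longrightarrow> \<iota> n x \<in> Arr (N n)"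
  using iotaN_hom[of x n] by (simp add: hom_def)

section \<open>The identities of \<alpha> behind the coherence conditions\<close>

lemma alpha_hom:
  assumes x: "x \<in> Obj (N (Suc n))"
  shows "\<alpha> n x \<in> hom (N n) (ObjMap (L n) (ObjMap (d (Suc n) (Suc n)) (ObjMap (L (Suc n)) x)))
    (ObjMap (L n) (ObjMap (d (Suc n) (Suc n)) x))"
  unfolding \<alpha>_def
  by (rule is_functor.ArrMap_hom[OF LN_functor is_functor.ArrMap_hom[OF d_functor iotaN_hom[OF x]]]) simp

text \<open>\<open>L\<close> and \<iota> commute with \<open>d_i\<close> because it preserves the
  last vertex, and the last face does so by a simplicial identity. This becomes (C1).\<close>

lemma alpha_d:
  assumes x: "x \<in> Obj (N (Suc (Suc n)))" and i: "i \<le> n"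
  shows "ArrMap (d (Suc n) i) (\<alpha> (Suc n) x) = \<alpha> n (ObjMap (d (Suc (Suc n)) i) x)"
  using x i d_d(2)[of i "Suc (Suc n)" n] iota_Arr[OF x] iota_d[of i "Suc n" x, symmetric]
  by (simp add: \<alpha>_def L_d(2)[symmetric] N_mem)

text \<open>The same argument with degeneracies in place of faces; this becomes (C4).\<close>

lemma alpha_s:
  assumes x: "x \<in> Obj (N (Suc n))" and k: "k \<le> n"
  shows "ArrMap (s n k) (\<alpha> n x) = \<alpha> (Suc n) (ObjMap (s (Suc n) k) x)"
  using x k d_s_greater(2)[of k "Suc (Suc n)" n] iota_Arr[OF x] iota_s[of k "Suc n" x, symmetric]
  by (simp add: \<alpha>_def L_s(2)[symmetric] N_mem)

text \<open>On chains ending in zero \<iota> is an identity. This is the first half of (C3), where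
  \<open>d_(n+1) s_n\<close> gives back such a chain.\<close>

lemma alpha_Z:
  assumes x: "x \<in> Obj (N (Suc n))" "x \<in> Z (Suc n)"
  shows "\<alpha> n x = Idt (N n) (ObjMap (L n) (ObjMap (d (Suc n) (Suc n)) x))"
  using iotaN_eq[OF x] is_functor.ArrMap_Idt[OF d_functor x(1), of "Suc n"]
    is_functor.ArrMap_Idt[OF LN_functor, of "ObjMap (d (Suc n) (Suc n)) x"] N_mem(1)[OF _ x(1), of "Suc n"]
  by (simp add: \<alpha>_def)

text \<open>Here \<iota> need not be an identity, but the last face undoes \<open>s_n\<close> and
  leaves \<open>L\<close> of \<iota>, which is one. This is the second half of (C3).\<close>

lemma alpha_s_top:
  assumes x: "x \<in> Obj (N n)"
  shows "\<alpha> n (ObjMap (s n n) x) = Idt (N n) (ObjMap (L n) x)"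
  using iota_s[of n n x] d_s_id(2)[of n n "Suc n"] iota_Arr[OF x] LN_iota[OF x] x
  by (simp add: \<alpha>_def flip: iota_s)

text \<open>The last face followed by \<open>L n\<close>, applied to the naturality square of
  \<iota> at \<open>f\<close>.\<close>

lemma alpha_natural:
  assumes f: "f \<in> hom (N (Suc n)) x y"
  shows "\<alpha> n y \<cdot>\<^bsub>N n\<^esub> ArrMap (L n) (ArrMap (d (Suc n) (Suc n)) (ArrMap (L (Suc n)) f)) =
    ArrMap (L n) (ArrMap (d (Suc n) (Suc n)) f) \<cdot>\<^bsub>N n\<^esub> \<alpha> n x"
proof -
  let ?M = "L n \<odot>\<^bsub>N (Suc n)\<^esub> d (Suc n) (Suc n)"
  have M: "is_functor (N (Suc n)) (N n) ?M" by (rule is_functor_comp[OF d_functor LN_functor]) simp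
  have xy: "x \<in> Obj (N (Suc n))" "y \<in> Obj (N (Suc n))"
    using category.in_hom_Obj[OF category_N f] by auto
  note Lf = is_functor.ArrMap_hom[OF LN_functor f]
  have "ArrMap ?M (\<iota> (Suc n) y) \<cdot>\<^bsub>N n\<^esub> ArrMap ?M (ArrMap (L (Suc n)) f) =
      ArrMap ?M f \<cdot>\<^bsub>N n\<^esub> ArrMap ?M (\<iota> (Suc n) x)"
    using iotaN_natural[OF f] is_functor.ArrMap_Cmp[OF M Lf iotaN_hom[OF xy(2)]]
      is_functor.ArrMap_Cmp[OF M iotaN_hom[OF xy(1)] f] by simp
  moreover have "f \<in> Arr (N (Suc n))" using f by (simp add: hom_def)
  ultimately show ?thesis using xy by (simp add: \<alpha>_def iota_Arr N_mem)
qed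

text \<open>The coherence (C2) is naturality of the counit \<open>\<iota>\<close> at its own components.\<close>

lemma alpha_C2:
  assumes x: "x \<in> Obj (N (Suc (Suc n)))"
  shows "\<alpha> n (ObjMap (d (Suc (Suc n)) (Suc (Suc n))) x) \<cdot>\<^bsub>N n\<^esub>
      ArrMap (L n) (ArrMap (d (Suc n) (Suc n)) (\<alpha> (Suc n) x)) =
    \<alpha> n (ObjMap (d (Suc (Suc n)) (Suc n)) x) \<cdot>\<^bsub>N n\<^esub>
      \<alpha> n (ObjMap (d (Suc (Suc n)) (Suc (Suc n))) (ObjMap (L (Suc (Suc n))) x))"
proof -
  let ?r = "d (Suc (Suc n)) (Suc (Suc n))"
  have r: "ArrMap ?r (\<iota> (Suc (Suc n)) x) \<in>
      hom (N (Suc n)) (ObjMap ?r (ObjMap (L (Suc (Suc n))) x)) (ObjMap ?r x)"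
    by (rule is_functor.ArrMap_hom[OF d_functor iotaN_hom[OF x]]) simp
  have "ArrMap (L n) (ArrMap (d (Suc n) (Suc n)) (ArrMap ?r (\<iota> (Suc (Suc n)) x))) =
      \<alpha> n (ObjMap (d (Suc (Suc n)) (Suc n)) x)"
    using d_d(2)[of "Suc n" "Suc (Suc n)" n, OF _ _ iota_Arr[OF x]] iota_d[of "Suc n" "Suc n" x] x
    by (simp add: \<alpha>_def)
  then show ?thesis using alpha_natural[OF r] by (simp add: \<alpha>_def)
qed

text \<open>The arrows into the final \<open>z\<close> carry no information, as \<open>z\<close> is
  terminal; everything else survives the truncation.\<close>

lemma face_top_inj:
  assumes x: "x \<in> Obj (N (Suc n))" "y \<in> Obj (N (Suc n))" and zz: "x \<in> Z (Suc n)" "y \<in> Z (Suc n)"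
    and e: "ObjMap (d (Suc n) (Suc n)) x = ObjMap (d (Suc n) (Suc n)) y"
  shows "x = y"
proof -
  have F: "is_functor (ord_cat (Suc n)) C x" "is_functor (ord_cat (Suc n)) C y"
    using x by (simp_all add: N_def)
  have o: "ObjMap x i = ObjMap y i" if "i \<le> n" for i
    using arg_cong[OF e, of "\<lambda>u. ObjMap u i"] that F by (simp add: coface_def)
  have o': "ObjMap x i = ObjMap y i" if "i \<le> Suc n" for i
    using o[of i] zz that by (cases "i = Suc n") (auto simp: Z_def)
  have a: "ArrMap x (i, j) = ArrMap y (i, j)" if "i \<le> j" "j \<le> n" for i j
    using arg_cong[OF e, of "\<lambda>u. ArrMap u (i, j)"] that F by (simp add: coface_def)
  show ?thesis
  proof (rule chain_eqI[OF F o'])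
    fix i j assume ij: "i \<le> j" "j \<le> Suc n"
    show "ArrMap x (i, j) = ArrMap y (i, j)"
    proof (cases "j = Suc n")
      case True
      then show ?thesis
        using to_zero_unique chain_hom[OF F(1) ij] chain_hom[OF F(2) ij] o'[of i] zz ij
        by (simp add: Z_def) metis
    next
      case False
      then show ?thesis using a ij by simp
    qed
  qed
qed

lemma category_XL: "category (XL n)"
  unfolding XL_def by (rule category_full_sub[OF category_N])

lemma XF_apply:
  "x \<in> Obj (XL (Suc n)) \<Longrightarrow> ObjMap (XF (Suc n) i) x =
    (if i < Suc n then ObjMap (d (Suc n) i) x else ObjMap (L n) (ObjMap (d (Suc n) (Suc n)) x))"
  "f \<in> Arr (XL (Suc n)) \<Longrightarrow> ArrMap (XF (Suc n) i) f =
    (if i < Suc n then ArrMap (d (Suc n) i) f else ArrMap (L n) (ArrMap (d (Suc n) (Suc n)) f))"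
  by (simp_all add: XF_def DD_apply)

lemma XD_apply:
  "x \<in> Obj (XL n) \<Longrightarrow> ObjMap (XD n j) x = ObjMap (s n j) x"
  "f \<in> Arr (XL n) \<Longrightarrow> ArrMap (XD n j) f = ArrMap (s n j) f"
  by (simp_all add: XD_def)

lemmas X_Obj = XF_functor[THEN is_functor_Obj] XD_functor[THEN is_functor_Obj]

lemma alpha_XL:
  assumes x: "x \<in> Obj (N (Suc n))"
  shows "\<alpha> n x \<in> Arr (XL n)"
  using category.hom_D[OF category_N alpha_hom[OF x]] x L_Z by (simp add: N_mem)

lemma terminal_XL_0: "terminal_cat (XL 0)"
proof -
  define F where "F = mk_chain 0 (\<lambda>_. z) (\<lambda>_ _. Idt C z)"
  have F: "is_functor (ord_cat 0) C F"
    unfolding F_def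
    by (rule is_functor_mk_chain) (auto simp: category_axioms z_Obj Idt_hom Idt_Cmp[OF Idt_hom[OF z_Obj]])
  have Fz: "F \<in> Z 0" by (simp add: Z_def F_def)
  have eq: "G = F" if "is_functor (ord_cat 0) C G" "G \<in> Z 0" for G
    by (rule chain_eqI_Suc) (use that F Fz in \<open>auto simp: Z_def\<close>)
  have ar: "t = (\<lambda>i\<in>{..0}. Idt C z)" if t: "is_nat_trans (ord_cat 0) C F F t" for t
  proof (rule nat_trans_eqI[OF t])
    show "is_nat_trans (ord_cat 0) C F F (\<lambda>i\<in>{..0}. Idt C z)"
      by (rule nat_transI[OF F F]) (auto simp: F_def Idt_hom z_Obj)
    show "t i = (\<lambda>i\<in>{..0}. Idt C z) i" if "i \<le> 0" for i
      using nat_trans_component[OF t, of 0] to_zero_unique[of "t 0" z] that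
      by (simp add: F_def to_zero_z)
  qed
  have "x = F" if "x \<in> Obj (XL 0)" for x
    using eq[of x] that by (simp add: N_def)
  moreover have F0: "F \<in> Obj (XL 0)" using F Fz by (simp add: N_def)
  ultimately have Obj: "Obj (XL 0) = {F}" by blast
  have I: "f = (F, F, \<lambda>i\<in>{..0}. Idt C z)" if f: "f \<in> Arr (XL 0)" for f
  proof -
    obtain G H t where f': "f = (G, H, t)" by (cases f)
    then have t: "is_nat_trans (ord_cat 0) C G H t" and Z: "G \<in> Z 0" "H \<in> Z 0"
      using f by (auto simp: N_def)
    have "G = F" "H = F" using eq Z nat_trans_functors[OF t] by blast+
    then show ?thesis using ar t f' by blast
  qed
  have "Idt (XL 0) F \<in> Arr (XL 0)"
    using category.hom_D[OF category_XL category.Idt_hom[OF category_XL F0]] by blast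
  then have "(F, F, \<lambda>i\<in>{..0}. Idt C z) \<in> Arr (XL 0)" using I by metis
  then have "Arr (XL 0) = {(F, F, \<lambda>i\<in>{..0}. Idt C z)}"
    by (intro equalityI subsetI) (use I in \<open>blast+\<close>)
  then show ?thesis using Obj category_XL unfolding terminal_cat_def by blast
qed

text \<open>Only the top face involves \<open>L\<close>. Where it meets a degeneracy, either the
  chain ends in zero and \<open>L\<close> fixes it, or \<open>L\<close> moves past the degeneracy by
  \<open>L_s\<close>.\<close>

lemma simplicial_base_kerX: "simplicial_base kerX"
proof (intro simplicial_base.intro, unfold kerX_simps)
  fix n i j :: nat
  show "category (XL n)" by (rule category_XL)
  show "is_functor (XL n) (XL (n - 1)) (XF n i)" if "n \<ge> 1" "i \<le> n"
    using that XF_functor[of i "n - 1"] by simp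
  show "is_functor (XL n) (XL (n + 1)) (XD n j)" if "j \<le> n"
    using that XD_functor[of j n] by simp
  show "XD (n + 1) i \<odot>\<^bsub>XL n\<^esub> XD n j = XD (n + 1) (j + 1) \<odot>\<^bsub>XL n\<^esub> XD n i"
    if "i \<le> j" "j \<le> n"
    using that NS.degen_degen[of i j n] by (simp add: XD_XD Lev_N del: Lev_nerve)
  show "XF (n + 1) i \<odot>\<^bsub>XL n\<^esub> XD n j = XD (n - 1) (j - 1) \<odot>\<^bsub>XL n\<^esub> XF n i" if h: "i < j" "j \<le> n"
  proof -
    obtain m where n: "n = Suc m" using h by (cases n) auto
    show ?thesis
      using h NS.face_degen_less[of i j n] unfolding n by (simp add: XF_XD XD_XF DD_def Lev_N del: Lev_nerve)
  qed
  show "XF (n + 1) i \<odot>\<^bsub>XL n\<^esub> XD n j = id_ftor (XL n)" if h: "j \<le> n" "i = j \<or> i = j + 1"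
  proof -
    have "res_ftor (XL n) (DD (Suc n) i \<odot>\<^bsub>N n\<^esub> s n j) = res_ftor (XL n) (id_ftor (N n))"
    proof (rule res_ftor_cong)
      \<comment> \<open>The index \<open>i = Suc n\<close> forces \<open>j = n\<close>; there
        \<open>L\<close> is applied to a chain that ends in zero.\<close>
      have i: "i < Suc n \<or> i = Suc n \<and> j = n" using h by auto
      show "ObjMap (DD (Suc n) i \<odot>\<^bsub>N n\<^esub> s n j) x = ObjMap (id_ftor (N n)) x" if "x \<in> Obj (XL n)" for x
        using i that h d_s_id(1)[of j n i x] by (elim disjE) (simp_all add: DD_apply N_mem L_eq)
      show "ArrMap (DD (Suc n) i \<odot>\<^bsub>N n\<^esub> s n j) f = ArrMap (id_ftor (N n)) f" if "f \<in> Arr (XL n)" for f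
        using i that h d_s_id(2)[of j n i f] by (elim disjE) (simp_all add: DD_apply N_mem L_eq)
    qed
    then show ?thesis using h res_id_ftor[of "N n" "Z n", folded XL_def] by (simp add: XF_XD)
  qed
  show "XF (n + 1) i \<odot>\<^bsub>XL n\<^esub> XD n j = XD (n - 1) j \<odot>\<^bsub>XL n\<^esub> XF n (i - 1)"
    if h: "j + 1 < i" "i \<le> n + 1"
  proof -
    obtain m where n: "n = Suc m" using h by (cases n) auto
    have "res_ftor (XL n) (DD (Suc n) i \<odot>\<^bsub>N n\<^esub> s n j) =
        res_ftor (XL n) (s m j \<odot>\<^bsub>N n\<^esub> DD n (i - 1))"
      unfolding n by (rule res_ftor_cong)
        (use h n d_s_greater[of j i m] in \<open>auto simp: DD_apply N_mem L_s le_Suc_eq\<close>)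
    then show ?thesis using h n by (simp add: XF_XD XD_XF)
  qed
qed

lemma supercoherent_kerX: "almost_strict_supercoherent kerX"
proof (intro almost_strict_supercoherent.intro almost_strict_supercoherent_axioms.intro simplicial_base_kerX,
    unfold kerX_simps)
  show "terminal_cat (XL 0)" by (rule terminal_XL_0)
next
  fix n i j :: nat
  assume h: "2 \<le> n" "i < j" "j \<le> n" "\<not> (i = n - 1 \<and> j = n)"
  then obtain m where n: "n = Suc (Suc m)" by (metis Suc_le_D numeral_2_eq_2 Suc_le_mono)
  have "res_ftor (XL n) (DD (Suc m) i \<odot>\<^bsub>N n\<^esub> DD n j) =
      res_ftor (XL n) (DD (Suc m) (j - 1) \<odot>\<^bsub>N n\<^esub> DD n i)"
  proof (rule res_ftor_cong)
    show "ObjMap (DD (Suc m) i \<odot>\<^bsub>N n\<^esub> DD n j) x = ObjMap (DD (Suc m) (j - 1) \<odot>\<^bsub>N n\<^esub> DD n i) x"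
      if "x \<in> Obj (XL n)" for x
    \<comment> \<open>For \<open>j = n\<close> the exclusion of \<open>i = n - 1\<close> leaves
      \<open>i \<le> m\<close>, so \<open>d_i\<close> preserves the last vertex and passes through
      \<open>L\<close>.\<close>
    proof (cases "j = n")
      case True
      then show ?thesis
        using that h n d_d(1)[of i n m x] L_d(1)[of i m "ObjMap (d n n) x"]
        by (simp add: DD_apply N_mem)
    next
      case False
      then have "j < n" "i < Suc m" "j - 1 < Suc m" using h n by auto
      then show ?thesis using that h n d_d(1)[of i j m x] by (simp add: DD_apply N_mem)
    qed
    show "ArrMap (DD (Suc m) i \<odot>\<^bsub>N n\<^esub> DD n j) f = ArrMap (DD (Suc m) (j - 1) \<odot>\<^bsub>N n\<^esub> DD n i) f"
      if "f \<in> Arr (XL n)" for f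
    proof (cases "j = n")
      case True
      then show ?thesis
        using that h n d_d(2)[of i n m f] L_d(2)[of i m "ArrMap (d n n) f"]
        by (simp add: DD_apply N_mem)
    next
      case False
      then have "j < n" "i < Suc m" "j - 1 < Suc m" using h n by auto
      then show ?thesis using that h n d_d(2)[of i j m f] by (simp add: DD_apply N_mem)
    qed
  qed
  then show "XF (n - 1) i \<odot>\<^bsub>XL n\<^esub> XF n j = XF (n - 1) (j - 1) \<odot>\<^bsub>XL n\<^esub> XF n i"
    using h n by (simp add: XF_XF)
next
  fix n :: nat
  assume "2 \<le> n"
  then obtain m where n: "n = Suc (Suc m)" by (metis Suc_le_D numeral_2_eq_2 Suc_le_mono)
  have FG: "is_functor (XL n) (XL m) (XF (Suc m) (Suc m) \<odot>\<^bsub>XL n\<^esub> XF n j)" if "j \<le> n" for j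
    unfolding n by (rule is_functor_comp[OF XF_functor XF_functor]) (use that n in auto)
  \<comment> \<open>Both composites are expressed by the truncated chain \<open>d n n x\<close>; for
    the second this uses the nerve identity between the last two faces, which is strict.\<close>
  have obj: "ObjMap (XF (Suc m) (Suc m) \<odot>\<^bsub>XL n\<^esub> XF n n) x =
        ObjMap (L m) (ObjMap (d (Suc m) (Suc m)) (ObjMap (L (Suc m)) (ObjMap (d n n) x)))"
      "ObjMap (XF (Suc m) (Suc m) \<odot>\<^bsub>XL n\<^esub> XF n (Suc m)) x =
        ObjMap (L m) (ObjMap (d (Suc m) (Suc m)) (ObjMap (d n n) x))"
    if "x \<in> Obj (XL n)" for x
    using that d_d(1)[of "Suc m" n m x] n by (simp_all add: XF_XF DD_apply N_mem)
  have arr: "ArrMap (XF (Suc m) (Suc m) \<odot>\<^bsub>XL n\<^esub> XF n n) f =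
        ArrMap (L m) (ArrMap (d (Suc m) (Suc m)) (ArrMap (L (Suc m)) (ArrMap (d n n) f)))"
      "ArrMap (XF (Suc m) (Suc m) \<odot>\<^bsub>XL n\<^esub> XF n (Suc m)) f =
        ArrMap (L m) (ArrMap (d (Suc m) (Suc m)) (ArrMap (d n n) f))"
    if "f \<in> Arr (XL n)" for f
    using that d_d(2)[of "Suc m" n m f] n by (simp_all add: XF_XF DD_apply N_mem)
  have "is_nat_trans (XL n) (XL m) (XF (Suc m) (Suc m) \<odot>\<^bsub>XL n\<^esub> XF n n)
      (XF (Suc m) (Suc m) \<odot>\<^bsub>XL n\<^esub> XF n (Suc m)) (\<lambda>x\<in>Obj (XL n). \<alpha> m (ObjMap (d n n) x))"
  proof (intro is_nat_trans.intro FG is_nat_trans_axioms.intro)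
    show "n \<le> n" "Suc m \<le> n" using n by auto
    show "(\<lambda>x\<in>Obj (XL n). \<alpha> m (ObjMap (d n n) x)) \<in> extensional (Obj (XL n))" by simp
    fix x assume x: "x \<in> Obj (XL n)"
    then have "ObjMap (d n n) x \<in> Obj (N (Suc m))" unfolding n by (simp add: N_mem)
    from alpha_hom[OF this] L_Z show "(\<lambda>x\<in>Obj (XL n). \<alpha> m (ObjMap (d n n) x)) x \<in>
        hom (XL m) (ObjMap (XF (Suc m) (Suc m) \<odot>\<^bsub>XL n\<^esub> XF n n) x)
          (ObjMap (XF (Suc m) (Suc m) \<odot>\<^bsub>XL n\<^esub> XF n (Suc m)) x)"
      using x unfolding obj[OF x] by (simp add: hom_XL n N_mem)
  next
    fix f x y assume f: "f \<in> hom (XL n) x y"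
    then have xy: "x \<in> Obj (XL n)" "y \<in> Obj (XL n)" "f \<in> Arr (XL n)"
      using category.in_hom_Obj[OF category_XL f] category.hom_D[OF category_XL f] by auto
    have "ArrMap (d n n) f \<in> hom (N (Suc m)) (ObjMap (d n n) x) (ObjMap (d n n) y)"
      using f unfolding hom_XL n by (auto intro: is_functor.ArrMap_hom[OF d_functor])
    from alpha_natural[OF this]
    show "(\<lambda>x\<in>Obj (XL n). \<alpha> m (ObjMap (d n n) x)) y \<cdot>\<^bsub>XL m\<^esub>
          ArrMap (XF (Suc m) (Suc m) \<odot>\<^bsub>XL n\<^esub> XF n n) f =
        ArrMap (XF (Suc m) (Suc m) \<odot>\<^bsub>XL n\<^esub> XF n (Suc m)) f \<cdot>\<^bsub>XL m\<^esub>
          (\<lambda>x\<in>Obj (XL n). \<alpha> m (ObjMap (d n n) x)) x"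
      using xy unfolding arr[OF xy(3)] by simp
  qed
  then show "is_nat_trans (XL n) (XL (n - 2)) (XF (n - 1) (n - 1) \<odot>\<^bsub>XL n\<^esub> XF n n)
      (XF (n - 1) (n - 1) \<odot>\<^bsub>XL n\<^esub> XF n (n - 1)) (\<lambda>x\<in>Obj (XL n). \<alpha> (n - 2) (ObjMap (d n n) x))"
    using n by simp
next
  fix n i :: nat
  assume h: "3 \<le> n" "i \<le> n - 3"
  define m where "m = n - 3"
  have n: "n = Suc (Suc (Suc m))" using h by (simp add: m_def)
  show "whisker_left (XL n) (XF (n - 2) i) (\<lambda>x\<in>Obj (XL n). \<alpha> (n - 2) (ObjMap (d n n) x)) =
    whisker_right (XL n) (\<lambda>x\<in>Obj (XL (n - 1)). \<alpha> (n - 1 - 2) (ObjMap (d (n - 1) (n - 1)) x)) (XF n i)"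
    unfolding whisker_left_def whisker_right_def
  proof (rule restrict_ext)
    fix x assume x: "x \<in> Obj (XL n)"
    then have xN: "x \<in> Obj (N n)" by simp
    then have x': "ObjMap (d n n) x \<in> Obj (N (Suc (Suc m)))" unfolding n by (simp add: N_mem)
    \<comment> \<open>Truncation commutes with \<open>d_i\<close>, so (C1) at \<open>x\<close> is
      \<open>alpha_d\<close> at the truncated chain.\<close>
    show "ArrMap (XF (n - 2) i) ((\<lambda>x\<in>Obj (XL n). \<alpha> (n - 2) (ObjMap (d n n) x)) x) =
        (\<lambda>x\<in>Obj (XL (n - 1)). \<alpha> (n - 1 - 2) (ObjMap (d (n - 1) (n - 1)) x)) (ObjMap (XF n i) x)"
      using x xN h alpha_XL[OF x'] alpha_d[OF x', of i] X_Obj(1)[of i "Suc (Suc m)" x]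
        d_d(1)[of i n "Suc m" x] unfolding n
      by (simp add: XF_apply del: XL_simps(1,2))
  qed
next
  fix n :: nat
  assume h: "3 \<le> n"
  define m where "m = n - 3"
  have n: "n = Suc (Suc (Suc m))" using h by (simp add: m_def)
  show "vcomp (XL n) (XL (n - 3))
      (whisker_right (XL n) (\<lambda>x\<in>Obj (XL (n - 1)). \<alpha> (n - 1 - 2) (ObjMap (d (n - 1) (n - 1)) x))
        (XF n (n - 1)))
      (whisker_left (XL n) (XF (n - 2) (n - 2)) (\<lambda>x\<in>Obj (XL n). \<alpha> (n - 2) (ObjMap (d n n) x))) =
    vcomp (XL n) (XL (n - 3))
      (whisker_right (XL n) (\<lambda>x\<in>Obj (XL (n - 1)). \<alpha> (n - 1 - 2) (ObjMap (d (n - 1) (n - 1)) x))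
        (XF n (n - 2)))
      (whisker_right (XL n) (\<lambda>x\<in>Obj (XL (n - 1)). \<alpha> (n - 1 - 2) (ObjMap (d (n - 1) (n - 1)) x))
        (XF n n))"
    unfolding vcomp_def
  proof (rule restrict_ext)
    fix x assume x: "x \<in> Obj (XL n)"
    then have xN: "x \<in> Obj (N n)" by simp
    then have x': "ObjMap (d n n) x \<in> Obj (N (Suc (Suc m)))" unfolding n by (simp add: N_mem)
    note mem = X_Obj(1)[of _ "Suc (Suc m)" x, OF _ x[unfolded n]]
    \<comment> \<open>After truncation the faces \<open>n - 1\<close> and \<open>n - 2\<close> of
      \<open>x\<close> become the last two faces of \<open>d n n x\<close>, and the claim is
      \<open>alpha_C2\<close> at that chain.\<close>
    show "whisker_right (XL n) (\<lambda>x\<in>Obj (XL (n - 1)). \<alpha> (n - 1 - 2) (ObjMap (d (n - 1) (n - 1)) x))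
        (XF n (n - 1)) x \<cdot>\<^bsub>XL (n - 3)\<^esub>
        whisker_left (XL n) (XF (n - 2) (n - 2)) (\<lambda>x\<in>Obj (XL n). \<alpha> (n - 2) (ObjMap (d n n) x)) x =
      whisker_right (XL n) (\<lambda>x\<in>Obj (XL (n - 1)). \<alpha> (n - 1 - 2) (ObjMap (d (n - 1) (n - 1)) x))
        (XF n (n - 2)) x \<cdot>\<^bsub>XL (n - 3)\<^esub>
      whisker_right (XL n) (\<lambda>x\<in>Obj (XL (n - 1)). \<alpha> (n - 1 - 2) (ObjMap (d (n - 1) (n - 1)) x))
        (XF n n) x"
      using x xN alpha_XL[OF x'] alpha_C2[OF x'] mem[of n] mem[of "n - 1"] mem[of "n - 2"]
        d_d(1)[of "Suc m" n "Suc m" x] d_d(1)[of "Suc (Suc m)" n "Suc m" x] unfolding n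
      by (simp add: XF_apply whisker_left_def whisker_right_def del: XL_simps(1,2))
  qed
next
  fix n :: nat
  assume h: "1 \<le> n"
  define m where "m = n - 1"
  have n: "n = Suc m" using h by (simp add: m_def)
  show "whisker_right (XL n) (\<lambda>x\<in>Obj (XL (n + 1)). \<alpha> (n + 1 - 2) (ObjMap (d (n + 1) (n + 1)) x)) (XD n n) =
    id_nat (XL n) (XL (n - 1)) (XF n n)"
    unfolding whisker_right_def id_nat_def
  proof (rule restrict_ext)
    fix x assume x: "x \<in> Obj (XL n)"
    show "(\<lambda>x\<in>Obj (XL (n + 1)). \<alpha> (n + 1 - 2) (ObjMap (d (n + 1) (n + 1)) x)) (ObjMap (XD n n) x) =
        Idt (XL (n - 1)) (ObjMap (XF n n) x)"
      using x X_Obj(2)[of n n x] d_s_id(1)[of n n "Suc n" x] alpha_Z[of x m] unfolding n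
      by (simp add: XF_apply XD_apply)
  qed
  show "whisker_right (XL n) (\<lambda>x\<in>Obj (XL (n + 1)). \<alpha> (n + 1 - 2) (ObjMap (d (n + 1) (n + 1)) x))
      (XD n (n - 1)) = id_nat (XL n) (XL (n - 1)) (XF n n)"
    unfolding whisker_right_def id_nat_def
  proof (rule restrict_ext)
    \<comment> \<open>Truncating \<open>s_(n-1) x\<close> gives a chain that is degenerate at its
      last vertex, the case of \<open>alpha_s_top\<close>.\<close>
    fix x assume x: "x \<in> Obj (XL n)"
    show "(\<lambda>x\<in>Obj (XL (n + 1)). \<alpha> (n + 1 - 2) (ObjMap (d (n + 1) (n + 1)) x)) (ObjMap (XD n (n - 1)) x) =
        Idt (XL (n - 1)) (ObjMap (XF n n) x)"
      using x X_Obj(2)[of m n x] d_s_greater(1)[of m "Suc n" m x] alpha_s_top[of "ObjMap (d n n) x" m]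
      unfolding n by (simp add: XF_apply XD_apply N_mem)
  qed
next
  fix n k :: nat
  assume h: "2 \<le> n" "k \<le> n - 2"
  define m where "m = n - 2"
  have n: "n = Suc (Suc m)" using h by (simp add: m_def)
  show "whisker_right (XL n) (\<lambda>x\<in>Obj (XL (n + 1)). \<alpha> (n + 1 - 2) (ObjMap (d (n + 1) (n + 1)) x)) (XD n k) =
    whisker_left (XL n) (XD (n - 2) k) (\<lambda>x\<in>Obj (XL n). \<alpha> (n - 2) (ObjMap (d n n) x))"
    unfolding whisker_right_def whisker_left_def
  proof (rule restrict_ext)
    fix x assume x: "x \<in> Obj (XL n)"
    then have x': "ObjMap (d n n) x \<in> Obj (N (Suc m))" unfolding n by (simp add: N_mem)
    show "(\<lambda>x\<in>Obj (XL (n + 1)). \<alpha> (n + 1 - 2) (ObjMap (d (n + 1) (n + 1)) x)) (ObjMap (XD n k) x) =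
        ArrMap (XD (n - 2) k) ((\<lambda>x\<in>Obj (XL n). \<alpha> (n - 2) (ObjMap (d n n) x)) x)"
      using x h X_Obj(2)[of k n x] d_s_greater(1)[of k "Suc n" "Suc m" x] alpha_s[OF x', of k]
        alpha_XL[OF x'] unfolding n
      by (simp add: XD_apply del: XL_simps(1,2)) simp
  qed
qed


section \<open>Dropping the final zero: the isomorphism with the nerve\<close>

definition Q where "Q n = res_ftor (XL (Suc n)) (d (Suc n) (Suc n))"

lemma Q_functor: "is_functor (XL (Suc n)) (N n) (Q n)"
proof -
  \<comment> \<open>\<open>is_functor_res\<close> lands in a full subcategory; with
    \<open>UNIV\<close> this is the whole level of the nerve.\<close>
  have "full_sub (N n) UNIV = N n" by (simp add: full_sub_def)
  then show ?thesis
    using is_functor_res[OF d_functor[of "Suc n" n], of "Z (Suc n)" UNIV] by (simp add: Q_def XL_def)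
qed

lemma Q_apply:
  "x \<in> Obj (XL (Suc n)) \<Longrightarrow> ObjMap (Q n) x = ObjMap (d (Suc n) (Suc n)) x"
  "f \<in> Arr (XL (Suc n)) \<Longrightarrow> ArrMap (Q n) f = ArrMap (d (Suc n) (Suc n)) f"
  by (simp_all add: Q_def)

lemma Q_surj_Obj:
  assumes "F \<in> Obj (N n)"
  shows "\<exists>x \<in> Obj (XL (Suc n)). ObjMap (d (Suc n) (Suc n)) x = F"
proof -
  have F: "is_functor (ord_cat n) C F" using assms by (simp add: N_def)
  \<comment> \<open>The chain is extended by a last vertex \<open>z\<close> with the only possible
    arrows into it; the identity of the new vertex is \<open>to_zero C z z\<close>.\<close>
  define ob where "ob i = (if i \<le> n then ObjMap F i else z)" for i
  define ar where "ar i j = (if j \<le> n then ArrMap F (i, j) else to_zero C z (ob i))" for i j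
  let ?P = "mk_chain (Suc n) ob ar"
  have ob: "ob i \<in> Obj C" for i using chain_Obj[OF F] z_Obj by (simp add: ob_def)
  have ar: "ar i j \<in> hom C (ob i) (ob j)" if "i \<le> j" for i j
    using that chain_hom[OF F, of i j] to_zero_hom[OF ob[of i]] by (simp add: ar_def ob_def)
  have P: "is_functor (ord_cat (Suc n)) C ?P"
  proof (rule is_functor_mk_chain[OF category_axioms])
    show "ob i \<in> Obj C" "i \<le> j \<Longrightarrow> ar i j \<in> hom C (ob i) (ob j)" for i j
      using ob ar by auto
    show "ar i i = Idt C (ob i)" for i
      using chain_Idt[OF F, of i] by (simp add: ar_def ob_def to_zero_z)
    show "ar j k \<cdot> ar i j = ar i k" if ijk: "i \<le> j" "j \<le> k" for i j k
    proof (cases "k \<le> n")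
      case True
      then show ?thesis using ijk chain_Cmp[OF F ijk True] by (simp add: ar_def)
    next
      case False
      then show ?thesis
        using to_zero_unique[of "ar j k \<cdot> ar i j" "ob i"] Cmp_hom[OF ar[OF ijk(1)] ar[OF ijk(2)]]
        by (simp add: ar_def[of i k] ob_def[of k])
    qed
  qed
  have "ObjMap (d (Suc n) (Suc n)) ?P = F"
    by (rule chain_eqI[OF _ F])
      (use P N_mem(1)[of "Suc n" n ?P] in \<open>simp_all add: N_def coface_def ob_def ar_def\<close>)
  moreover have "?P \<in> Obj (XL (Suc n))" using P by (simp add: N_def Z_def ob_def)
  ultimately show ?thesis by blast
qed

lemma XL_ArrE:
  assumes "f \<in> Arr (XL n)"
  obtains F G t where "f = (F, G, t)" "is_nat_trans (ord_cat n) C F G t"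
    "is_functor (ord_cat n) C F" "is_functor (ord_cat n) C G" "F \<in> Z n" "G \<in> Z n"
proof -
  obtain F G t where f: "f = (F, G, t)" by (cases f)
  have "is_nat_trans (ord_cat n) C F G t" "F \<in> Z n" "G \<in> Z n" using assms by (simp_all add: f N_def)
  with f that nat_trans_functors show ?thesis by blast
qed

text \<open>Source and target are recovered by \<open>face_top_inj\<close>; the only component lost
  by truncation is an arrow into \<open>z\<close>.\<close>

lemma Q_inj_Arr:
  assumes f: "f \<in> Arr (XL (Suc n))" and g: "g \<in> Arr (XL (Suc n))"
    and e: "ArrMap (d (Suc n) (Suc n)) f = ArrMap (d (Suc n) (Suc n)) g"
  shows "f = g"
proof -
  from f obtain F G t where f': "f = (F, G, t)" and t: "is_nat_trans (ord_cat (Suc n)) C F G t"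
    and FG: "is_functor (ord_cat (Suc n)) C F" "is_functor (ord_cat (Suc n)) C G"
    and Z: "F \<in> Z (Suc n)" "G \<in> Z (Suc n)" by (rule XL_ArrE)
  from g obtain F' G' t' where g': "g = (F', G', t')" and t': "is_nat_trans (ord_cat (Suc n)) C F' G' t'"
    and FG': "is_functor (ord_cat (Suc n)) C F'" "is_functor (ord_cat (Suc n)) C G'"
    and Z': "F' \<in> Z (Suc n)" "G' \<in> Z (Suc n)" by (rule XL_ArrE)
  have eq: "F = F'" "G = G'"
    using e face_top_inj[of F n F'] face_top_inj[of G n G'] t t' FG FG' Z Z'
    by (simp_all add: f' g' N_def face_nerve)
  have "t i = t' i" if "i \<le> Suc n" for i
  proof (cases "i = Suc n")
    case True
    then show ?thesis
      using to_zero_unique[of "t i" z] to_zero_unique[of "t' i" z] Z Z'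
        nat_trans_component[OF t that] nat_trans_component[OF t' that] by (simp add: Z_def)
  next
    case False
    then show ?thesis
      using that arg_cong[OF e, of "\<lambda>u. snd (snd u) i"] t t' by (simp add: f' g' coface_def)
  qed
  then have "t = t'" using nat_trans_eqI[OF t t'] by blast
  then show ?thesis using eq f' g' by simp
qed

lemma Q_surj_Arr:
  assumes f: "f \<in> Arr (N n)"
  shows "\<exists>g \<in> Arr (XL (Suc n)). ArrMap (d (Suc n) (Suc n)) g = f"
proof -
  obtain F G t where f': "f = (F, G, t)" by (cases f)
  have t: "is_nat_trans (ord_cat n) C F G t" using f by (simp add: f' N_def)
  obtain P where P: "P \<in> Obj (XL (Suc n))" "ObjMap (d (Suc n) (Suc n)) P = F"
    using Q_surj_Obj[of F n] nat_trans_functors[OF t] by (auto simp: N_def)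
  obtain R where R: "R \<in> Obj (XL (Suc n))" "ObjMap (d (Suc n) (Suc n)) R = G"
    using Q_surj_Obj[of G n] nat_trans_functors[OF t] by (auto simp: N_def)
  have F: "is_functor (ord_cat (Suc n)) C P" "is_functor (ord_cat (Suc n)) C R"
    "ObjMap P (Suc n) = z" "ObjMap R (Suc n) = z"
    using P R by (simp_all add: N_def Z_def)
  have P': "ObjMap F i = ObjMap P i" "ObjMap G i = ObjMap R i" if "i \<le> n" for i
    using that F P(2)[symmetric] R(2)[symmetric] by (simp_all add: coface_def)
  have PA: "ArrMap F (i, j) = ArrMap P (i, j)" "ArrMap G (i, j) = ArrMap R (i, j)"
    if "i \<le> j" "j \<le> n" for i j
    using that F P(2)[symmetric] R(2)[symmetric] by (simp_all add: coface_def)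
  \<comment> \<open>The new component has to be the identity of \<open>z\<close>, and the new square
    commutes because \<open>z\<close> is terminal.\<close>
  define u where "u i = (if i \<le> n then t i else Idt C z)" for i
  have u: "u i \<in> hom C (ObjMap P i) (ObjMap R i)" if "i \<le> Suc n" for i
    using that nat_trans_component[OF t, of i] P'[of i] F(3,4) Idt_hom[OF z_Obj]
    by (cases "i = Suc n") (simp_all add: u_def)
  have ut: "is_nat_trans (ord_cat (Suc n)) C P R (\<lambda>i\<in>{..Suc n}. u i)"
  proof (rule nat_transI[OF F(1,2) u])
    fix i assume i: "i < Suc n"
    then have i': "i \<le> Suc i" "Suc i \<le> Suc n" "i \<le> Suc n" by auto
    show "u (Suc i) \<cdot> ArrMap P (i, Suc i) = ArrMap R (i, Suc i) \<cdot> u i"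
    proof (cases "i = n")
      case True
      note h = Cmp_hom[OF chain_hom[OF F(1) i'(1,2)] u[OF i'(2)]]
        Cmp_hom[OF u[OF i'(3)] chain_hom[OF F(2) i'(1,2)]]
      have "ObjMap R (Suc i) = z" using True F(4) by simp
      then show ?thesis using h to_zero_unique by metis
    next
      case False
      then show ?thesis
        using i nat_trans_naturality[OF t, of i "Suc i"] PA[of i "Suc i"] by (simp add: u_def)
    qed
  qed
  have "ArrMap (d (Suc n) (Suc n)) (P, R, \<lambda>i\<in>{..Suc n}. u i) = f"
  proof -
    let ?w = "ArrMap (d (Suc n) (Suc n)) (P, R, \<lambda>i\<in>{..Suc n}. u i)"
    have "(P, R, \<lambda>i\<in>{..Suc n}. u i) \<in> hom (N (Suc n)) P R"
      using ut by (simp add: N_def fun_cat_hom)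
    then have "?w \<in> hom (N n) F G"
      using is_functor.ArrMap_hom[OF d_functor[of "Suc n" n]] P(2) R(2) by auto
    then obtain v where w: "?w = (F, G, v)" and v: "is_nat_trans (ord_cat n) C F G v"
      unfolding N_def fun_cat_hom by blast
    have "v = t"
    proof (rule nat_trans_eqI[OF v t])
      show "v i = t i" if "i \<le> n" for i
        using arg_cong[OF w, of "\<lambda>q. snd (snd q) i"] face_nerve_simps(3)[OF ut that] that
        by (simp add: coface_def u_def)
    qed
    then show ?thesis using w f' by simp
  qed
  moreover have "(P, R, \<lambda>i\<in>{..Suc n}. u i) \<in> Arr (XL (Suc n))"
    using ut P R by (simp add: N_def)
  ultimately show ?thesis by blast
qed

lemma Q_inverse:
  "\<exists>G. is_functor (N n) (XL (Suc n)) G \<and> Q n \<odot>\<^bsub>N n\<^esub> G = id_ftor (N n) \<and>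
     G \<odot>\<^bsub>XL (Suc n)\<^esub> Q n = id_ftor (XL (Suc n))"
proof (rule inverse_functor[OF Q_functor])
  show "bij_betw (ObjMap (Q n)) (Obj (XL (Suc n))) (Obj (N n))"
    unfolding bij_betw_def
  proof (intro conjI inj_onI equalityI subsetI)
    show "x = y" if "x \<in> Obj (XL (Suc n))" "y \<in> Obj (XL (Suc n))" "ObjMap (Q n) x = ObjMap (Q n) y" for x y
      using that face_top_inj[of x n y] by (simp add: Q_apply)
    show "y \<in> Obj (N n)" if "y \<in> ObjMap (Q n) ` Obj (XL (Suc n))" for y
      using that is_functor_Obj[OF Q_functor] by blast
    show "y \<in> ObjMap (Q n) ` Obj (XL (Suc n))" if "y \<in> Obj (N n)" for y
      using Q_surj_Obj[OF that] Q_apply(1) by (metis imageI)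
  qed
  show "bij_betw (ArrMap (Q n)) (Arr (XL (Suc n))) (Arr (N n))"
    unfolding bij_betw_def
  proof (intro conjI inj_onI equalityI subsetI)
    show "f = g" if "f \<in> Arr (XL (Suc n))" "g \<in> Arr (XL (Suc n))" "ArrMap (Q n) f = ArrMap (Q n) g" for f g
      using that Q_inj_Arr[of f n g] by (simp add: Q_apply del: XL_simps)
    show "g \<in> Arr (N n)" if "g \<in> ArrMap (Q n) ` Arr (XL (Suc n))" for g
      using that is_functor_Arr[OF Q_functor] by blast
    show "g \<in> ArrMap (Q n) ` Arr (XL (Suc n))" if "g \<in> Arr (N n)" for g
      using Q_surj_Arr[OF that] Q_apply(2) by (metis imageI)
  qed
qed

text \<open>The relation is \<open>d_i d_(n+2) = d_(n+1) d_i\<close> in the nerve. By the bound on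
  \<open>i\<close> the face \<open>XF\<close> is not the top one, so no \<open>L\<close>
  occurs.\<close>

lemma Q_d:
  assumes "i \<le> Suc n"
  shows "x \<in> Obj (XL (Suc (Suc n))) \<Longrightarrow>
      ObjMap (d (Suc n) i) (ObjMap (Q (Suc n)) x) = ObjMap (Q n) (ObjMap (XF (Suc (Suc n)) i) x)"
    and "f \<in> Arr (XL (Suc (Suc n))) \<Longrightarrow>
      ArrMap (d (Suc n) i) (ArrMap (Q (Suc n)) f) = ArrMap (Q n) (ArrMap (XF (Suc (Suc n)) i) f)"
proof -
  show "x \<in> Obj (XL (Suc (Suc n))) \<Longrightarrow>
      ObjMap (d (Suc n) i) (ObjMap (Q (Suc n)) x) = ObjMap (Q n) (ObjMap (XF (Suc (Suc n)) i) x)"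
    using assms d_d(1)[of i "Suc (Suc n)" n x] is_functor_Obj[OF XF_functor, of i "Suc n" x]
    by (simp add: Q_apply XF_apply)
  show "f \<in> Arr (XL (Suc (Suc n))) \<Longrightarrow>
      ArrMap (d (Suc n) i) (ArrMap (Q (Suc n)) f) = ArrMap (Q n) (ArrMap (XF (Suc (Suc n)) i) f)"
    using assms d_d(2)[of i "Suc (Suc n)" n f] is_functor_Arr[OF XF_functor, of i "Suc n" f]
    by (simp add: Q_apply XF_apply)
qed

lemma Q_s:
  assumes "j \<le> n"
  shows "x \<in> Obj (XL (Suc n)) \<Longrightarrow>
      ObjMap (s n j) (ObjMap (Q n) x) = ObjMap (Q (Suc n)) (ObjMap (XD (Suc n) j) x)"
    and "f \<in> Arr (XL (Suc n)) \<Longrightarrow>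
      ArrMap (s n j) (ArrMap (Q n) f) = ArrMap (Q (Suc n)) (ArrMap (XD (Suc n) j) f)"
proof -
  show "x \<in> Obj (XL (Suc n)) \<Longrightarrow>
      ObjMap (s n j) (ObjMap (Q n) x) = ObjMap (Q (Suc n)) (ObjMap (XD (Suc n) j) x)"
    using assms d_s_greater(1)[of j "Suc (Suc n)" n x] is_functor_Obj[OF XD_functor, of j "Suc n" x]
    by (simp add: Q_apply XD_apply)
  show "f \<in> Arr (XL (Suc n)) \<Longrightarrow>
      ArrMap (s n j) (ArrMap (Q n) f) = ArrMap (Q (Suc n)) (ArrMap (XD (Suc n) j) f)"
    using assms d_s_greater(2)[of j "Suc (Suc n)" n f] is_functor_Arr[OF XD_functor, of j "Suc n" f]
    by (simp add: Q_apply XD_apply)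
qed

lemma nerve_iso_dec_kerX: "\<exists>\<Phi>. simplicial_iso (nerve C) (dec kerX) \<Phi>"
proof -
  obtain \<Phi> where \<Phi>: "\<And>n. is_functor (N n) (XL (Suc n)) (\<Phi> n)"
    "\<And>n. Q n \<odot>\<^bsub>N n\<^esub> \<Phi> n = id_ftor (N n)" "\<And>n. \<Phi> n \<odot>\<^bsub>XL (Suc n)\<^esub> Q n = id_ftor (XL (Suc n))"
    using Q_inverse by metis
  note P = is_functor_Obj[OF \<Phi>(1)] is_functor_Arr[OF \<Phi>(1)]
  note QP = comp_ftor_idD[OF \<Phi>(2)] and PQ = comp_ftor_idD[OF \<Phi>(3)]
  have "simplicial_iso (nerve C) (dec kerX) \<Phi>"
  proof (intro simplicial_iso.intro simplicial_iso_axioms.intro NS.simplicial_object_axioms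
      simplicial_object_dec[OF supercoherent_kerX], unfold dec_simps kerX_simps Lev_N)
    fix n i j :: nat
    show "iso_ftor (N n) (XL (n + 1)) (\<Phi> n)"
      using \<Phi>[of n] Q_functor[of n] unfolding iso_ftor_def by auto
    show "\<Phi> (n - 1) \<odot>\<^bsub>N n\<^esub> d n i = XF (n + 1) i \<odot>\<^bsub>N n\<^esub> \<Phi> n" if h: "n \<ge> 1" "i \<le> n"
    proof -
      obtain m where n: "n = Suc m" using h by (cases n) auto
      have i: "i \<le> Suc m" "i \<le> Suc (Suc m)" using h n by auto
      have "\<Phi> m \<odot>\<^bsub>N (Suc m)\<^esub> d (Suc m) i = XF (Suc (Suc m)) i \<odot>\<^bsub>N (Suc m)\<^esub> \<Phi> (Suc m)"
      \<comment> \<open>Since \<Phi> is inverse to \<open>Q\<close>, compatibility of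
        \<open>Q\<close> with the faces turns into that of \<Phi> by cancelling.\<close>
      proof (rule comp_ftor_cong)
        show "ObjMap (\<Phi> m) (ObjMap (d (Suc m) i) x) = ObjMap (XF (Suc (Suc m)) i) (ObjMap (\<Phi> (Suc m)) x)"
          if x: "x \<in> Obj (N (Suc m))" for x
          using Q_d(1)[OF i(1) P(1)[OF x]] QP(1)[OF x]
            PQ(1)[OF is_functor_Obj[OF XF_functor[OF i(2)] P(1)[OF x]]] by simp
        show "ArrMap (\<Phi> m) (ArrMap (d (Suc m) i) f) = ArrMap (XF (Suc (Suc m)) i) (ArrMap (\<Phi> (Suc m)) f)"
          if f: "f \<in> Arr (N (Suc m))" for f
          using Q_d(2)[OF i(1) P(2)[OF f]] QP(2)[OF f]
            PQ(2)[OF is_functor_Arr[OF XF_functor[OF i(2)] P(2)[OF f]]] by simp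
      qed
      then show ?thesis by (simp add: n)
    qed
    show "\<Phi> (n + 1) \<odot>\<^bsub>N n\<^esub> s n j = XD (n + 1) j \<odot>\<^bsub>N n\<^esub> \<Phi> n" if h: "j \<le> n"
    proof -
      have j: "j \<le> Suc n" using h by simp
      have "\<Phi> (Suc n) \<odot>\<^bsub>N n\<^esub> s n j = XD (Suc n) j \<odot>\<^bsub>N n\<^esub> \<Phi> n"
      proof (rule comp_ftor_cong)
        show "ObjMap (\<Phi> (Suc n)) (ObjMap (s n j) x) = ObjMap (XD (Suc n) j) (ObjMap (\<Phi> n) x)"
          if x: "x \<in> Obj (N n)" for x
          using Q_s(1)[OF h P(1)[OF x]] QP(1)[OF x]
            PQ(1)[OF is_functor_Obj[OF XD_functor[OF j] P(1)[OF x]]] by simp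
        show "ArrMap (\<Phi> (Suc n)) (ArrMap (s n j) f) = ArrMap (XD (Suc n) j) (ArrMap (\<Phi> n) f)"
          if f: "f \<in> Arr (N n)" for f
          using Q_s(2)[OF h P(2)[OF f]] QP(2)[OF f]
            PQ(2)[OF is_functor_Arr[OF XD_functor[OF j] P(2)[OF f]]] by simp
      qed
      then show ?thesis by simp
    qed
  qed
  then show ?thesis by blast
qed

end

text \<open>HOL cannot quantify over types inside a formula. The equivalence therefore fixes the
  carrier types of the nerve, on which the structure built from kernels lives, and the second clause
  gives the converse for structures on arbitrary types.\<close>

theorem theorem26:
  fixes C :: "('o, 'a) cat" and z :: 'o
  assumes "pointed_category C z"
  shows "(has_kernels C z \<longleftrightarrow>
           (\<exists>(X :: (('o, 'a) nerve_obj, ('o, 'a) nerve_arr) supercoh_data) \<Phi>.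
              almost_strict_supercoherent X \<and> simplicial_iso (nerve C) (dec X) \<Phi>)) \<and>
         (\<forall>(X :: ('x, 'y) supercoh_data) \<Phi>.
            almost_strict_supercoherent X \<and> simplicial_iso (nerve C) (dec X) \<Phi> \<longrightarrow>
            has_kernels C z)"
proof (intro conjI iffI allI impI)
  assume "has_kernels C z"
  then obtain \<kappa> where "kernel_choice C z \<kappa>" unfolding has_kernels_def by blast
  then interpret kernels C z \<kappa> by (intro kernels.intro kernels_axioms.intro assms)
  show "\<exists>(X :: (('o, 'a) nerve_obj, ('o, 'a) nerve_arr) supercoh_data) \<Phi>.
      almost_strict_supercoherent X \<and> simplicial_iso (nerve C) (dec X) \<Phi>"
    using supercoherent_kerX nerve_iso_dec_kerX by blast
next
  assume "\<exists>(X :: (('o, 'a) nerve_obj, ('o, 'a) nerve_arr) supercoh_data) \<Phi>.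
      almost_strict_supercoherent X \<and> simplicial_iso (nerve C) (dec X) \<Phi>"
  then obtain X :: "(('o, 'a) nerve_obj, ('o, 'a) nerve_arr) supercoh_data" and \<Phi>
    where X: "almost_strict_supercoherent X" "simplicial_iso (nerve C) (dec X) \<Phi>" by blast
  interpret decalage_iso C z X \<Phi> by (intro decalage_iso.intro assms X)
  show "has_kernels C z" by (rule nerve_has_kernels)
next
  fix X :: "('x, 'y) supercoh_data" and \<Phi>
  assume X: "almost_strict_supercoherent X \<and> simplicial_iso (nerve C) (dec X) \<Phi>"
  interpret decalage_iso C z X \<Phi> by (intro decalage_iso.intro assms conjunct1[OF X] conjunct2[OF X])
  show "has_kernels C z" by (rule nerve_has_kernels)
qed

end
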